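(* Let $k \ge 2$ be an integer, $n = 2^k - 1$, and $d \ge 1$. Choose $s_1,\dots,s_d$ independently and uniformly at random in $\mathit{GL}_k(\mathbb{F}_2)$, and let $G$ be the Schreier graph with vertex set $(\mathbb{F}_2^k)^* = \mathbb{F}_2^k\setminus\{0\}$ in which, for every nonzero vector $x$ and every $j$, there is an edge $\{x, s_j x\}$ (a $2d$-regular multigraph on $n$ vertices). Let $M$ be its normalized adjacency matrix (adjacency matrix divided by $2d$) with eigenvalues ordered as $1=|\mu_1| \ge |\mu_2| \ge \dots \ge |\mu_n|$. For integers $p \ge 1$, $c \ge 0$, $l \ge 0$, $d' \ge 0$ define recursively $$ X_p(c,l, d') = \begin{cases} 1 & \text{if } c = 0 \text{ and } l = 0;\\ 0 & \text{if } p > l;\\ \displaystyle\sum_{i = c}^{\lfloor l/p\rfloor} \binom{d'}{i}\Big(\frac{2^p}{p!}\Big)^i\frac{l!}{(l-pi)!}\,X_{p+1}(0,l-pi, d'-i) & \text{otherwise,} \end{cases} $$ (with $\binom{d'}{i}=0$ for $i>d'$), and set $x_3(i) = X_3(1,2m-2i, d-i)$ and $x_4(i) = X_4(0,2m-2i, d-i)$. Then for every positive integer $m$, \begin{multline*} \mathbf{E}(|\mu_2|) \le \Bigg(\Big(\frac{1}{2d}\Big)^{2m}n\bigg[\sum_{i=1}^m\binom{d}{i}\frac{(2m)!}{(2m-2i)!} \bigg[(2^i-1)(x_3(i) + x_4(i))\frac{2}{n} \\ + \bigg((x_3(i) + x_4(i))\frac{1}{n} +\frac{2^i}{(i+1)!}\Big(x_3(i)\frac{5}{n}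 + x_4(i) \Big)\bigg)\bigg] \\ + X_1(1, 2m, d)\frac{1}{n} + x_3(0)\frac{5}{n} + x_4(0)\bigg]-1\Bigg)^{\frac{1}{2m}}. \end{multline*}
   Context: $(\mathbb{F}_2^k)^*$ denotes the set of nonzero vectors of $\mathbb{F}_2^k$, on which $\mathit{GL}_k(\mathbb{F}_2)$ acts by matrix--vector multiplication. The expectation is over the random choice of $s_1,\dots,s_d$. *)

theory Defs
  imports "HOL-Probability.Probability" "HOL-Library.Z2" "Jordan_Normal_Form.Char_Poly"
begin

definition GL2 :: "nat \<Rightarrow> bit mat set" where
  "GL2 k = {A \<in> carrier_mat k k. invertible_mat A}"

text \<open>Enumeration of the nonzero vectors of F_2^k: index i (i < 2^k - 1) is the
  vector of binary digits of i+1.\<close>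
definition vtx :: "nat \<Rightarrow> nat \<Rightarrow> bit vec" where
  "vtx k i = vec k (\<lambda>j. if bit (Suc i) j then 1 else 0)"

text \<open>Adjacency matrix of the Schreier graph: for every vertex x and every generator s_j
  there is an edge {x, s_j x} (a loop counts 2 towards the degree).\<close>
definition schreier_adj :: "nat \<Rightarrow> bit mat list \<Rightarrow> real mat" where
  "schreier_adj k ss = mat (2^k - 1) (2^k - 1) (\<lambda>(a, b).
      (\<Sum>j<length ss. of_bool (ss ! j *\<^sub>v vtx k a = vtx k b)
                     + of_bool (ss ! j *\<^sub>v vtx k b = vtx k a)))"

definition schreier_norm :: "nat \<Rightarrow> bit mat list \<Rightarrow> real mat" where
  "schreier_norm k ss = (1 / (2 * real (length ss))) \<cdot>\<^sub>m schreier_adj k ss"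

definition eigenvalues_mset :: "real mat \<Rightarrow> complex multiset" where
  "eigenvalues_mset M = proots (char_poly (map_mat complex_of_real M))"

definition abs_mu2 :: "real mat \<Rightarrow> real" where
  "abs_mu2 M = rev (sorted_list_of_multiset (image_mset cmod (eigenvalues_mset M))) ! 1"

function Xp :: "nat \<Rightarrow> nat \<Rightarrow> nat \<Rightarrow> nat \<Rightarrow> real" where
  "Xp p c l d' =
     (if c = 0 \<and> l = 0 then 1
      else if p > l then 0
      else (\<Sum>i = c..l div p. real (d' choose i) * (2 ^ p / fact p) ^ i
              * (fact l / fact (l - p * i)) * Xp (Suc p) 0 (l - p * i) (d' - i)))"
  by pat_completeness auto
termination
  by (relation "Wellfounded.measure (\<lambda>(p, c, l, d'). Suc l - p)") auto

end

theory Submission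
  imports Defs "Jordan_Normal_Form.Schur_Decomposition"
begin

text \<open>
  Trace method. The trace of the \<open>2m\<close>-th power of \<open>M\<close> is, up to the factor \<open>1 / (2d)^(2m)\<close>, the sum
  over all words of length \<open>2m\<close> in the letters \<open>s\<^sub>j\<close> and their inverses of the number of fixed
  points of the word. The mean number of fixed points is at most \<open>1\<close> if some letter occurs once,
  \<open>2\<close> if some letter occurs twice with the same sign, \<open>5\<close> if some letter occurs three times, and
  \<open>n\<close> in any case. If two letters that occur twice with opposite signs cross (\<open>s..t..s..t\<close>), then
  the mean need not be at most \<open>1\<close>: for a commutator it is \<open>n / (n - 1)\<close>. It is however at most
  \<open>1 + 2 / n\<close>, and the same holds after the sign of one occurrence of \<open>s\<close> or of \<open>t\<close> is changed,
  where the bound has room for \<open>2\<close>; since \<open>3 (1 + 2 / n) \<le> 1 + 2 + 2\<close>, the three words together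
  stay within the bound. The all-opposite words without crossing are counted by Catalan numbers.
\<close>

section \<open>Families of permutations acting like the general linear group\<close>

text \<open>For \<open>i\<close> letters that occur twice there are \<open>4 ^ i\<close> sign
  patterns on the same places, of which \<open>2 ^ i\<close> are opposite throughout. This is the
  ratio of \<open>2 ^ i - 1\<close> to 1 in the bound, where the former words are charged 2 each and
  the latter 1. The charge 1 cannot be justified word by word, since a commutator exceeds it for
  every \<open>n\<close>; only a sum over words can hold. The compensating words have to be assigned
  injectively, or one surplus would be spent twice. For this reason the crossing pair is chosen from
  the letters alone, which a change of sign leaves intact.

  The noncrossing all-opposite words are paid with the trivial bound or, if another letter occurs
  three times, with 5; their number, of Catalan type, is the origin of the term
  \<open>2 ^ i / (i + 1)!\<close>.

  The group enters only through the distribution of the images of at most three vectors. Over two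
  elements, three distinct nonzero vectors are independent or one is the sum of the other two, and
  this relation is the obstacle in the estimate of three occurrences: it makes some conditions on
  the generator redundant.\<close>

lemma sum_prod_diff:
  fixes p q :: "'a \<Rightarrow> real" and c :: real
  shows "(\<Sum>t\<in>A. (c - p t) * (c - q t))
     = card A * c\<^sup>2 - c * (\<Sum>t\<in>A. p t) - c * (\<Sum>t\<in>A. q t) + (\<Sum>t\<in>A. p t * q t)"
proof -
  have "(c - p t) * (c - q t) = c\<^sup>2 - c * p t - c * q t + p t * q t" for t
    by (simp add: algebra_simps power2_eq_square)
  then show ?thesis by (simp add: sum.distrib sum_subtractf sum_distrib_left)
qed

text \<open>Here \<open>a\<close> is the number of points and \<open>b\<close> the order of the
  group. The left-hand side is the estimate of \<open>opp_bound\<close> averaged over a second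
  generator, with mean 1 for both inner fixed-point counts and mean 2 for their product.\<close>

lemma opposite_mean_identity:
  fixes a b :: real
  assumes "a \<ge> 3"
  shows "2 * b / a + (b * a\<^sup>2 - a * b - a * b + 2 * b) / (a * (a - 1)) = b * (a / (a - 1))"
proof -
  have "2 * b / a = 2 * b * (a - 1) / (a * (a - 1))" "b * (a / (a - 1)) = b * a * a / (a * (a - 1))" using assms by auto
  moreover have "2 * b * (a - 1) + (b * a\<^sup>2 - a * b - a * b + 2 * b) = b * a * a"
    by (simp add: algebra_simps power2_eq_square)
  ultimately show ?thesis by (metis add_divide_distrib)
qed

text \<open>
  \<open>V\<close> plays the role of the nonzero vectors, so \<open>add\<close> is only controlled for distinct arguments.
  For \<open>card V = 3\<close> the right-hand side of \<open>act3\<close> is the junk value \<open>0\<close>, but then there is no \<open>u''\<close>.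
\<close>

locale vec_action =
  fixes V :: "'v set" and G :: "'g set" and act :: "'g \<Rightarrow> 'v \<Rightarrow> 'v" and add :: "'v \<Rightarrow> 'v \<Rightarrow> 'v"
  assumes finV: "finite V" and finG: "finite G" and G_ne: "G \<noteq> {}"
    and cardV: "card V \<ge> 3"
    and act_bij: "g \<in> G \<Longrightarrow> bij_betw (act g) V V"
    and add_comm: "u \<in> V \<Longrightarrow> v \<in> V \<Longrightarrow> add u v = add v u"
    and add_closed: "u \<in> V \<Longrightarrow> v \<in> V \<Longrightarrow> u \<noteq> v \<Longrightarrow> add u v \<in> V"
    and add_not_closed: "u \<in> V \<Longrightarrow> add u u \<notin> V"
    and add_cancel: "u \<in> V \<Longrightarrow> v \<in> V \<Longrightarrow> add u (add u v) = v"
    and act_add: "g \<in> G \<Longrightarrow> u \<in> V \<Longrightarrow> v \<in> V \<Longrightarrow> act g (add u v) = add (act g u) (act g v)"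
    and act1: "u \<in> V \<Longrightarrow> w \<in> V \<Longrightarrow>
      real (card {g \<in> G. act g u = w}) = card G / card V"
    and act2: "u \<in> V \<Longrightarrow> u' \<in> V - {u} \<Longrightarrow> w \<in> V \<Longrightarrow> w' \<in> V - {w} \<Longrightarrow>
      real (card {g \<in> G. act g u = w \<and> act g u' = w'}) \<le> card G / (real (card V) * (real (card V) - 1))"
    and act3: "u \<in> V \<Longrightarrow> u' \<in> V - {u} \<Longrightarrow> u'' \<in> V - {u, u', add u u'} \<Longrightarrow>
      w \<in> V \<Longrightarrow> w' \<in> V - {w} \<Longrightarrow> w'' \<in> V - {w, w', add w w'} \<Longrightarrow>
      real (card {g \<in> G. act g u = w \<and> act g u' = w' \<and> act g u'' = w''})
        \<le> card G / (real (card V) * (real (card V) - 1) * (real (card V) - 3))"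
begin

text \<open>The Boolean is the sign of the exponent of \<open>g\<close>.\<close>

definition sact :: "'g \<Rightarrow> bool \<Rightarrow> 'v \<Rightarrow> 'v" where
  "sact g e = (if e then act g else inv_into V (act g))"

definition fixn :: "('v \<Rightarrow> 'v) \<Rightarrow> nat" where
  "fixn f = card {x \<in> V. f x = x}"

abbreviation n where "n \<equiv> real (card V)"
abbreviation N where "N \<equiv> real (card G)"

lemma n_ge: "n \<ge> 3" using cardV by simp

lemma N_pos: "N > 0" using finG G_ne by (simp add: card_gt_0_iff)

lemma sact_bij: "g \<in> G \<Longrightarrow> bij_betw (sact g e) V V"
  by (simp add: sact_def act_bij bij_betw_inv_into)

lemma bij_in: "bij_betw f V V \<Longrightarrow> x \<in> V \<Longrightarrow> f x \<in> V"
  by (rule bij_betwE[THEN bspec])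

lemma sact_in: "g \<in> G \<Longrightarrow> x \<in> V \<Longrightarrow> sact g e x \<in> V"
  using sact_bij bij_in by blast

lemma sact_inverse: "g \<in> G \<Longrightarrow> x \<in> V \<Longrightarrow> sact g (\<not> e) (sact g e x) = x"
  using bij_betw_inv_into_left[OF act_bij, of g x] bij_betw_inv_into_right[OF act_bij, of g x]
  by (cases e) (simp_all add: sact_def)

lemma sact_flip: "g \<in> G \<Longrightarrow> x \<in> V \<Longrightarrow> y \<in> V \<Longrightarrow> sact g (\<not> e) x = y \<longleftrightarrow> sact g e y = x"
  using sact_inverse[of g y e] sact_inverse[of g x "\<not> e"] by auto

lemma sact_inj: "g \<in> G \<Longrightarrow> x \<in> V \<Longrightarrow> y \<in> V \<Longrightarrow> sact g e x = sact g e y \<longleftrightarrow> x = y"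
  using sact_bij[of g e] by (auto simp: bij_betw_def inj_on_def)

text \<open>\<open>inv_into V\<close> is controlled on \<open>V\<close> only;
  \<open>u \<noteq> v\<close> keeps the sums inside \<open>V\<close>, where the inverse of an
  additive bijection is additive.\<close>

lemma sact_add:
  assumes "g \<in> G" "u \<in> V" "v \<in> V" "u \<noteq> v"
  shows "sact g e (add u v) = add (sact g e u) (sact g e v)"
proof (cases e)
  case True
  then show ?thesis using assms by (simp add: sact_def act_add)
next
  case False
  let ?u = "sact g e u" and ?v = "sact g e v"
  have uv: "?u \<in> V" "?v \<in> V" "?u \<noteq> ?v" using assms sact_in sact_inj by auto
  have "sact g True ?u = u" "sact g True ?v = v"
    using False assms sact_flip[of g u ?u True] sact_flip[of g v ?v True] uv by auto
  then have "sact g True (add ?u ?v) = add u v"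
    using act_add[OF assms(1) uv(1,2)] by (simp add: sact_def)
  then show ?thesis
    using sact_flip[of g "add u v" "add ?u ?v" True] assms uv add_closed False by auto
qed

lemma inv_act: "g \<in> G \<Longrightarrow> u \<in> V \<Longrightarrow> w \<in> V \<Longrightarrow> inv_into V (act g) u = w \<longleftrightarrow> act g w = u"
  using sact_flip[of g u w True] by (simp add: sact_def)

lemma sact1:
  assumes "u \<in> V" "w \<in> V"
  shows "real (card {g \<in> G. sact g e u = w}) = N / n"
proof (cases e)
  case True
  then show ?thesis using act1 assms by (simp add: sact_def)
next
  case False
  then have "{g \<in> G. sact g e u = w} = {g \<in> G. act g w = u}"
    using assms by (intro Collect_cong conj_cong) (simp_all add: sact_def inv_act)
  then show ?thesis using act1[OF assms(2,1)] by simp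
qed

lemma sact2:
  assumes "u \<in> V" "u' \<in> V" "u' \<noteq> u" "w \<in> V" "w' \<in> V"
  shows "real (card {g \<in> G. sact g e u = w \<and> sact g e u' = w'}) \<le> N / (n * (n - 1))"
proof (cases "w' = w")
  case True
  then have "{g \<in> G. sact g e u = w \<and> sact g e u' = w'} = {}"
    using assms sact_inj by auto
  then show ?thesis using n_ge by (simp del: Collect_empty_eq)
next
  case False
  show ?thesis
  proof (cases e)
    case True
    then show ?thesis using act2[of u u' w w'] assms False by (simp add: sact_def)
  next
    case e: False
    then have "{g \<in> G. sact g e u = w \<and> sact g e u' = w'} = {g \<in> G. act g w = u \<and> act g w' = u'}"
      using assms by (intro Collect_cong conj_cong) (simp_all add: sact_def inv_act)
    then show ?thesis using act2[of w w' u u'] assms False by simp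
  qed
qed

text \<open>Dependent targets are hit by no \<open>g\<close>: being injective and additive,
  \<open>sact g e\<close> maps \<open>u''\<close> away from the images of \<open>u\<close> and
  \<open>u'\<close> and from their sum.\<close>

lemma sact3:
  assumes "u \<in> V" "u' \<in> V" "u' \<noteq> u" "u'' \<in> V - {u, u', add u u'}" "w \<in> V" "w' \<in> V" "w'' \<in> V"
  shows "real (card {g \<in> G. sact g e u = w \<and> sact g e u' = w' \<and> sact g e u'' = w''})
           \<le> N / (n * (n - 1) * (n - 3))"
proof (cases "w' \<noteq> w \<and> w'' \<notin> {w, w', add w w'}")
  case False
  have "sact g e u'' \<noteq> add (sact g e u) (sact g e u')" if "g \<in> G" for g
    using sact_inj[OF that, of u'' "add u u'" e] sact_add[OF that assms(1,2), of e] assms add_closed[of u u'] by auto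
  then have "{g \<in> G. sact g e u = w \<and> sact g e u' = w' \<and> sact g e u'' = w''} = {}"
    using assms sact_inj False by auto
  then show ?thesis using n_ge by (simp del: Collect_empty_eq)
next
  case True
  show ?thesis
  proof (cases e)
    case e: True
    then show ?thesis using act3[of u u' u'' w w' w''] assms True by (simp add: sact_def)
  next
    case e: False
    then have "{g \<in> G. sact g e u = w \<and> sact g e u' = w' \<and> sact g e u'' = w''}
       = {g \<in> G. act g w = u \<and> act g w' = u' \<and> act g w'' = u''}"
      using assms by (intro Collect_cong conj_cong) (simp_all add: sact_def inv_act)
    then show ?thesis using act3[of w w' w'' u u' u''] assms True by simp
  qed
qed

section \<open>Means over one generator that occurs once or twice\<close>

lemma card_le_card_times:
  fixes c :: real
  assumes "finite I" "X \<subseteq> (\<Union>i\<in>I. Y i)" "\<And>i. i \<in> I \<Longrightarrow> real (card (Y i)) \<le> c" "\<And>i. i \<in> I \<Longrightarrow> finite (Y i)"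
  shows "real (card X) \<le> card I * c"
proof -
  have "card X \<le> card (\<Union>i\<in>I. Y i)"
    using assms by (intro card_mono) auto
  also have "\<dots> \<le> (\<Sum>i\<in>I. card (Y i))" by (rule card_UN_le) fact
  finally have "real (card X) \<le> (\<Sum>i\<in>I. real (card (Y i)))"
    by (metis of_nat_le_iff of_nat_sum)
  also have "\<dots> \<le> card I * c" using assms by (intro sum_bounded_above) auto
  finally show ?thesis .
qed

text \<open>Double counting of the pairs \<open>(g, x)\<close> with \<open>x\<close> fixed; from
  here on a mean is estimated point by point.\<close>

lemma sum_fixn:
  "(\<Sum>g\<in>G. real (fixn (f g))) = (\<Sum>x\<in>V. real (card {g \<in> G. f g x = x}))"
proof -
  have "(\<Sum>g\<in>G. fixn (f g)) = (\<Sum>x\<in>V. card {g \<in> G. f g x = x})"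
    unfolding fixn_def
    by (rule sum_multicount_gen[where R = "\<lambda>g x. f g x = x", simplified]) (auto simp: finV finG)
  then show ?thesis by (simp only: of_nat_sum[symmetric])
qed

lemma fixn_le: "fixn f \<le> card V"
  unfolding fixn_def by (rule card_mono) (auto simp: finV)

text \<open>Each single point has an equidistributed image. An equality is required because
  \<open>cross_opp_bound\<close> subtracts such means.\<close>

lemma once_bound:
  assumes "bij_betw b V V"
  shows "(\<Sum>g\<in>G. real (fixn (\<lambda>x. sact g e (b x)))) = N"
proof -
  have "(\<Sum>g\<in>G. real (fixn (\<lambda>x. sact g e (b x)))) = (\<Sum>x\<in>V. N / n)"
    unfolding sum_fixn by (intro sum.cong refl sact1) (auto intro: bij_in[OF assms])
  then show ?thesis using n_ge by simp
qed

text \<open>With \<open>u = g y\<close> the condition reads \<open>g y = u\<close> and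
  \<open>g (a u) = z\<close>. For \<open>u = z\<close> it collapses to one condition and is possible
  only if \<open>a z = y\<close>; each of the other \<open>n - 1\<close> values of \<open>u\<close>
  prescribes two images and has share at most \<open>1 / (n (n - 1))\<close>.\<close>

lemma same_pointwise:
  assumes a: "bij_betw a V V" and y: "y \<in> V" and z: "z \<in> V"
  shows "real (card {g \<in> G. sact g e (a (sact g e y)) = z}) \<le> N / n * (1 + of_bool (a z = y))"
proof -
  let ?A = "{g \<in> G. sact g e y = z \<and> a z = y}"
  let ?B = "{g \<in> G. sact g e (a (sact g e y)) = z} - ?A"
  have "?B \<subseteq> (\<Union>u\<in>V - {z}. {g \<in> G. sact g e y = u \<and> sact g e (a u) = z \<and> a u \<noteq> y})"
    using sact_in[OF _ y] sact_inj y bij_in[OF a] by auto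
  moreover have "real (card {g \<in> G. sact g e y = u \<and> sact g e (a u) = z \<and> a u \<noteq> y}) \<le> N / (n * (n - 1))"
    if "u \<in> V" for u
    using sact2[of y "a u" u z e] n_ge y z that bij_in[OF a that] by (cases "a u = y") auto
  ultimately have "real (card ?B) \<le> card (V - {z}) * (N / (n * (n - 1)))"
    by (intro card_le_card_times) (auto simp: finV finG)
  also have "real (card (V - {z})) = n - 1" using z finV n_ge by (simp add: of_nat_diff)
  also have "(n - 1) * (N / (n * (n - 1))) = N / n" using n_ge by simp
  finally have B: "real (card ?B) \<le> N / n" .
  have A: "real (card ?A) \<le> N / n * of_bool (a z = y)"
    using sact1[OF y z, of e] by (cases "a z = y") auto
  have "card {g \<in> G. sact g e (a (sact g e y)) = z} \<le> card (?A \<union> ?B)"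
    by (intro card_mono) (auto simp: finG)
  also have "\<dots> \<le> card ?A + card ?B" by (rule card_Un_le)
  finally have "real (card {g \<in> G. sact g e (a (sact g e y)) = z}) \<le> real (card ?A) + real (card ?B)"
    by linarith
  moreover have "N / n * (1 + of_bool (a z = y)) = N / n + N / n * of_bool (a z = y)"
    by (cases "a z = y") auto
  ultimately show ?thesis using A B by linarith
qed

text \<open>The number of coincidences of \<open>a\<close> and \<open>b\<close> is kept, rather than
  estimated by \<open>n\<close>, because \<open>cross_same_bound\<close> averages it over a second
  generator.\<close>

lemma same_bound:
  assumes a: "bij_betw a V V" and b: "bij_betw b V V"
  shows "(\<Sum>g\<in>G. real (fixn (\<lambda>x. sact g e (a (sact g e (b x))))))
          \<le> N * (1 + card {x \<in> V. a x = b x} / n)"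
proof -
  have "(\<Sum>g\<in>G. real (fixn (\<lambda>x. sact g e (a (sact g e (b x))))))
      \<le> (\<Sum>x\<in>V. N / n * (1 + of_bool (a x = b x)))"
    unfolding sum_fixn by (intro sum_mono same_pointwise a bij_in[OF b])
  also have "\<dots> = N / n * (\<Sum>x\<in>V. 1 + of_bool (a x = b x))"
    by (simp only: sum_distrib_left)
  also have "(\<Sum>x\<in>V. 1 + of_bool (a x = b x)) = n + card {x \<in> V. a x = b x}"
    using finV by (simp add: sum.distrib Int_def)
  also have "N / n * (n + card {x \<in> V. a x = b x}) = N * (1 + card {x \<in> V. a x = b x} / n)"
    using n_ge by (simp add: field_simps)
  finally show ?thesis .
qed

lemma same_bound2:
  assumes a: "bij_betw a V V" and b: "bij_betw b V V"
  shows "(\<Sum>g\<in>G. real (fixn (\<lambda>x. sact g e (a (sact g e (b x)))))) \<le> 2 * N"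
proof -
  have "card {x \<in> V. a x = b x} \<le> card V" by (intro card_mono) (auto simp: finV)
  then have "real (card {x \<in> V. a x = b x}) / n \<le> 1" using n_ge by simp
  then have "N * (1 + card {x \<in> V. a x = b x} / n) \<le> N * 2"
    by (intro mult_left_mono) auto
  with same_bound[OF a b, of e] show ?thesis by simp
qed

text \<open>Let \<open>v\<close> be the image of \<open>b x\<close> under the inner occurrence of
  \<open>g\<close>: then \<open>g v = b x\<close> and \<open>g (a v) = x\<close>. A fixed point
  \<open>x\<close> of \<open>b\<close> goes with fixed points \<open>v\<close> of \<open>a\<close>
  and leaves one condition on \<open>g\<close>; every other \<open>x\<close> goes with the points
  moved by \<open>a\<close> and leaves two.\<close>

lemma opp_bound:
  assumes a: "bij_betw a V V" and b: "bij_betw b V V"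
  shows "(\<Sum>g\<in>G. real (fixn (\<lambda>x. sact g e (a (sact g (\<not> e) (b x))))))
          \<le> N * (fixn a * fixn b / n + (n - fixn a) * (n - fixn b) / (n * (n - 1)))"
proof -
  have pt: "real (card {g \<in> G. sact g e (a (sact g (\<not> e) (b x))) = x})
     \<le> (if b x = x then N * fixn a / n else N * (n - fixn a) / (n * (n - 1)))" if x: "x \<in> V" for x
  proof -
    have bx: "b x \<in> V" using x b bij_in by auto
    have sub: "{g \<in> G. sact g e (a (sact g (\<not> e) (b x))) = x} \<subseteq>
       (\<Union>v\<in>{v \<in> V. (a v = v) = (b x = x)}. {g \<in> G. sact g e v = b x \<and> sact g e (a v) = x})"
    proof
      fix g assume g: "g \<in> {g \<in> G. sact g e (a (sact g (\<not> e) (b x))) = x}"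
      let ?v = "sact g (\<not> e) (b x)"
      have v: "?v \<in> V" "sact g e ?v = b x" using g bx sact_in sact_flip[of g "b x" ?v e] by auto
      moreover have "a ?v = ?v \<longleftrightarrow> b x = x"
        using g v sact_inj[of g "a ?v" ?v e] bij_in[OF a v(1)] by auto
      ultimately show "g \<in> (\<Union>v\<in>{v \<in> V. (a v = v) = (b x = x)}. {g \<in> G. sact g e v = b x \<and> sact g e (a v) = x})"
        using g by auto
    qed
    show ?thesis
    proof (cases "b x = x")
      case True
      then have "real (card {g \<in> G. sact g e (a (sact g (\<not> e) (b x))) = x}) \<le> card {v \<in> V. (a v = v) = (b x = x)} * (N / n)"
        using sact1[of _ x e] x by (intro card_le_card_times[OF _ sub]) (auto simp: finV finG)
      then show ?thesis using True by (simp add: fixn_def mult.commute)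
    next
      case False
      have "{v \<in> V. (a v = v) = (b x = x)} = V - {v \<in> V. a v = v}" using False by auto
      moreover have "card (V - {v \<in> V. a v = v}) = card V - fixn a"
        unfolding fixn_def by (intro card_Diff_subset) (auto simp: finV)
      moreover have "real (card V - fixn a) = n - fixn a" by (rule of_nat_diff[OF fixn_le])
      moreover have "real (card {g \<in> G. sact g e (a (sact g (\<not> e) (b x))) = x}) \<le> card {v \<in> V. (a v = v) = (b x = x)} * (N / (n * (n - 1)))"
        using False bx x bij_in[OF a] by (intro card_le_card_times[OF _ sub] sact2) (auto simp: finV finG)
      ultimately show ?thesis using False by (simp add: mult.commute)
    qed
  qed
  have "(\<Sum>g\<in>G. real (fixn (\<lambda>x. sact g e (a (sact g (\<not> e) (b x))))))
     \<le> (\<Sum>x\<in>V. if b x = x then N * fixn a / n else N * (n - fixn a) / (n * (n - 1)))"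
    unfolding sum_fixn by (intro sum_mono pt)
  also have "\<dots> = fixn b * (N * fixn a / n) + card (V - {x \<in> V. b x = x}) * (N * (n - fixn a) / (n * (n - 1)))"
    unfolding sum.If_cases[OF finV] by (simp add: fixn_def Int_def Diff_eq Collect_neg_eq[symmetric] cong: conj_cong)
  also have "card (V - {x \<in> V. b x = x}) = card V - fixn b"
    unfolding fixn_def by (intro card_Diff_subset) (auto simp: finV)
  also have "real (card V - fixn b) = n - fixn b" by (rule of_nat_diff[OF fixn_le])
  also have "fixn b * (N * fixn a / n) + (n - fixn b) * (N * (n - fixn a) / (n * (n - 1)))
      = N * (fixn a * fixn b / n + (n - fixn a) * (n - fixn b) / (n * (n - 1)))"
    by (simp add: distrib_left mult.commute mult.left_commute)
  finally show ?thesis .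
qed

section \<open>Means over one generator that occurs three times\<close>

lemma card_free_le:
  assumes a: "bij_betw a V V" and u: "u \<in> V" "u' \<in> V" "u' \<noteq> u"
  shows "card {v \<in> V. a v \<notin> {u, u', add u u'}} \<le> card V - 3"
proof -
  \<comment> \<open>\<open>add u u'\<close> is the third nonzero vector of the plane spanned by
    \<open>u\<close> and \<open>u'\<close>, so three different values of the bijection
    \<open>a\<close> are excluded.\<close>
  have ne: "add u u' \<noteq> u" "add u u' \<noteq> u'"
    using add_cancel[OF u(1,2)] add_cancel[OF u(2,1)] add_comm[OF u(1,2)] add_not_closed[OF u(1)]
      add_not_closed[OF u(2)] u by metis+
  have "card {v \<in> V. a v \<notin> {u, u', add u u'}} = card (a ` {v \<in> V. a v \<notin> {u, u', add u u'}})"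
    using a by (intro card_image[symmetric]) (auto simp: bij_betw_def inj_on_def)
  also have "\<dots> \<le> card (V - {u, u', add u u'})"
    using bij_in[OF a] by (intro card_mono) (auto simp: finV)
  also have "\<dots> = card V - card {u, u', add u u'}"
    using u add_closed finV by (intro card_Diff_subset) auto
  also have "card {u, u', add u u'} = 3" using ne u by auto
  finally show ?thesis .
qed

text \<open>The quotients bound the number of group elements with one, two or three prescribed
  images; they are multiplied by the numbers of choices that occur below.\<close>

lemma order_quotients: "N / (n * (n - 1)) \<le> N / n / 2" "N / (n * (n - 1)) \<ge> 0"
  "n * (N / (n * (n - 1))) = N / n + N / (n * (n - 1))" "(n - 1) * (N / (n * (n - 1))) = N / n"
  "real (card V - 3) * (N / (n * (n - 1) * (n - 3))) \<le> N / (n * (n - 1))"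
proof -
  have "N / n / (n - 1) \<le> N / n / 2"
    using n_ge by (intro divide_left_mono) auto
  then show "N / (n * (n - 1)) \<le> N / n / 2" by simp
  show "N / (n * (n - 1)) \<ge> 0" using n_ge by simp
  show *: "(n - 1) * (N / (n * (n - 1))) = N / n" using n_ge by simp
  have "n * c = (n - 1) * c + c" for c by (simp add: left_diff_distrib)
  from this[of "N / (n * (n - 1))"]
  show "n * (N / (n * (n - 1))) = N / n + N / (n * (n - 1))" unfolding * .
  \<comment> \<open>The case \<open>n = 3\<close> is genuine: there the factor
    \<open>card V - 3\<close> vanishes, and so does the quotient, by division by zero.\<close>
  have "real (card V - 3) = n - 3" using cardV by (simp add: of_nat_diff)
  then show "real (card V - 3) * (N / (n * (n - 1) * (n - 3))) \<le> N / (n * (n - 1))"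
    using n_ge by (cases "n = 3") auto
qed

lemma card_Un5_le:
  assumes "X \<subseteq> A \<union> B \<union> C \<union> D \<union> E" "finite A" "finite B" "finite C" "finite D" "finite E"
  shows "real (card X) \<le> real (card A) + real (card B) + real (card C) + real (card D) + real (card E)"
proof -
  have "card X \<le> card (A \<union> B \<union> C \<union> D \<union> E)" using assms by (intro card_mono) auto
  also have "\<dots> \<le> card A + card B + card C + card D + card E"
    by (meson add_le_mono1 card_Un_le le_trans)
  finally show ?thesis by linarith
qed

lemma card_single: "x \<in> V \<Longrightarrow> real (card (V - {x})) = n - 1"
  using finV cardV by (simp add: of_nat_diff)

text \<open>Follow the point: \<open>u = g y\<close>, \<open>v = g (b u)\<close>,
  \<open>g (a v) = z\<close>. The sets \<open>E1\<close> to \<open>E5\<close> record how the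
  arguments \<open>y\<close>, \<open>b u\<close>, \<open>a v\<close> of \<open>g\<close> depend on
  each other: \<open>b u = y\<close>, \<open>a v = y\<close>, \<open>a v = b u\<close>,
  \<open>a v = add y (b u)\<close>, or not at all. \<open>E1\<close>, \<open>E4\<close> and
  \<open>E5\<close> cost at most \<open>N / n\<close> each, \<open>E2\<close> and \<open>E3\<close>
  at most half of it.\<close>

lemma triple_same:
  assumes a: "bij_betw a V V" and b: "bij_betw b V V" and y: "y \<in> V" and z: "z \<in> V"
  shows "real (card {g \<in> G. sact g e (a (sact g e (b (sact g e y)))) = z}) \<le> 5 * (N / n)"
proof -
  note A = bij_in[OF a] and B = bij_in[OF b]
  define E1 where "E1 = {g \<in> G. sact g e y = inv_into V b y}"
  define E2 where "E2 = (if b z = y then {} else {g \<in> G. sact g e y = z \<and> sact g e (b z) = inv_into V a y})"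
  define E3 where "E3 = (if a z = y then {} else {g \<in> G. sact g e y = inv_into V b (a z) \<and> sact g e (a z) = z})"
  \<comment> \<open>Additivity gives \<open>z = add u v\<close>, hence \<open>v = add u z\<close> is
    determined by \<open>u\<close>.\<close>
  define E4 where "E4 = (\<Union>u\<in>{u\<in>V - {z}. b u \<noteq> y}. {g \<in> G. sact g e y = u \<and> sact g e (b u) = add u z})"
  define Y where "Y = (\<lambda>u. {v \<in> V. a v \<notin> {y, b u, add y (b u)}})"
  define E5 where "E5 = (\<Union>u\<in>{u\<in>V - {z}. b u \<noteq> y}. (\<Union>v\<in>Y u.
     {g \<in> G. sact g e y = u \<and> sact g e (b u) = v \<and> sact g e (a v) = z}))"
  have ib: "inv_into V b u \<in> V" if "u \<in> V" for u
    using b that by (metis bij_betw_imp_surj_on inv_into_into)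
  have ia: "inv_into V a u \<in> V" if "u \<in> V" for u
    using a that by (metis bij_betw_imp_surj_on inv_into_into)
  have ivb: "inv_into V b (b u) = u" if "u \<in> V" for u
    using bij_betw_inv_into_left[OF b that] .
  have iva: "inv_into V a (a u) = u" if "u \<in> V" for u
    using bij_betw_inv_into_left[OF a that] .
  have "{g \<in> G. sact g e (a (sact g e (b (sact g e y)))) = z} \<subseteq> E1 \<union> E2 \<union> E3 \<union> E4 \<union> E5"
  proof
    fix g assume "g \<in> {g \<in> G. sact g e (a (sact g e (b (sact g e y)))) = z}"
    then have g: "g \<in> G" and eq: "sact g e (a (sact g e (b (sact g e y)))) = z" by auto
    define u where "u = sact g e y"
    define v where "v = sact g e (b u)"
    have uv: "u \<in> V" "v \<in> V" using g y B sact_in by (auto simp: u_def v_def)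
    have zv: "sact g e (a v) = z" using eq by (simp add: u_def v_def)
    consider "b u = y" | "b u \<noteq> y" "a v = y" | "b u \<noteq> y" "a v \<noteq> y" "a v = b u"
      | "b u \<noteq> y" "a v = add y (b u)" "a v \<noteq> y"
      | "b u \<noteq> y" "a v \<noteq> y" "a v \<noteq> b u" "a v \<noteq> add y (b u)" by argo
    then show "g \<in> E1 \<union> E2 \<union> E3 \<union> E4 \<union> E5"
    proof cases
      case 1
      then have "g \<in> E1" using g ivb[OF uv(1)] by (simp add: E1_def u_def)
      then show ?thesis by simp
    next
      case 2
      then have "u = z" "v = inv_into V a y" using zv iva[OF uv(2)] by (auto simp: u_def)
      then have "g \<in> E2" using g 2 by (auto simp: E2_def u_def v_def)
      then show ?thesis by simp
    next
      case 3
      then have "v = z" using zv by (simp add: v_def)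
      then have "u = inv_into V b (a z)" using 3 ivb[OF uv(1)] by simp
      then have "g \<in> E3" using g 3 \<open>v = z\<close> zv by (auto simp: E3_def u_def)
      then show ?thesis by simp
    next
      case 4
      have "z = add u v" using zv 4 sact_add[OF g y B[OF uv(1)], of e] by (auto simp: u_def v_def)
      then have "v = add u z" using add_cancel uv by simp
      moreover have "u \<noteq> z" using zv 4 sact_inj[OF g y A[OF uv(2)], of e] by (auto simp: u_def)
      ultimately have "g \<in> E4" using g 4 uv by (auto simp: E4_def u_def v_def)
      then show ?thesis by simp
    next
      case 5
      moreover have "u \<noteq> z" using zv 5 sact_inj[OF g y A[OF uv(2)], of e] by (auto simp: u_def)
      ultimately have "g \<in> E5" using g zv uv by (auto simp: E5_def Y_def u_def v_def)
      then show ?thesis by simp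
    qed
  qed
  moreover have fin: "finite E1" "finite E2" "finite E3" "finite E4" "finite E5"
    using finG finV by (auto simp: E1_def E2_def E3_def E4_def E5_def Y_def)
  ultimately have *: "real (card {g \<in> G. sact g e (a (sact g e (b (sact g e y)))) = z})
     \<le> real (card E1) + real (card E2) + real (card E3) + real (card E4) + real (card E5)"
    by (rule card_Un5_le)
  have e1: "real (card E1) = N / n" unfolding E1_def by (rule sact1) (use y ib in auto)
  have e2: "real (card E2) \<le> N / (n * (n - 1))"
    using sact2[of y "b z" z "inv_into V a y" e] y z ia B order_quotients(2) by (auto simp: E2_def)
  have e3: "real (card E3) \<le> N / (n * (n - 1))"
    using sact2[of y "a z" "inv_into V b (a z)" z e] y z ib A order_quotients(2) by (auto simp: E3_def)
  have le: "real (card {u\<in>V - {z}. b u \<noteq> y}) \<le> n - 1"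
    unfolding card_single[OF z, symmetric] by (intro of_nat_mono card_mono) (auto simp: finV)
  have "real (card E4) \<le> card {u\<in>V - {z}. b u \<noteq> y} * (N / (n * (n - 1)))"
    unfolding E4_def using y z B add_closed
    by (intro card_le_card_times[OF _ subset_refl] sact2) (auto simp: finV finG)
  also have "\<dots> \<le> (n - 1) * (N / (n * (n - 1)))" using le order_quotients(2) by (rule mult_right_mono)
  finally have e4: "real (card E4) \<le> N / n" unfolding order_quotients(4) .
  have "real (card E5) \<le> card {u\<in>V - {z}. b u \<noteq> y} * (N / (n * (n - 1)))"
    unfolding E5_def
  proof (rule card_le_card_times[OF _ subset_refl])
    fix u assume u: "u \<in> {u\<in>V - {z}. b u \<noteq> y}"
    have "real (card (\<Union>v\<in>Y u. {g \<in> G. sact g e y = u \<and> sact g e (b u) = v \<and> sact g e (a v) = z}))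
       \<le> card (Y u) * (N / (n * (n - 1) * (n - 3)))" (is "?Z \<le> _")
      using y z B A u finV finG
      by (intro card_le_card_times[OF _ subset_refl] sact3) (auto simp: Y_def)
    also have "\<dots> \<le> real (card V - 3) * (N / (n * (n - 1) * (n - 3)))"
      unfolding Y_def using y u B n_ge by (intro mult_right_mono of_nat_mono card_free_le a) auto
    also note order_quotients(5)
    finally show "?Z
       \<le> N / (n * (n - 1))" .
  qed (auto simp: Y_def finV finG)
  also have "\<dots> \<le> (n - 1) * (N / (n * (n - 1)))" using le order_quotients(2) by (rule mult_right_mono)
  finally have e5: "real (card E5) \<le> N / n" unfolding order_quotients(4) .
  show ?thesis using * e1 e2 e3 e4 e5 order_quotients(1) by linarith
qed

text \<open>Now \<open>u\<close> is the preimage of \<open>y\<close>, and the arguments of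
  \<open>g\<close> are \<open>u\<close>, \<open>b u\<close>, \<open>a v\<close> with
  \<open>g u = y\<close>. \<open>E1\<close>, \<open>E2\<close> and \<open>E4\<close> cost at most
  \<open>N / n\<close> each, \<open>E3\<close> costs at most \<open>N / (n (n - 1))\<close>, and
  \<open>E5\<close> at most the sum of these two quotients. For \<open>n \<ge> 3\<close> the total
  is at most \<open>5 N / n\<close>; this is the origin of the constant 5.\<close>

lemma triple_mixed:
  assumes a: "bij_betw a V V" and b: "bij_betw b V V" and y: "y \<in> V" and z: "z \<in> V"
  shows "real (card {g \<in> G. sact g e (a (sact g e (b (sact g (\<not> e) y)))) = z}) \<le> 5 * (N / n)"
proof -
  note A = bij_in[OF a] and B = bij_in[OF b]
  define E1 where "E1 = {g \<in> G. sact g e (a y) = z}"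
  define E2 where "E2 = (\<Union>v\<in>{v\<in>V - {y}. b (a v) \<noteq> a v}. {g \<in> G. sact g e (a v) = y \<and> sact g e (b (a v)) = v})"
  define w where "w = inv_into V b (a z)"
  define E3 where "E3 = (if b w = w then {} else {g \<in> G. sact g e w = y \<and> sact g e (b w) = z})"
  \<comment> \<open>For \<open>y = z\<close> there is no such \<open>v\<close>, because
    \<open>add y y\<close> is outside \<open>V\<close>. Removing \<open>a (add y z)\<close> leaves
    at most \<open>n - 1\<close> choices of \<open>u\<close>; with \<open>n\<close> choices the five
    bounds would add up to more than \<open>5 N / n\<close> when \<open>n = 3\<close>.\<close>
  define E4 where "E4 = (if y = z then {} else \<Union>u\<in>{u\<in>V - {a (add y z)}. b u \<noteq> u}. {g \<in> G. sact g e u = y \<and> sact g e (b u) = add y z})"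
  define Y where "Y = (\<lambda>u. {v \<in> V. a v \<notin> {u, b u, add u (b u)}})"
  define E5 where "E5 = (\<Union>u\<in>{u\<in>V. b u \<noteq> u}. (\<Union>v\<in>Y u.
     {g \<in> G. sact g e u = y \<and> sact g e (b u) = v \<and> sact g e (a v) = z}))"
  have wV: "w \<in> V"
    using b A[OF z] by (metis w_def bij_betw_imp_surj_on inv_into_into)
  have "{g \<in> G. sact g e (a (sact g e (b (sact g (\<not> e) y)))) = z} \<subseteq> E1 \<union> E2 \<union> E3 \<union> E4 \<union> E5"
  proof
    fix g assume "g \<in> {g \<in> G. sact g e (a (sact g e (b (sact g (\<not> e) y)))) = z}"
    then have g: "g \<in> G" and eq: "sact g e (a (sact g e (b (sact g (\<not> e) y)))) = z" by auto
    define u where "u = sact g (\<not> e) y"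
    define v where "v = sact g e (b u)"
    have uv: "u \<in> V" "v \<in> V" using g y B sact_in by (auto simp: u_def v_def)
    have uy: "sact g e u = y" using sact_flip[OF g y uv(1), of e] by (simp add: u_def)
    have zv: "sact g e (a v) = z" using eq by (simp add: u_def v_def)
    consider "b u = u" | "b u \<noteq> u" "a v = u" | "b u \<noteq> u" "a v = b u"
      | "b u \<noteq> u" "a v = add u (b u)"
      | "b u \<noteq> u" "a v \<noteq> u" "a v \<noteq> b u" "a v \<noteq> add u (b u)" by argo
    then show "g \<in> E1 \<union> E2 \<union> E3 \<union> E4 \<union> E5"
    proof cases
      case 1
      then have "g \<in> E1" using g zv uy by (simp add: E1_def v_def)
      then show ?thesis by simp
    next
      case 2
      moreover have "v \<noteq> y" using sact_inj[OF g B[OF uv(1)] uv(1), of e] uy 2 by (auto simp: v_def)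
      ultimately have "g \<in> E2" using g uv uy by (auto simp: E2_def v_def)
      then show ?thesis by simp
    next
      case 3
      then have "v = z" using zv by (simp add: v_def)
      then have "u = w" using 3 bij_betw_inv_into_left[OF b uv(1)] by (simp add: w_def)
      then have "g \<in> E3" using g 3 \<open>v = z\<close> uy by (auto simp: E3_def v_def)
      then show ?thesis by simp
    next
      case 4
      have "z = add y v" using zv uy 4 sact_add[OF g uv(1) B[OF uv(1)], of e] by (auto simp: v_def)
      then have v: "v = add y z" using add_cancel y uv by simp
      moreover have "y \<noteq> z" using v uv add_not_closed y by auto
      moreover have "u \<noteq> a (add y z)"
        using 4 v add_cancel[OF uv(1) B[OF uv(1)]] add_not_closed[OF uv(1)] B[OF uv(1)] by metis
      ultimately have "g \<in> E4" using g 4 uv uy by (auto simp: E4_def v_def)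
      then show ?thesis by simp
    next
      case 5
      then have "g \<in> E5" using g zv uv uy by (auto simp: E5_def Y_def v_def)
      then show ?thesis by simp
    qed
  qed
  moreover have fin: "finite E1" "finite E2" "finite E3" "finite E4" "finite E5"
    using finG finV by (auto simp: E1_def E2_def E3_def E4_def E5_def Y_def)
  ultimately have *: "real (card {g \<in> G. sact g e (a (sact g e (b (sact g (\<not> e) y)))) = z})
     \<le> real (card E1) + real (card E2) + real (card E3) + real (card E4) + real (card E5)"
    by (rule card_Un5_le)
  have le: "real (card {u\<in>V - {x}. Q u}) \<le> n - 1" if "x \<in> V" for x Q
    unfolding card_single[OF that, symmetric] by (intro of_nat_mono card_mono) (auto simp: finV)
  have e1: "real (card E1) = N / n" unfolding E1_def by (rule sact1) (use y z A in auto)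
  have "real (card E2) \<le> card {v\<in>V - {y}. b (a v) \<noteq> a v} * (N / (n * (n - 1)))"
    unfolding E2_def using y A B
    by (intro card_le_card_times[OF _ subset_refl] sact2) (auto simp: finV finG)
  also have "\<dots> \<le> (n - 1) * (N / (n * (n - 1)))" using le[OF y] order_quotients(2) by (rule mult_right_mono)
  finally have e2: "real (card E2) \<le> N / n" unfolding order_quotients(4) .
  have e3: "real (card E3) \<le> N / (n * (n - 1))"
    using sact2[of w "b w" y z e] y z wV B order_quotients(2) by (auto simp: E3_def)
  have e4: "real (card E4) \<le> N / n"
  proof (cases "y = z")
    case False
    then have "real (card E4) \<le> card {u\<in>V - {a (add y z)}. b u \<noteq> u} * (N / (n * (n - 1)))"
      unfolding E4_def if_not_P[OF False] using y z B add_closed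
      by (intro card_le_card_times[OF _ subset_refl] sact2) (auto simp: finV finG)
    also have "\<dots> \<le> (n - 1) * (N / (n * (n - 1)))"
      using le[OF A[OF add_closed[OF y z False]]] order_quotients(2) by (rule mult_right_mono)
    finally show ?thesis unfolding order_quotients(4) .
  qed (use n_ge in \<open>simp add: E4_def\<close>)
  have "real (card E5) \<le> card {u\<in>V. b u \<noteq> u} * (N / (n * (n - 1)))"
    unfolding E5_def
  proof (rule card_le_card_times[OF _ subset_refl])
    fix u assume u: "u \<in> {u\<in>V. b u \<noteq> u}"
    have "real (card (\<Union>v\<in>Y u. {g \<in> G. sact g e u = y \<and> sact g e (b u) = v \<and> sact g e (a v) = z}))
       \<le> card (Y u) * (N / (n * (n - 1) * (n - 3)))" (is "?Z \<le> _")
      using y z B A u finV finG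
      by (intro card_le_card_times[OF _ subset_refl] sact3) (auto simp: Y_def)
    also have "\<dots> \<le> real (card V - 3) * (N / (n * (n - 1) * (n - 3)))"
      unfolding Y_def using u B n_ge by (intro mult_right_mono of_nat_mono card_free_le a) auto
    also note order_quotients(5)
    finally show "?Z
       \<le> N / (n * (n - 1))" .
  qed (auto simp: Y_def finV finG)
  also have "\<dots> \<le> n * (N / (n * (n - 1)))"
    using order_quotients(2) by (intro mult_right_mono of_nat_mono card_mono) (auto simp: finV)
  finally have e5: "real (card E5) \<le> N / n + N / (n * (n - 1))" unfolding order_quotients(3) .
  show ?thesis using * e1 e2 e3 e4 e5 order_quotients(1) by linarith
qed

lemma triple_bound:
  assumes a: "bij_betw a V V" and b: "bij_betw b V V" and c: "bij_betw c V V"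
  shows "(\<Sum>g\<in>G. real (fixn (\<lambda>x. sact g e (a (sact g e (b (sact g e' (c x)))))))) \<le> 5 * N"
proof -
  have "(\<Sum>g\<in>G. real (fixn (\<lambda>x. sact g e (a (sact g e (b (sact g e' (c x))))))))
      \<le> (\<Sum>x\<in>V. 5 * (N / n))"
    unfolding sum_fixn
  proof (rule sum_mono)
    fix x assume x: "x \<in> V"
    show "real (card {g \<in> G. sact g e (a (sact g e (b (sact g e' (c x))))) = x}) \<le> 5 * (N / n)"
    proof (cases "e' = e")
      case True
      then show ?thesis using triple_same[OF a b bij_in[OF c x] x, of e] by simp
    next
      case False
      then have "e' = (\<not> e)" by auto
      then show ?thesis using triple_mixed[OF a b bij_in[OF c x] x, of e] by simp
    qed
  qed
  then show ?thesis using n_ge by simp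
qed

section \<open>Means over two generators that cross\<close>

lemma fixn_conj_inner:
  assumes a: "bij_betw a V V" and b: "bij_betw b V V" and f: "bij_betw f V V"
  shows "fixn (\<lambda>x. a (f (b x))) = fixn (\<lambda>x. f (b (a x)))"
proof -
  have "bij_betw (\<lambda>x. f (b x)) {x \<in> V. a (f (b x)) = x} {x \<in> V. f (b (a x)) = x}"
    using bij_in[OF a] bij_in[OF b] bij_in[OF f]
    by (intro bij_betw_byWitness[where f' = a]) auto
  then show ?thesis unfolding fixn_def by (rule bij_betw_same_card)
qed

text \<open>A second moment: the product counts pairs \<open>(x, y)\<close> with
  \<open>t (a x) = x\<close> and \<open>t y = b y\<close>. For given \<open>x\<close>, the choice
  \<open>y = a x\<close> has share at most \<open>1 / n\<close> and each of the other
  \<open>n - 1\<close> choices at most \<open>1 / (n (n - 1))\<close>, so the sum over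
  \<open>x\<close> is at most 2.\<close>

lemma sum_fixn_mult:
  assumes a: "bij_betw a1 V V" "bij_betw a2 V V" and b: "bij_betw b1 V V" "bij_betw b2 V V"
  shows "(\<Sum>t\<in>G. real (fixn (\<lambda>x. a1 (sact t f (a2 x)))) * real (fixn (\<lambda>x. b1 (sact t (\<not> f) (b2 x))))) \<le> 2 * N"
proof -
  define a where "a = (\<lambda>x. a2 (a1 x))"
  define b where "b = (\<lambda>x. b2 (b1 x))"
  have ab: "bij_betw a V V" "bij_betw b V V"
    using bij_betw_trans[OF a] bij_betw_trans[OF b] by (simp_all add: a_def b_def comp_def)
  note A = bij_in[OF ab(1)] and B = bij_in[OF ab(2)]
  have "real (fixn (\<lambda>x. a1 (sact t f (a2 x)))) * real (fixn (\<lambda>x. b1 (sact t (\<not> f) (b2 x))))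
      = (\<Sum>(x, y)\<in>V \<times> V. of_bool (sact t f (a x) = x \<and> sact t f y = b y))" if t: "t \<in> G" for t
  proof -
    have "fixn (\<lambda>x. a1 (sact t f (a2 x))) = fixn (\<lambda>x. sact t f (a x))"
      unfolding a_def by (intro fixn_conj_inner a sact_bij t)
    moreover have "fixn (\<lambda>x. b1 (sact t (\<not> f) (b2 x))) = fixn (\<lambda>x. sact t (\<not> f) (b x))"
      unfolding b_def by (intro fixn_conj_inner b sact_bij t)
    moreover have "{x \<in> V. sact t (\<not> f) (b x) = x} = {x \<in> V. sact t f x = b x}"
      using sact_flip[OF t] B by auto
    moreover have "card {x \<in> V. sact t f (a x) = x} * card {x \<in> V. sact t f x = b x}
      = card (V \<times> V \<inter> {(x, y). sact t f (a x) = x \<and> sact t f y = b y})"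
      unfolding card_cartesian_product[symmetric] by (rule arg_cong[where f = card]) auto
    ultimately show ?thesis using finV
      by (simp add: fixn_def case_prod_beta' Int_def of_nat_mult[symmetric] del: of_nat_mult)
  qed
  then have "(\<Sum>t\<in>G. real (fixn (\<lambda>x. a1 (sact t f (a2 x)))) * real (fixn (\<lambda>x. b1 (sact t (\<not> f) (b2 x)))))
    = (\<Sum>t\<in>G. \<Sum>(x, y)\<in>V \<times> V. of_bool (sact t f (a x) = x \<and> sact t f y = b y))"
    by simp
  also have "\<dots> = (\<Sum>(x, y)\<in>V \<times> V. real (card {t \<in> G. sact t f (a x) = x \<and> sact t f y = b y}))"
    by (subst sum.swap) (simp add: case_prod_beta' finG Int_def)
  also have "\<dots> = (\<Sum>x\<in>V. \<Sum>y\<in>V. real (card {t \<in> G. sact t f (a x) = x \<and> sact t f y = b y}))"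
    by (rule sum.cartesian_product[symmetric])
  also have "\<dots> \<le> (\<Sum>x\<in>V. 2 * (N / n))"
  proof (rule sum_mono)
    fix x assume x: "x \<in> V"
    have ax: "a x \<in> V" using A x .
    have "(\<Sum>y\<in>V. real (card {t \<in> G. sact t f (a x) = x \<and> sact t f y = b y}))
       = real (card {t \<in> G. sact t f (a x) = x \<and> sact t f (a x) = b (a x)})
         + (\<Sum>y\<in>V - {a x}. real (card {t \<in> G. sact t f (a x) = x \<and> sact t f y = b y}))"
      by (rule sum.remove[OF finV ax])
    also have "\<dots> \<le> N / n + (\<Sum>y\<in>V - {a x}. N / (n * (n - 1)))"
    proof (intro add_mono sum_mono)
      have "card {t \<in> G. sact t f (a x) = x \<and> sact t f (a x) = b (a x)} \<le> card {t \<in> G. sact t f (a x) = x}"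
        by (intro card_mono) (auto simp: finG)
      then show "real (card {t \<in> G. sact t f (a x) = x \<and> sact t f (a x) = b (a x)}) \<le> N / n"
        using sact1[OF ax x, of f] by linarith
    qed (use x ax B in \<open>auto intro!: sact2\<close>)
    also have "(\<Sum>y\<in>V - {a x}. N / (n * (n - 1))) = N / n"
      unfolding sum_constant card_single[OF ax] by (rule order_quotients(4))
    finally show "(\<Sum>y\<in>V. real (card {t \<in> G. sact t f (a x) = x \<and> sact t f y = b y})) \<le> 2 * (N / n)"
      by simp
  qed
  also have "\<dots> = 2 * N" using n_ge by simp
  finally show ?thesis .
qed

text \<open>With \<open>t\<close> frozen, \<open>opp_bound\<close> applies to the maps separated by
  the two occurrences of \<open>g\<close>. Its value is affine in each of their fixed-point counts,
  so averaging over \<open>t\<close> asks only for their means and the mean of their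
  product.\<close>

lemma cross_opp_bound:
  assumes a: "bij_betw a1 V V" "bij_betw a2 V V" and b: "bij_betw b1 V V" "bij_betw b2 V V"
  shows "(\<Sum>t\<in>G. \<Sum>g\<in>G. real (fixn (\<lambda>x. sact g e (a1 (sact t f (a2 (sact g (\<not> e) (b1 (sact t (\<not> f) (b2 x))))))))))
           \<le> N * N * (1 + 2 / n)"
    (is "(\<Sum>t\<in>G. ?F t) \<le> _")
proof -
  let ?p = "\<lambda>t. real (fixn (\<lambda>x. a1 (sact t f (a2 x))))"
  let ?q = "\<lambda>t. real (fixn (\<lambda>x. b1 (sact t (\<not> f) (b2 x))))"
  have comp: "bij_betw (\<lambda>x. p (q x)) V V" if "bij_betw p V V" "bij_betw q V V" for p q :: "'v \<Rightarrow> 'v"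
    using bij_betw_trans[OF that(2,1)] by (simp add: comp_def)
  have "(\<Sum>t\<in>G. ?F t)
      \<le> (\<Sum>t\<in>G. N * (?p t * ?q t / n + (n - ?p t) * (n - ?q t) / (n * (n - 1))))"
  proof (rule sum_mono)
    fix t assume t: "t \<in> G"
    show "?F t
      \<le> N * (?p t * ?q t / n + (n - ?p t) * (n - ?q t) / (n * (n - 1)))"
      using opp_bound[OF comp[OF a(1) comp[OF sact_bij[OF t] a(2)]] comp[OF b(1) comp[OF sact_bij[OF t] b(2)]]]
      by simp
  qed
  also have "\<dots> = N * (\<Sum>t\<in>G. ?p t * ?q t / n + (n - ?p t) * (n - ?q t) / (n * (n - 1)))"
    by (rule sum_distrib_left[symmetric])
  also have "(\<Sum>t\<in>G. ?p t * ?q t / n + (n - ?p t) * (n - ?q t) / (n * (n - 1)))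
     = (\<Sum>t\<in>G. ?p t * ?q t) / n + (\<Sum>t\<in>G. (n - ?p t) * (n - ?q t)) / (n * (n - 1))"
    by (simp add: sum.distrib sum_divide_distrib)
  also have "(\<Sum>t\<in>G. (n - ?p t) * (n - ?q t))
     = N * n\<^sup>2 - n * (\<Sum>t\<in>G. ?p t) - n * (\<Sum>t\<in>G. ?q t) + (\<Sum>t\<in>G. ?p t * ?q t)"
    by (rule sum_prod_diff[of n ?p ?q G])
  also have "(\<Sum>t\<in>G. ?p t) = N"
  proof -
    have "(\<Sum>t\<in>G. ?p t) = (\<Sum>t\<in>G. real (fixn (\<lambda>x. sact t f (a2 (a1 x)))))"
      by (intro sum.cong refl arg_cong[where f = real] fixn_conj_inner a sact_bij)
    then show ?thesis using once_bound[OF comp[OF a(2,1)]] by simp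
  qed
  also have "(\<Sum>t\<in>G. ?q t) = N"
  proof -
    have "(\<Sum>t\<in>G. ?q t) = (\<Sum>t\<in>G. real (fixn (\<lambda>x. sact t (\<not> f) (b2 (b1 x)))))"
      by (intro sum.cong refl arg_cong[where f = real] fixn_conj_inner b sact_bij)
    then show ?thesis using once_bound[OF comp[OF b(2,1)]] by simp
  qed
  \<comment> \<open>The product has a positive coefficient, so an upper bound for its mean suffices;
    the linear terms come with negative sign and have been evaluated exactly.\<close>
  also have "N * ((\<Sum>t\<in>G. ?p t * ?q t) / n + (N * n\<^sup>2 - n * N - n * N + (\<Sum>t\<in>G. ?p t * ?q t)) / (n * (n - 1)))
     \<le> N * (2 * N / n + (N * n\<^sup>2 - n * N - n * N + 2 * N) / (n * (n - 1)))"
    using n_ge N_pos sum_fixn_mult[OF a b, of f]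
    by (intro mult_left_mono add_mono divide_right_mono order_refl) auto
  also have "2 * N / n + (N * n\<^sup>2 - n * N - n * N + 2 * N) / (n * (n - 1)) = N * (n / (n - 1))"
    using n_ge by (rule opposite_mean_identity)
  \<comment> \<open>Weakened to the value that \<open>cross_same_bound\<close> yields, so that a
    crossing word and its two sign changes share one bound.\<close>
  also have "N * (N * (n / (n - 1))) \<le> N * (N * (1 + 2 / n))"
  proof -
    have "3 * n \<le> n * n" using n_ge by (intro mult_right_mono) auto
    then have "n / (n - 1) \<le> 1 + 2 / n" using n_ge by (simp add: divide_simps) (simp add: algebra_simps)
    then show ?thesis by (intro mult_left_mono) auto
  qed
  finally show ?thesis by (simp add: mult.assoc)
qed

text \<open>With \<open>t\<close> frozen, \<open>same_bound\<close> leaves the mean number of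
  coincidences of the two maps in between. As \<open>t\<close> occurs in them with opposite signs, a
  coincidence is an equation that contains \<open>t\<close> twice with the same sign, so each
  \<open>x\<close> has share at most \<open>2 / n\<close>.\<close>

lemma cross_same_bound:
  assumes a: "bij_betw a1 V V" "bij_betw a2 V V" and b: "bij_betw b1 V V" "bij_betw b2 V V"
  shows "(\<Sum>t\<in>G. \<Sum>g\<in>G. real (fixn (\<lambda>x. sact g e (a1 (sact t f (a2 (sact g e (b1 (sact t (\<not> f) (b2 x))))))))))
           \<le> N * N * (1 + 2 / n)"
    (is "(\<Sum>t\<in>G. ?F t) \<le> _")
proof -
  have comp: "bij_betw (\<lambda>x. p (q x)) V V" if "bij_betw p V V" "bij_betw q V V" for p q :: "'v \<Rightarrow> 'v"
    using bij_betw_trans[OF that(2,1)] by (simp add: comp_def)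
  let ?c = "\<lambda>t. real (card {x \<in> V. a1 (sact t f (a2 x)) = b1 (sact t (\<not> f) (b2 x))})"
  \<comment> \<open>Solving for \<open>b2 x\<close> turns a coincidence at \<open>x\<close> into
    \<open>t (c (t (a2 x))) = b2 x\<close>, where \<open>t\<close> stands for
    \<open>sact t f\<close>.\<close>
  define c where "c = (\<lambda>x. inv_into V b1 (a1 x))"
  have c: "bij_betw c V V" unfolding c_def by (rule comp[OF bij_betw_inv_into[OF b(1)] a(1)])
  have "(\<Sum>t\<in>G. ?F t)
      \<le> (\<Sum>t\<in>G. N * (1 + ?c t / n))"
  proof (rule sum_mono)
    fix t assume t: "t \<in> G"
    show "?F t
      \<le> N * (1 + ?c t / n)"
      using same_bound[OF comp[OF a(1) comp[OF sact_bij[OF t] a(2)]] comp[OF b(1) comp[OF sact_bij[OF t] b(2)]]]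
      by simp
  qed
  also have "\<dots> = N * (N + (\<Sum>t\<in>G. ?c t) / n)"
    by (simp add: sum_distrib_left[symmetric] sum.distrib sum_divide_distrib)
  also have "(\<Sum>t\<in>G. ?c t) = (\<Sum>x\<in>V. real (card {t \<in> G. a1 (sact t f (a2 x)) = b1 (sact t (\<not> f) (b2 x))}))"
    unfolding of_nat_sum[symmetric] of_nat_eq_iff
    by (rule sum_multicount_gen[where R = "\<lambda>t x. a1 (sact t f (a2 x)) = b1 (sact t (\<not> f) (b2 x))", simplified])
      (auto simp: finV finG)
  also have "\<dots> \<le> (\<Sum>x\<in>V. 2 * (N / n))"
  proof (rule sum_mono)
    fix x assume x: "x \<in> V"
    have "{t \<in> G. a1 (sact t f (a2 x)) = b1 (sact t (\<not> f) (b2 x))}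
       = {t \<in> G. sact t f (c (sact t f (a2 x))) = b2 x}"
    proof (intro Collect_cong conj_cong refl)
      fix t assume t: "t \<in> G"
      let ?u = "sact t f (a2 x)" and ?v = "sact t (\<not> f) (b2 x)"
      have u: "?u \<in> V" "?v \<in> V" "b2 x \<in> V" using t x bij_in a b sact_in by simp_all
      have "a1 ?u = b1 ?v \<longleftrightarrow> c ?u = ?v"
        using u bij_in[OF a(1)] bij_betw_inv_into_left[OF b(1)] bij_betw_inv_into_right[OF b(1)]
        by (metis c_def)
      also have "\<dots> \<longleftrightarrow> sact t f (c ?u) = b2 x"
        using sact_flip[OF t u(3) bij_in[OF c u(1)], of f] by auto
      finally show "a1 ?u = b1 ?v \<longleftrightarrow> sact t f (c ?u) = b2 x" .
    qed
    then have "real (card {t \<in> G. a1 (sact t f (a2 x)) = b1 (sact t (\<not> f) (b2 x))})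
       \<le> N / n * (1 + of_bool (c (b2 x) = a2 x))"
      using same_pointwise[OF c bij_in[OF a(2) x] bij_in[OF b(2) x]] by simp
    also have "\<dots> \<le> N / n * 2" by (intro mult_left_mono) auto
    also have "\<dots> = 2 * (N / n)" by simp
    finally show "real (card {t \<in> G. a1 (sact t f (a2 x)) = b1 (sact t (\<not> f) (b2 x))}) \<le> 2 * (N / n)" .
  qed
  finally have "(\<Sum>t\<in>G. ?F t)
     \<le> N * (N + (\<Sum>x\<in>V. 2 * (N / n)) / n)"
    using N_pos n_ge by (simp add: divide_right_mono)
  also have "\<dots> = N * N * (1 + 2 / n)" using n_ge by (simp add: field_simps)
  finally show ?thesis .
qed

end

section \<open>Words and their counting\<close>

type_synonym word = "(nat \<times> bool) list"

definition words :: "nat set \<Rightarrow> nat \<Rightarrow> word set" where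
  "words D l = {w. set w \<subseteq> D \<times> UNIV \<and> length w = l}"

definition occ :: "word \<Rightarrow> nat \<Rightarrow> word" where
  "occ w j = filter (\<lambda>x. fst x = j) w"

definition restr :: "nat set \<Rightarrow> word \<Rightarrow> word" where
  "restr I w = filter (\<lambda>x. fst x \<in> I) w"

definition erase :: "nat set \<Rightarrow> word \<Rightarrow> word" where
  "erase I w = filter (\<lambda>x. fst x \<notin> I) w"

text \<open>For \<open>p \<ge> 1\<close> these are the words counted by
  \<open>Xp p 0 l (card D)\<close>.\<close>

definition wmin :: "nat \<Rightarrow> nat set \<Rightarrow> nat \<Rightarrow> word set" where
  "wmin p D l = {w \<in> words D l. \<forall>j\<in>D. occ w j = [] \<or> p \<le> length (occ w j)}"

definition exact :: "nat \<Rightarrow> word \<Rightarrow> nat set" where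
  "exact p w = {j. length (occ w j) = p}"

text \<open>\<open>Q\<close> restricts the signs of the occurrences of each letter; it is constantly
  true or \<open>opposite\<close>.\<close>

definition exwords :: "(word \<Rightarrow> bool) \<Rightarrow> nat \<Rightarrow> nat set \<Rightarrow> word set" where
  "exwords Q p I = {w \<in> words I (p * card I). \<forall>j\<in>I. length (occ w j) = p \<and> Q (occ w j)}"

text \<open>Shuffles of words in the letters \<open>I\<close> with words in the other letters. They
  are described by their two subwords, so that an operation on the letters of \<open>I\<close>
  leaves the condition on the rest untouched.\<close>

definition mixed :: "nat set \<Rightarrow> word set \<Rightarrow> word set \<Rightarrow> word set" where
  "mixed I A B = {w. restr I w \<in> A \<and> erase I w \<in> B}"

lemma occ_Nil [simp]: "occ [] j = []" by (simp add: occ_def)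
lemma occ_Cons [simp]: "occ (x # w) j = (if fst x = j then x # occ w j else occ w j)" by (simp add: occ_def)
lemma occ_append [simp]: "occ (u @ v) j = occ u j @ occ v j" by (simp add: occ_def)

lemma occ_restr: "occ (restr I w) j = (if j \<in> I then occ w j else [])"
  by (auto simp: occ_def restr_def filter_empty_conv intro!: filter_cong)

lemma occ_erase: "occ (erase I w) j = (if j \<in> I then [] else occ w j)"
  by (auto simp: occ_def erase_def filter_empty_conv intro!: filter_cong)

lemma occ_eq_Nil: "occ w j = [] \<longleftrightarrow> j \<notin> fst ` set w"
  by (auto simp: occ_def filter_empty_conv image_iff)

lemma finite_words: "finite D \<Longrightarrow> finite (words D l)"
  unfolding words_def by (rule finite_lists_length_eq) simp

lemma card_words: "finite D \<Longrightarrow> card (words D l) = (2 * card D) ^ l"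
  unfolding words_def by (subst card_lists_length_eq) (auto simp: card_cartesian_product mult.commute)

lemma set_words: "w \<in> words D l \<Longrightarrow> fst ` set w \<subseteq> D"
  by (auto simp: words_def)

text \<open>Over disjoint alphabets a shuffle determines its two parts, so the union is disjoint and
  sizes multiply in \<open>card_mixed\<close>.\<close>

lemma mixed_eq_shuffles:
  assumes "A \<subseteq> words I a" "B \<subseteq> words J b" "I \<inter> J = {}"
  shows "mixed I A B = (\<Union>(x, y)\<in>A \<times> B. shuffles x y)" (is "?L = ?R")
    and "\<And>x y w. x \<in> A \<Longrightarrow> y \<in> B \<Longrightarrow> w \<in> shuffles x y \<Longrightarrow> restr I w = x \<and> erase I w = y"
proof -
  show *: "restr I w = x \<and> erase I w = y" if "x \<in> A" "y \<in> B" "w \<in> shuffles x y" for x y w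
  proof -
    have x: "fst ` set x \<subseteq> I" and y: "fst ` set y \<inter> I = {}"
      using that assms set_words[of x I a] set_words[of y J b] by blast+
    then have "set x \<inter> set y = {}" by blast
    then have f: "filter (\<lambda>z. z \<in> set x) w = x" "filter (\<lambda>z. z \<notin> set x) w = y"
      using filter_shuffles_disjoint1 that(3) by blast+
    have "set w = set x \<union> set y" using that(3) by (rule set_shuffles)
    then have "fst z \<in> I \<longleftrightarrow> z \<in> set x" if "z \<in> set w" for z
      using x y that by auto
    then have "restr I w = filter (\<lambda>z. z \<in> set x) w" "erase I w = filter (\<lambda>z. z \<notin> set x) w"
      unfolding restr_def erase_def by (auto intro!: filter_cong)
    with f show ?thesis by simp
  qed
  show "?L = ?R"
  proof
    show "?L \<subseteq> ?R"
      using partition_in_shuffles[where P = "\<lambda>x. fst x \<in> I"] by (auto simp: mixed_def restr_def erase_def)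
    show "?R \<subseteq> ?L" using * by (auto simp: mixed_def)
  qed
qed

lemma card_mixed:
  assumes "A \<subseteq> words I a" "B \<subseteq> words J b" "I \<inter> J = {}" "finite I" "finite J"
  shows "card (mixed I A B) = ((a + b) choose a) * card A * card B"
proof -
  have fin: "finite A" "finite B" using assms finite_words finite_subset by blast+
  have "card (mixed I A B) = (\<Sum>(x, y)\<in>A \<times> B. card (shuffles x y))"
    unfolding mixed_eq_shuffles(1)[OF assms(1-3)]
  proof (subst card_UN_disjoint)
    show "finite (A \<times> B)" using fin by simp
    show "\<forall>i\<in>A \<times> B. finite (case i of (x, y) \<Rightarrow> shuffles x y)" by auto
    show "\<forall>i\<in>A \<times> B. \<forall>j\<in>A \<times> B. i \<noteq> j \<longrightarrow> (case i of (x, y) \<Rightarrow> shuffles x y) \<inter> (case j of (x, y) \<Rightarrow> shuffles x y) = {}"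
    proof (intro ballI impI equals0I)
      fix i j w assume "i \<in> A \<times> B" "j \<in> A \<times> B" "i \<noteq> j"
        and "w \<in> (case i of (x, y) \<Rightarrow> shuffles x y) \<inter> (case j of (x, y) \<Rightarrow> shuffles x y)"
      then have "i = (restr I w, erase I w)" "j = (restr I w, erase I w)"
        using mixed_eq_shuffles(2)[OF assms(1-3), of "fst i" "snd i" w]
          mixed_eq_shuffles(2)[OF assms(1-3), of "fst j" "snd j" w]
        by (auto simp: case_prod_beta mem_Times_iff prod_eq_iff)
      with \<open>i \<noteq> j\<close> show False by simp
    qed
  qed (auto intro!: sum.cong)
  also have "\<dots> = (\<Sum>(x, y)\<in>A \<times> B. (a + b) choose a)"
  proof (rule sum.cong[OF refl], clarify)
    fix x y assume "x \<in> A" "y \<in> B"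
    then have "x \<in> words I a" "y \<in> words J b" using assms by auto
    then have "set x \<inter> set y = {}" "length x = a" "length y = b" using assms(3) by (auto simp: words_def)
    then show "card (shuffles x y) = (a + b) choose a" by (simp add: card_disjoint_shuffles)
  qed
  also have "\<dots> = ((a + b) choose a) * card A * card B" by (simp add: card_cartesian_product)
  finally show ?thesis .
qed

lemma length_restr_erase: "length w = length (restr I w) + length (erase I w)"
  unfolding restr_def erase_def using sum_length_filter_compl[of "\<lambda>x. fst x \<in> I" w] by simp

lemma words_mixed:
  assumes "w \<in> mixed I (words I a) (words (D - I) b)" "I \<subseteq> D"
  shows "w \<in> words D (a + b)"
proof -
  have "set w \<subseteq> set (restr I w) \<union> set (erase I w)" by (auto simp: restr_def erase_def)
  moreover have "set (restr I w) \<subseteq> I \<times> UNIV" "set (erase I w) \<subseteq> (D - I) \<times> UNIV"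
    using assms by (auto simp: mixed_def words_def)
  moreover have "length w = a + b"
    using length_restr_erase[of w I] assms by (auto simp: mixed_def words_def)
  ultimately show ?thesis using assms(2) unfolding words_def by blast
qed

lemma exwords_insert:
  assumes "finite I" "j \<notin> I"
  shows "exwords Q p (insert j I) = mixed {j} (exwords Q p {j}) (exwords Q p I)"
proof (intro equalityI subsetI)
  fix w assume w: "w \<in> exwords Q p (insert j I)"
  then have s: "set w \<subseteq> insert j I \<times> UNIV" and l: "length w = p * card (insert j I)"
    and o: "\<And>i. i \<in> insert j I \<Longrightarrow> length (occ w i) = p \<and> Q (occ w i)"
    by (auto simp: exwords_def words_def)
  have r: "restr {j} w = occ w j" by (simp add: restr_def occ_def)
  have "length (restr {j} w) = p" using o r by simp
  then have "length (erase {j} w) = p * card I"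
    using length_restr_erase[of w "{j}"] l assms by simp
  moreover have "set (erase {j} w) \<subseteq> I \<times> UNIV" "set (restr {j} w) \<subseteq> {j} \<times> UNIV"
    using s by (auto simp: erase_def restr_def)
  ultimately show "w \<in> mixed {j} (exwords Q p {j}) (exwords Q p I)"
    using o assms by (auto simp: mixed_def exwords_def words_def occ_restr occ_erase r)
next
  fix w assume w: "w \<in> mixed {j} (exwords Q p {j}) (exwords Q p I)"
  then have "w \<in> mixed {j} (words {j} p) (words (insert j I - {j}) (p * card I))"
    using assms by (auto simp: mixed_def exwords_def)
  then have "w \<in> words (insert j I) (p * card (insert j I))"
    using words_mixed[of w "{j}" p "insert j I" "p * card I"] assms by simp
  moreover have "length (occ w i) = p \<and> Q (occ w i)" if "i \<in> insert j I" for i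
    using that w assms occ_restr[of "{j}" w i] occ_erase[of "{j}" w i]
    by (cases "i = j") (auto simp: mixed_def exwords_def)
  ultimately show "w \<in> exwords Q p (insert j I)" by (auto simp: exwords_def)
qed

lemma exwords_subset: "exwords Q p I \<subseteq> words I (p * card I)"
  by (auto simp: exwords_def)

text \<open>The multinomial number \<open>(p i)! / p! ^ i\<close> of arrangements, with
  \<open>i = card I\<close>, times \<open>c\<close> sign patterns per letter; the denominator stands
  on the left to stay within the natural numbers.\<close>

lemma card_exwords:
  assumes "finite I" and base: "\<And>j. card (exwords Q p {j}) = c"
  shows "card (exwords Q p I) * fact p ^ card I = fact (p * card I) * c ^ card I"
  using assms(1)
proof (induction I rule: finite_induct)
  case empty
  have "exwords Q p {} = {[]}" by (auto simp: exwords_def words_def)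
  then show ?case by simp
next
  case (insert j I)
  have "card (exwords Q p (insert j I)) = ((p + p * card I) choose p) * c * card (exwords Q p I)"
    unfolding exwords_insert[OF insert.hyps] base[of j, symmetric]
    using exwords_subset[of Q p "{j}"] insert.hyps by (intro card_mixed[where J = I] exwords_subset) auto
  then have "card (exwords Q p (insert j I)) * fact p ^ card (insert j I)
     = ((p + p * card I) choose p) * fact p * c * (card (exwords Q p I) * fact p ^ card I)"
    using insert.hyps by simp
  also have "\<dots> = (fact p * fact (p * card I) * ((p + p * card I) choose p)) * c * c ^ card I"
    unfolding insert.IH by simp
  also have "fact p * fact (p * card I) * ((p + p * card I) choose p) = (fact (p + p * card I) :: nat)"
    using binomial_fact_lemma[of p "p + p * card I"] by simp
  finally show ?case using insert.hyps by simp
qed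

lemma card_exwords_True: "card (exwords (\<lambda>_. True) p {j}) = 2 ^ p"
proof -
  have "length (occ w j) = length w" if "w \<in> words {j} p" for w
  proof -
    have "occ w j = w" unfolding occ_def using that by (intro filter_True) (auto simp: words_def)
    then show ?thesis by simp
  qed
  then have "exwords (\<lambda>_. True) p {j} = words {j} p" by (auto simp: exwords_def words_def)
  then show ?thesis by (simp add: card_words)
qed

text \<open>One branch of the recursion for \<open>Xp\<close>: the letters of multiplicity
  \<open>p\<close> form the set \<open>I\<close>, all others are absent or exceed
  \<open>p\<close>.\<close>

definition wexact :: "nat \<Rightarrow> nat set \<Rightarrow> nat \<Rightarrow> nat set \<Rightarrow> word set" where
  "wexact p D l I = mixed I (exwords (\<lambda>_. True) p I) (wmin (Suc p) (D - I) (l - p * card I))"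

lemma wmin_exact:
  assumes "finite D" "p \<ge> 1" "I \<subseteq> D"
  shows "{w \<in> wmin p D l. exact p w = I} = (if p * card I \<le> l then wexact p D l I else {})" (is "?L = ?R")
proof (intro equalityI subsetI)
  fix w assume "w \<in> ?L"
  then have w: "w \<in> words D l" "\<And>j. j \<in> D \<Longrightarrow> occ w j = [] \<or> p \<le> length (occ w j)" "exact p w = I"
    by (auto simp: wmin_def)
  have o: "length (occ w j) = p \<longleftrightarrow> j \<in> I" for j using w(3) by (auto simp: exact_def)
  have fI: "finite I" using assms finite_subset by auto
  have sr: "set (restr I w) \<subseteq> I \<times> UNIV" by (auto simp: restr_def)
  have len: "length u = (\<Sum>j\<in>I. length (occ u j))" if "set u \<subseteq> I \<times> UNIV" for u
    using that
  proof (induction u)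
    case (Cons x u)
    then have "fst x \<in> I" by auto
    have "(\<Sum>j\<in>I. length (occ (x # u) j)) = (\<Sum>j\<in>I. of_bool (j = fst x) + length (occ u j))"
      by (rule sum.cong) auto
    also have "\<dots> = 1 + (\<Sum>j\<in>I. length (occ u j))"
      using fI \<open>fst x \<in> I\<close> by (simp add: sum.distrib Int_def Collect_conv_if)
    finally show ?case using Cons by simp
  qed simp
  have "length (restr I w) = (\<Sum>j\<in>I. p)" unfolding len[OF sr] by (rule sum.cong) (auto simp: occ_restr o)
  then have lr: "length (restr I w) = p * card I" by (simp add: mult.commute)
  then have ld: "length (erase I w) = l - p * card I" and le: "p * card I \<le> l"
    using length_restr_erase[of w I] w(1) by (auto simp: words_def)
  have "restr I w \<in> exwords (\<lambda>_. True) p I"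
    using sr lr o by (auto simp: exwords_def words_def occ_restr)
  moreover have "erase I w \<in> wmin (Suc p) (D - I) (l - p * card I)"
  proof -
    have "set (erase I w) \<subseteq> (D - I) \<times> UNIV" using w(1) by (auto simp: words_def erase_def)
    moreover have "occ w j = [] \<or> Suc p \<le> length (occ w j)" if "j \<in> D - I" for j
      using w(2)[of j] o[of j] that by auto
    ultimately show ?thesis using ld by (simp add: wmin_def words_def occ_erase)
  qed
  ultimately show "w \<in> ?R" using le by (simp add: wexact_def mixed_def)
next
  fix w assume "w \<in> ?R"
  then have le: "p * card I \<le> l" and w: "restr I w \<in> exwords (\<lambda>_. True) p I"
     "erase I w \<in> wmin (Suc p) (D - I) (l - p * card I)"
    by (auto simp: wexact_def mixed_def split: if_splits)
  then have "w \<in> mixed I (words I (p * card I)) (words (D - I) (l - p * card I))"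
    by (auto simp: mixed_def exwords_def wmin_def)
  from words_mixed[OF this assms(3)] le have wd: "w \<in> words D l" by simp
  have oI: "length (occ w j) = p" if "j \<in> I" for j
    using w(1) that by (auto simp: exwords_def occ_restr)
  have oD: "occ w j = [] \<or> Suc p \<le> length (occ w j)" if "j \<notin> I" for j
  proof (cases "j \<in> D")
    case True then show ?thesis using w(2) that by (auto simp: wmin_def occ_erase)
  next
    case False then show ?thesis using wd set_words[OF wd] occ_eq_Nil by auto
  qed
  have "length (occ w j) = p \<longleftrightarrow> j \<in> I" for j
    using oI[of j] oD[of j] assms(2) by (cases "j \<in> I") auto
  then have "exact p w = I" by (auto simp: exact_def)
  moreover have "occ w j = [] \<or> p \<le> length (occ w j)" for j
    using oI[of j] oD[of j] by (cases "j \<in> I") auto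
  then have "w \<in> wmin p D l" using wd by (simp add: wmin_def)
  ultimately show "w \<in> ?L" by simp
qed

lemma exact_subset: "p \<ge> 1 \<Longrightarrow> w \<in> words D l \<Longrightarrow> exact p w \<subseteq> D"
proof
  fix j assume p: "p \<ge> 1" and w: "w \<in> words D l" and "j \<in> exact p w"
  then have "occ w j \<noteq> []" by (auto simp: exact_def)
  then show "j \<in> D" using set_words[OF w] by (auto simp: occ_eq_Nil)
qed

lemma finite_wmin: "finite D \<Longrightarrow> finite (wmin p D l)"
  unfolding wmin_def using finite_words by simp

declare Xp.simps [simp del]

text \<open>The factor \<open>(p i)!\<close> from arranging the letters of \<open>I\<close> cancels
  against the denominator of \<open>l choose (p i)\<close>; what remains is the weight of a summand
  of \<open>Xp\<close>.\<close>

lemma card_wexact: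
  assumes "finite D" "I \<subseteq> D" "p * card I \<le> l"
  shows "real (card (wexact p D l I))
    = (2 ^ p / fact p) ^ card I * (fact l / fact (l - p * card I)) * real (card (wmin (Suc p) (D - I) (l - p * card I)))"
proof -
  let ?i = "card I"
  have fI: "finite I" using assms finite_subset by auto
  have "real (card (exwords (\<lambda>_. True) p I)) * fact p ^ ?i = fact (p * ?i) * (2 ^ p) ^ ?i"
    using card_exwords[OF fI card_exwords_True, of p, THEN arg_cong[where f = real]] by simp
  then have e: "real (card (exwords (\<lambda>_. True) p I)) = fact (p * ?i) * (2 ^ p / fact p) ^ ?i"
    by (simp add: field_simps power_divide)
  have "card (wexact p D l I) = (l choose (p * ?i)) * card (exwords (\<lambda>_. True) p I) * card (wmin (Suc p) (D - I) (l - p * ?i))"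
    unfolding wexact_def using assms fI
    by (subst card_mixed[where a = "p * ?i" and b = "l - p * ?i" and J = "D - I"])
       (auto simp: exwords_def wmin_def)
  moreover have "real (l choose (p * ?i)) * fact (p * ?i) = fact l / fact (l - p * ?i)"
    using binomial_fact[OF assms(3), where 'a = real] by (simp add: field_simps)
  moreover have "real (card (wexact p D l I)) = (real (l choose (p * ?i)) * fact (p * ?i)) * (2 ^ p / fact p) ^ ?i
      * real (card (wmin (Suc p) (D - I) (l - p * ?i)))"
    unfolding calculation(1) of_nat_mult e by (simp only: mult.assoc)
  ultimately show ?thesis by (simp only: mult_ac)
qed

text \<open>The combinatorial meaning of \<open>Xp\<close>: sort the words by the set of letters of
  multiplicity exactly \<open>p\<close>, delete these letters, and continue with multiplicities of
  at least \<open>p + 1\<close>. The parameter \<open>c\<close> demands at least \<open>c\<close>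
  such letters and is dropped after one level.\<close>

lemma card_wmin:
  assumes "finite D" "p \<ge> 1"
  shows "real (card {w \<in> wmin p D l. card (exact p w) \<ge> c}) = Xp p c l (card D)"
  using assms
proof (induction p c l "card D" arbitrary: D rule: Xp.induct)
  case (1 p c l)
  note fD = \<open>finite D\<close>
  have exf: "exact p w \<subseteq> D" if "w \<in> wmin p D l" for w
    using exact_subset[OF \<open>1 \<le> p\<close>, of w D l] that by (auto simp: wmin_def)
  show ?case
  proof (cases "c = 0 \<and> l = 0")
    case True
    then have "{w \<in> wmin p D l. c \<le> card (exact p w)} = {[]}"
      by (auto simp: wmin_def words_def)
    then show ?thesis using True by (simp add: Xp.simps)
  next
    case ncl: False
    show ?thesis
    proof (cases "p > l")
      case True
      \<comment> \<open>A word shorter than \<open>p\<close> has no letter of multiplicity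
        \<open>p\<close>, which excludes \<open>c > 0\<close>; for \<open>c = 0\<close> it is
        nonempty and its letters would occur too rarely.\<close>
      have "{w \<in> wmin p D l. c \<le> card (exact p w)} = {}"
      proof (intro equals0I)
        fix w assume w: "w \<in> {w \<in> wmin p D l. c \<le> card (exact p w)}"
        then have lw: "length w = l" by (auto simp: wmin_def words_def)
        have small: "length (occ w j) < p" for j
          unfolding occ_def using length_filter_le[of "\<lambda>x. fst x = j" w] lw True by linarith
        then have "exact p w = {}" by (auto simp: exact_def)
        then have "c = 0" using w by auto
        then have "l > 0" using ncl by simp
        then obtain x where "x \<in> set w" using lw by (cases w) auto
        then have "occ w (fst x) \<noteq> []" "fst x \<in> D" using w by (auto simp: occ_eq_Nil wmin_def words_def)
        then show False using small[of "fst x"] w by (auto simp: wmin_def)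
      qed
      moreover have "Xp p c l (card D) = 0" using True ncl by (simp add: Xp.simps)
      ultimately show ?thesis by (simp only: card.empty of_nat_0)
    next
      case False
      let ?W = "\<lambda>I. {w \<in> wmin p D l. exact p w = I}"
      have W: "real (card (?W I)) = (2 ^ p / fact p) ^ i * (fact l / fact (l - p * i)) * Xp (Suc p) 0 (l - p * i) (card D - i)"
        if "i \<in> {c..l div p}" "I \<subseteq> D" "card I = i" for i I
      proof -
        have "i * p \<le> l" using that(1) \<open>1 \<le> p\<close> by (simp add: less_eq_div_iff_mult_less_eq)
        then have le: "p * card I \<le> l" using that by (simp add: mult.commute)
        have fI: "finite I" using fD that finite_subset by auto
        have cd: "card (D - I) = card D - i" using that fI by (simp add: card_Diff_subset)
        have "real (card {w \<in> wmin (Suc p) (D - I) (l - p * i). 0 \<le> card (exact (Suc p) w)}) = Xp (Suc p) 0 (l - p * i) (card D - i)"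
          using 1(1)[OF ncl False that(1) cd[symmetric]] fD cd by simp
        then show ?thesis
          using wmin_exact[OF fD \<open>1 \<le> p\<close> that(2), of l] le card_wexact[OF fD that(2) le] that(3) by simp
      qed
      have "{w \<in> wmin p D l. c \<le> card (exact p w)} = (\<Union>i\<in>{c..l div p}. \<Union>I\<in>{I. I \<subseteq> D \<and> card I = i}. ?W I)"
      proof (intro equalityI subsetI)
        fix w assume w: "w \<in> {w \<in> wmin p D l. c \<le> card (exact p w)}"
        then have "w \<in> ?W (exact p w)" by simp
        then have "p * card (exact p w) \<le> l"
          using wmin_exact[OF fD \<open>1 \<le> p\<close> exf, of w l] w by (auto split: if_splits)
        then have "card (exact p w) \<le> l div p"
          using \<open>1 \<le> p\<close> by (simp add: less_eq_div_iff_mult_less_eq mult.commute)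
        then show "w \<in> (\<Union>i\<in>{c..l div p}. \<Union>I\<in>{I. I \<subseteq> D \<and> card I = i}. ?W I)" using w exf by auto
      qed auto
      also have "real (card \<dots>) = (\<Sum>i\<in>{c..l div p}. \<Sum>I\<in>{I. I \<subseteq> D \<and> card I = i}. real (card (?W I)))"
      proof (subst card_UN_disjoint)
        show "\<forall>i\<in>{c..l div p}. finite (\<Union>I\<in>{I. I \<subseteq> D \<and> card I = i}. ?W I)"
          using fD by (auto intro!: finite_subset[OF _ finite_wmin])
        show "real (\<Sum>i\<in>{c..l div p}. card (\<Union>I\<in>{I. I \<subseteq> D \<and> card I = i}. ?W I))
           = (\<Sum>i\<in>{c..l div p}. \<Sum>I\<in>{I. I \<subseteq> D \<and> card I = i}. real (card (?W I)))"
          unfolding of_nat_sum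
        proof (intro sum.cong refl)
          fix i
          have "card (\<Union>I\<in>{I. I \<subseteq> D \<and> card I = i}. ?W I) = (\<Sum>I\<in>{I. I \<subseteq> D \<and> card I = i}. card (?W I))"
            using fD by (intro card_UN_disjoint) (auto intro!: finite_subset[OF _ finite_wmin])
          then show "real (card (\<Union>I\<in>{I. I \<subseteq> D \<and> card I = i}. ?W I)) = (\<Sum>I\<in>{I. I \<subseteq> D \<and> card I = i}. real (card (?W I)))"
            by (simp only: of_nat_sum)
        qed
      qed auto
      also have "\<dots> = (\<Sum>i\<in>{c..l div p}. \<Sum>I\<in>{I. I \<subseteq> D \<and> card I = i}. (2 ^ p / fact p) ^ i * (fact l / fact (l - p * i)) * Xp (Suc p) 0 (l - p * i) (card D - i))"
        using W by (intro sum.cong refl) auto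
      also have "\<dots> = (\<Sum>i\<in>{c..l div p}. real (card D choose i) * (2 ^ p / fact p) ^ i * (fact l / fact (l - p * i)) * Xp (Suc p) 0 (l - p * i) (card D - i))"
        using n_subsets[OF fD] by (simp add: mult.assoc)
      also have "\<dots> = Xp p c l (card D)"
        using ncl False by (subst (2) Xp.simps) (auto intro!: sum.cong)
      finally show ?thesis .
    qed
  qed
qed

section \<open>Mean number of fixed points of a word\<close>

text \<open>The order of the two letters matters: the pattern \<open>t s t s\<close> is
  \<open>cross t s\<close>. Signs are ignored, which makes crossing invariant under sign
  changes.\<close>

definition cross :: "nat \<Rightarrow> nat \<Rightarrow> word \<Rightarrow> bool" where
  "cross s t w \<longleftrightarrow> s \<noteq> t \<and> map fst (restr {s, t} w) = [s, t, s, t]"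

lemma occ_split:
  assumes "occ w j = x # xs"
  obtains u v where "w = u @ x # v" "j \<notin> fst ` set u" "occ v j = xs" "fst x = j"
proof -
  from assms obtain u v where "w = u @ x # v" "\<forall>y\<in>set u. fst y \<noteq> j" "fst x = j" "xs = occ v j"
    unfolding occ_def filter_eq_Cons_iff by blast
  then show thesis using that[of u v] by (force simp: image_iff)
qed

lemma restr_split:
  assumes "restr I w = x # xs"
  obtains u v where "w = u @ x # v" "fst ` set u \<inter> I = {}" "restr I v = xs"
proof -
  from assms obtain u v where "w = u @ x # v" "\<forall>y\<in>set u. fst y \<notin> I" "xs = restr I v"
    unfolding restr_def filter_eq_Cons_iff by blast
  then show thesis using that[of u v] by (force simp: image_iff)
qed

lemma restr_Nil: "restr I w = [] \<longleftrightarrow> fst ` set w \<inter> I = {}"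
  by (auto simp: restr_def filter_empty_conv)

context vec_action begin

text \<open>The uniform distribution on these lists is that of \<open>d\<close> independent uniform
  generators.\<close>

definition tuples :: "nat \<Rightarrow> 'g list set" where
  "tuples d = {ss. length ss = d \<and> set ss \<subseteq> G}"

definition ev :: "'g list \<Rightarrow> word \<Rightarrow> 'v \<Rightarrow> 'v" where
  "ev ss w = foldr (\<lambda>(j, e). sact (ss ! j) e) w"

text \<open>The mean number of fixed points of \<open>w\<close>, multiplied by \<open>card (tuples d)\<close>.\<close>

definition total :: "nat \<Rightarrow> word \<Rightarrow> real" where
  "total d w = (\<Sum>ss\<in>tuples d. real (fixn (ev ss w)))"

abbreviation T where "T d \<equiv> real (card (tuples d))"

lemma ev_Nil [simp]: "ev ss [] x = x" by (simp add: ev_def)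
lemma ev_Cons [simp]: "ev ss (y # w) x = sact (ss ! fst y) (snd y) (ev ss w x)"
  by (simp add: ev_def case_prod_beta)
lemma ev_append [simp]: "ev ss (u @ v) x = ev ss u (ev ss v x)" by (simp add: ev_def)

lemma finite_tuples: "finite (tuples d)"
  unfolding tuples_def using finite_lists_length_eq[OF finG, of d] by (simp add: conj_commute)

lemma card_tuples: "card (tuples d) = card G ^ d"
  unfolding tuples_def using card_lists_length_eq[OF finG, of d] by (simp add: conj_commute)

lemma T_pos: "T d > 0" using N_pos by (simp add: card_tuples)

lemma tuples_nth: "ss \<in> tuples d \<Longrightarrow> j < d \<Longrightarrow> ss ! j \<in> G"
  by (auto simp: tuples_def)

lemma tuples_length: "ss \<in> tuples d \<Longrightarrow> length ss = d"
  by (simp add: tuples_def)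

lemma tuples_update: "ss \<in> tuples d \<Longrightarrow> g \<in> G \<Longrightarrow> ss[j := g] \<in> tuples d"
  using set_update_subset_insert[of ss j g] by (auto simp: tuples_def)

lemma ev_bij:
  assumes "ss \<in> tuples d" "fst ` set w \<subseteq> {..<d}"
  shows "bij_betw (ev ss w) V V"
  using assms(2)
proof (induction w)
  case Nil
  then show ?case by (simp add: bij_betw_def inj_on_def)
next
  case (Cons x w)
  then have "bij_betw (ev ss w) V V" "bij_betw (sact (ss ! fst x) (snd x)) V V"
    using tuples_nth[OF assms(1)] sact_bij by auto
  from bij_betw_trans[OF this] show ?case by (simp add: comp_def ev_Cons[abs_def] cong: bij_betw_cong)
qed

lemma ev_update: "j \<notin> fst ` set u \<Longrightarrow> ev (ss[j := g]) u x = ev ss u x"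
  by (induction u) auto

text \<open>Independence in finite form: the exchange of coordinate \<open>j\<close> with a fresh
  \<open>g\<close> is an involution on the pairs \<open>(ss, g)\<close>.\<close>

lemma sum_resample:
  assumes "j < d"
  shows "(\<Sum>ss\<in>tuples d. \<Sum>g\<in>G. H (ss[j := g])) = N * (\<Sum>ss\<in>tuples d. H ss :: real)"
proof -
  have "(\<Sum>ss\<in>tuples d. \<Sum>g\<in>G. H (ss[j := g])) = (\<Sum>(ss, g)\<in>tuples d \<times> G. H (ss[j := g]))"
    by (rule sum.cartesian_product)
  also have "\<dots> = (\<Sum>(ss, g)\<in>tuples d \<times> G. H ss)"
    using assms
    by (intro sum.reindex_bij_witness[where i = "\<lambda>(ss, g). (ss[j := g], ss ! j)" and j = "\<lambda>(ss, g). (ss[j := g], ss ! j)"])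
       (auto simp: tuples_nth tuples_update tuples_length)
  also have "\<dots> = N * (\<Sum>ss\<in>tuples d. H ss)"
    by (simp add: sum.cartesian_product[symmetric] sum_distrib_left)
  finally show ?thesis .
qed

text \<open>A mean is at most any common bound of the conditional means given the other
  generators.\<close>

lemma resample_le:
  assumes "j < d" "\<And>ss. ss \<in> tuples d \<Longrightarrow> (\<Sum>g\<in>G. H (ss[j := g])) \<le> N * c"
  shows "(\<Sum>ss\<in>tuples d. H ss :: real) \<le> c * T d"
proof -
  have "N * (\<Sum>ss\<in>tuples d. H ss) \<le> (\<Sum>ss\<in>tuples d. N * c)"
    unfolding sum_resample[OF assms(1), symmetric] by (intro sum_mono assms(2))
  also have "\<dots> = N * (c * T d)" by simp
  finally show ?thesis using N_pos by (simp only: mult_le_cancel_left_pos)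
qed

lemma resample_le2:
  assumes "i < d" "j < d" "\<And>ss. ss \<in> tuples d \<Longrightarrow> (\<Sum>t\<in>G. \<Sum>g\<in>G. H (ss[i := t, j := g])) \<le> N * N * c"
  shows "(\<Sum>ss\<in>tuples d. H ss :: real) \<le> c * T d"
proof -
  have "(\<Sum>ss\<in>tuples d. \<Sum>g\<in>G. H (ss[j := g])) \<le> (N * c) * T d"
    using assms by (intro resample_le[OF assms(1)]) (simp add: mult.assoc)
  then have "N * (\<Sum>ss\<in>tuples d. H ss) \<le> N * (c * T d)"
    unfolding sum_resample[OF assms(2)] by (simp add: mult.assoc)
  then show ?thesis using N_pos by (simp only: mult_le_cancel_left_pos)
qed

lemma fixn_rotate:
  assumes "ss \<in> tuples d" "fst ` set (u @ v) \<subseteq> {..<d}"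
  shows "fixn (ev ss (u @ v)) = fixn (ev ss (v @ u))"
proof -
  have "bij_betw (ev ss u) V V" "bij_betw (ev ss v) V V" using assms by (auto intro!: ev_bij)
  from fixn_conj_inner[OF this(1) _ this(2), of "\<lambda>x. x"]
  show ?thesis by (simp add: bij_betw_def inj_on_def fixn_def)
qed

text \<open>Rotation conjugates the permutation and so preserves the number of fixed points; it
  serves to move a chosen occurrence to the front.\<close>

lemma total_rotate:
  assumes "fst ` set (u @ v) \<subseteq> {..<d}"
  shows "total d (u @ v) = total d (v @ u)"
  unfolding total_def using fixn_rotate assms by (intro sum.cong refl arg_cong[where f = real]) blast

lemma total_trivial: "total d w \<le> n * T d"
proof -
  have "total d w \<le> (\<Sum>ss\<in>tuples d. n)"
    unfolding total_def by (intro sum_mono of_nat_mono fixn_le)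
  then show ?thesis by (simp add: mult.commute)
qed

lemma total_once:
  assumes w: "fst ` set w \<subseteq> {..<d}" and o: "length (occ w j) = 1"
  shows "total d w \<le> T d"
proof -
  from o obtain x where "occ w j = [x]" by (auto simp: length_Suc_conv)
  then obtain u v where w': "w = u @ x # v" and j: "j \<notin> fst ` set u" "fst x = j" "occ v j = []"
    by (rule occ_split)
  define z where "z = v @ u"
  have z: "fst ` set z \<subseteq> {..<d}" "j \<notin> fst ` set z" "j < d" using w w' j by (auto simp: z_def occ_eq_Nil)
  have "total d w = total d (x # z)" using total_rotate[of u "x # v"] w w' by (simp add: z_def)
  also have "\<dots> \<le> 1 * T d"
    unfolding total_def
  proof (rule resample_le[OF z(3)])
    fix ss assume ss: "ss \<in> tuples d"
    then have "length ss = d" by (simp add: tuples_def)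
    then show "(\<Sum>g\<in>G. real (fixn (ev (ss[j := g]) (x # z)))) \<le> N * 1"
      using once_bound[OF ev_bij[OF ss z(1)], of "snd x"] z j by (simp add: fixn_def ev_update)
  qed
  finally show ?thesis by simp
qed

lemma total_same:
  assumes w: "fst ` set w \<subseteq> {..<d}" and o: "occ w j = [(j, e), (j, e)]"
  shows "total d w \<le> 2 * T d"
proof -
  from o obtain u v where w': "w = u @ (j, e) # v" and j: "j \<notin> fst ` set u" "occ v j = [(j, e)]"
    by (rule occ_split) 
  from j(2) obtain v1 v2 where v: "v = v1 @ (j, e) # v2" and jv: "j \<notin> fst ` set v1" "occ v2 j = []"
    by (rule occ_split)
  define z where "z = v2 @ u"
  have z: "fst ` set z \<subseteq> {..<d}" "j \<notin> fst ` set z" "j < d" "fst ` set v1 \<subseteq> {..<d}"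
    using w w' v j jv by (auto simp: z_def occ_eq_Nil)
  have "total d w = total d ((j, e) # v1 @ (j, e) # z)"
    using total_rotate[of u "(j, e) # v"] w w' v by (simp add: z_def)
  also have "\<dots> \<le> 2 * T d"
    unfolding total_def
  proof (rule resample_le[OF z(3)])
    fix ss assume ss: "ss \<in> tuples d"
    then have "length ss = d" by (simp add: tuples_def)
    then show "(\<Sum>g\<in>G. real (fixn (ev (ss[j := g]) ((j, e) # v1 @ (j, e) # z)))) \<le> N * 2"
      using same_bound2[OF ev_bij[OF ss z(4)] ev_bij[OF ss z(1)], of e] z jv by (simp add: fixn_def ev_update)
  qed
  finally show ?thesis .
qed

text \<open>
  For the sign pattern \<open>+ - +\<close> the images of a single point are not equidistributed: if the two words
  in between act as transvections, a point can be fixed with probability about \<open>1/4\<close>. Only the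
  sum over all points is bounded, so the word is rotated until the first two signs agree.
\<close>

lemma total_thrice:
  assumes w: "fst ` set w \<subseteq> {..<d}" and o: "length (occ w j) = 3"
  shows "total d w \<le> 5 * T d"
proof -
  from o obtain x1 x2 x3 where "occ w j = [x1, x2, x3]" by (auto simp: numeral_3_eq_3 length_Suc_conv)
  then obtain u v where w': "w = u @ x1 # v" and j: "j \<notin> fst ` set u" "occ v j = [x2, x3]" "fst x1 = j"
    by (rule occ_split)
  from j(2) obtain a v' where v: "v = a @ x2 # v'" and jv: "j \<notin> fst ` set a" "occ v' j = [x3]" "fst x2 = j"
    by (rule occ_split)
  from jv(2) obtain b v'' where v': "v' = b @ x3 # v''" and jv': "j \<notin> fst ` set b" "occ v'' j = []" "fst x3 = j"
    by (rule occ_split)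
  define c where "c = v'' @ u"
  have z: "fst ` set a \<subseteq> {..<d}" "fst ` set b \<subseteq> {..<d}" "fst ` set c \<subseteq> {..<d}" "j \<notin> fst ` set c" "j < d"
    using w w' v v' j jv jv' by (auto simp: c_def occ_eq_Nil)
  have rot: "total d w = total d (x1 # a @ x2 # b @ x3 # c)"
    using total_rotate[of u "x1 # v"] w w' v v' by (simp add: c_def)
  have main: "total d (y1 # p @ y2 # q @ y3 # r) \<le> 5 * T d"
    if "fst y1 = j" "fst y2 = j" "fst y3 = j" "snd y1 = snd y2"
      "fst ` set p \<subseteq> {..<d}" "fst ` set q \<subseteq> {..<d}" "fst ` set r \<subseteq> {..<d}"
      "j \<notin> fst ` set p" "j \<notin> fst ` set q" "j \<notin> fst ` set r" for y1 y2 y3 p q r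
    unfolding total_def
  proof (rule resample_le[OF z(5)])
    fix ss assume ss: "ss \<in> tuples d"
    then have "length ss = d" by (simp add: tuples_def)
    then show "(\<Sum>g\<in>G. real (fixn (ev (ss[j := g]) (y1 # p @ y2 # q @ y3 # r)))) \<le> N * 5"
      using triple_bound[OF ev_bij[OF ss that(5)] ev_bij[OF ss that(6)] ev_bij[OF ss that(7)], of "snd y1" "snd y3"]
        that z(5) by (simp add: fixn_def ev_update)
  qed
  consider "snd x1 = snd x2" | "snd x2 = snd x3" | "snd x3 = snd x1" by argo
  then show ?thesis
  proof cases
    case 1
    then show ?thesis unfolding rot using z j jv jv' by (intro main) auto
  next
    case 2
    have "total d w = total d (x2 # b @ x3 # c @ x1 # a)"
      unfolding rot using total_rotate[of "x1 # a" "x2 # b @ x3 # c" d] z j jv jv' by (auto simp: image_Un)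
    also have "\<dots> \<le> 5 * T d" using 2 z j jv jv' by (intro main) auto
    finally show ?thesis .
  next
    case 3
    have "total d w = total d (x3 # c @ x1 # a @ x2 # b)"
      unfolding rot using total_rotate[of "x1 # a @ x2 # b" "x3 # c" d] z j jv jv' by (auto simp: image_Un)
    also have "\<dots> \<le> 5 * T d" using 3 z j jv jv' by (intro main) auto
    finally show ?thesis .
  qed
qed

text \<open>If \<open>t\<close> has opposite signs, the two cross bounds cover both possibilities
  for \<open>s\<close>. Otherwise \<open>s\<close> has opposite signs, and rotating the word past
  its first \<open>s\<close> exchanges the two roles. The hypothesis on the signs covers the
  all-opposite word as well as both of its sign changes.\<close>

lemma total_cross:
  assumes w: "fst ` set w \<subseteq> {..<d}" and cr: "cross s t w"
    and os: "occ w s = [(s, e), (s, e')]" and ot: "occ w t = [(t, f), (t, f')]" and opp: "e' \<noteq> e \<or> f' \<noteq> f"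
  shows "total d w \<le> (1 + 2 / n) * T d"
proof -
  have main: "total d ((s, e) # p @ (t, f) # q @ (s, e') # r @ (t, \<not> f) # z) \<le> (1 + 2 / n) * T d"
    if "s < d" "t < d" "s \<noteq> t" and sub: "fst ` set p \<subseteq> {..<d}" "fst ` set q \<subseteq> {..<d}" "fst ` set r \<subseteq> {..<d}" "fst ` set z \<subseteq> {..<d}"
      and nin: "fst ` set p \<inter> {s, t} = {}" "fst ` set q \<inter> {s, t} = {}" "fst ` set r \<inter> {s, t} = {}" "fst ` set z \<inter> {s, t} = {}"
    for s t e f e' p q r z
    unfolding total_def
  proof (rule resample_le2[OF that(2,1)])
    fix ss assume ss: "ss \<in> tuples d"
    then have l: "length ss = d" by (simp add: tuples_def)
    have upd: "ev (ss[t := h, s := g]) u x = ev ss u x" if "fst ` set u \<inter> {s, t} = {}" for h g u x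
      using that by (auto simp: ev_update)
    have eq: "fixn (ev (ss[t := h, s := g]) ((s, e) # p @ (t, f) # q @ (s, e') # r @ (t, \<not> f) # z))
      = fixn (\<lambda>x. sact g e (ev ss p (sact h f (ev ss q (sact g e' (ev ss r (sact h (\<not> f) (ev ss z x))))))))" for h g
      using that(1-3) l by (simp add: fixn_def upd[OF nin(1)] upd[OF nin(2)] upd[OF nin(3)] upd[OF nin(4)])
    note bij = ev_bij[OF ss sub(1)] ev_bij[OF ss sub(2)] ev_bij[OF ss sub(3)] ev_bij[OF ss sub(4)]
    show "(\<Sum>h\<in>G. \<Sum>g\<in>G. real (fixn (ev (ss[t := h, s := g]) ((s, e) # p @ (t, f) # q @ (s, e') # r @ (t, \<not> f) # z))))
      \<le> N * N * (1 + 2 / n)"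
      unfolding eq using cross_opp_bound[OF bij, of e f] cross_same_bound[OF bij, of e f]
      by (cases "e' = e") auto
  qed
  from cr have st: "s \<noteq> t" "map fst (restr {s, t} w) = [s, t, s, t]" by (auto simp: cross_def)
  then obtain x1 x2 x3 x4 where r: "restr {s, t} w = [x1, x2, x3, x4]"
    and x: "fst x1 = s" "fst x2 = t" "fst x3 = s" "fst x4 = t"
    by (auto simp: map_eq_Cons_conv)
  have "occ w s = occ (restr {s, t} w) s" "occ w t = occ (restr {s, t} w) t" by (simp_all add: occ_restr)
  then have x': "x1 = (s, e)" "x2 = (t, f)" "x3 = (s, e')" "x4 = (t, f')"
    using os ot x st(1) unfolding r by auto
  from r obtain u w1 where 1: "w = u @ x1 # w1" "fst ` set u \<inter> {s, t} = {}" "restr {s, t} w1 = [x2, x3, x4]"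
    by (rule restr_split)
  from 1(3) obtain p w2 where 2: "w1 = p @ x2 # w2" "fst ` set p \<inter> {s, t} = {}" "restr {s, t} w2 = [x3, x4]"
    by (rule restr_split)
  from 2(3) obtain q w3 where 3: "w2 = q @ x3 # w3" "fst ` set q \<inter> {s, t} = {}" "restr {s, t} w3 = [x4]"
    by (rule restr_split)
  from 3(3) obtain v w4 where 4: "w3 = v @ x4 # w4" "fst ` set v \<inter> {s, t} = {}" "restr {s, t} w4 = []"
    by (rule restr_split)
  define z where "z = w4 @ u"
  have sub: "fst ` set p \<subseteq> {..<d}" "fst ` set q \<subseteq> {..<d}" "fst ` set v \<subseteq> {..<d}" "fst ` set z \<subseteq> {..<d}" "s < d" "t < d"
    using w 1(1) 2(1) 3(1) 4(1) x' by (auto simp: z_def)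
  have zn: "fst ` set z \<inter> {s, t} = {}" using 1(2) 4(3) by (auto simp: z_def restr_Nil)
  have rot: "total d w = total d ((s, e) # p @ (t, f) # q @ (s, e') # v @ (t, f') # z)"
    using total_rotate[of u "x1 # w1" d] w 1(1) 2(1) 3(1) 4(1) x' by (simp add: z_def)
  show ?thesis
  proof (cases "f' = f")
    case False
    then have "f' = (\<not> f)" by auto
    then show ?thesis unfolding rot using main[OF sub(5,6) st(1) sub(1-4) 2(2) 3(2) 4(2) zn] by simp
  next
    case True
    then have e': "e' = (\<not> e)" using opp by auto
    have nin: "fst ` set q \<inter> {t, s} = {}" "fst ` set v \<inter> {t, s} = {}" "fst ` set z \<inter> {t, s} = {}" "fst ` set p \<inter> {t, s} = {}"
      using 2(2) 3(2) 4(2) zn by auto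
    have "total d w = total d ((t, f) # q @ (s, e') # v @ (t, f') # z @ (s, e) # p)"
      unfolding rot using total_rotate[of "(s, e) # p" "(t, f) # q @ (s, e') # v @ (t, f') # z" d] sub by (auto simp: image_Un)
    then show ?thesis
      using main[OF sub(6,5) st(1)[symmetric] sub(2,3,4,1) nin, of f "\<not> e" f'] e' by simp
  qed
qed

end

section \<open>Noncrossing pairings\<close>

definition opposite :: "word \<Rightarrow> bool" where
  "opposite v \<longleftrightarrow> (\<exists>j e. v = [(j, e), (j, \<not> e)])"

lemma occ_fst: "x \<in> set (occ w j) \<Longrightarrow> fst x = j"
  by (simp add: occ_def)

lemma occ_two:
  assumes "length (occ w j) = 2"
  obtains e f where "occ w j = [(j, e), (j, f)]"
proof -
  from assms obtain x y where xy: "occ w j = [x, y]" by (auto simp: numeral_2_eq_2 length_Suc_conv)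
  then have "fst x = j" "fst y = j" using occ_fst[of x w j] occ_fst[of y w j] by auto
  then show thesis using that[of "snd x" "snd y"] xy by (metis prod.collapse)
qed

lemma occ_opposite: "opposite (occ w j) \<longleftrightarrow> (\<exists>e. occ w j = [(j, e), (j, \<not> e)])"
proof
  assume "opposite (occ w j)"
  then obtain i e where o: "occ w j = [(i, e), (i, \<not> e)]" unfolding opposite_def by blast
  then have "i = j" using occ_fst[of "(i, e)" w j] by simp
  then show "\<exists>e. occ w j = [(j, e), (j, \<not> e)]" using o by blast
qed (auto simp: opposite_def)

lemma exwords_opposite_single: "card (exwords opposite 2 {j}) = 2"
proof -
  have "occ w j = w" if "set w \<subseteq> {j} \<times> UNIV" for w
    unfolding occ_def using that by (intro filter_True) auto
  then have "exwords opposite 2 {j} = (\<lambda>e. [(j, e), (j, \<not> e)]) ` UNIV"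
    by (auto simp: exwords_def words_def opposite_def image_iff)
  moreover have "inj (\<lambda>e. [(j, e), (j, \<not> e)])" by (auto simp: inj_def)
  ultimately show ?thesis by (simp add: card_image)
qed

text \<open>There are \<open>(2 i)! / 2 ^ i\<close> arrangements, with \<open>i = card I\<close>,
  and two opposite sign patterns for each letter.\<close>

lemma card_exwords_opposite: "finite I \<Longrightarrow> card (exwords opposite 2 I) = fact (2 * card I)"
  using card_exwords[OF _ exwords_opposite_single, of I] by simp

lemma card_exwords_2: "finite I \<Longrightarrow> card (exwords (\<lambda>_. True) 2 I) = fact (2 * card I) * 2 ^ card I"
proof -
  assume I: "finite I"
  have "(4::nat) ^ card I = 2 ^ card I * 2 ^ card I" by (simp add: power_mult_distrib[symmetric])
  then show ?thesis using card_exwords[OF I card_exwords_True, of 2] by simp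
qed

text \<open>
  \<open>q\<close> closes the letters on the stack \<open>st\<close> in last-in-first-out order, and opens and closes each
  letter of \<open>U\<close> once in the meantime.
\<close>

fun nested :: "nat set \<Rightarrow> word \<Rightarrow> word \<Rightarrow> bool" where
  "nested U st [] \<longleftrightarrow> U = {} \<and> st = []"
| "nested U st (x # q) \<longleftrightarrow> fst x \<in> U \<and> nested (U - {fst x}) (x # st) q
     \<or> st \<noteq> [] \<and> x = (fst (hd st), \<not> snd (hd st)) \<and> nested U (tl st) q"

text \<open>The ballot numbers, weighted by the labellings of the newly opened letters.\<close>

definition nested_bound :: "nat \<Rightarrow> nat \<Rightarrow> real" where
  "nested_bound u h = 2 ^ u * (real h + 1) * fact (2 * u + h) / fact (u + h + 1)"

lemma nested_bound_0: "nested_bound 0 h = 1"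
  by (simp add: nested_bound_def)

text \<open>The ballot recursion: the first symbol opens one of \<open>u + 1\<close> letters with
  one of two signs, or closes the top of a nonempty stack.\<close>

lemma nested_bound_Suc:
  "2 * (real u + 1) * nested_bound u (Suc h) + (if h = 0 then 0 else nested_bound (Suc u) (h - 1)) = nested_bound (Suc u) h"
proof -
  \<comment> \<open>After division by this common factor the recursion is
    \<open>(u + 1) (h + 2) + h (u + h + 2) = (h + 1) (2 u + h + 2)\<close>.\<close>
  define F :: real where "F = 2 ^ Suc u * fact (2 * u + h + 1) / fact (u + h + 2)"
  have 1: "2 * (real u + 1) * nested_bound u (Suc h) = F * ((u + 1) * (h + 2))"
    by (simp add: nested_bound_def F_def algebra_simps)
  have 2: "nested_bound (Suc u) h = F * ((h + 1) * (2 * u + h + 2))"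
    by (simp add: nested_bound_def F_def) (simp add: algebra_simps)
  have 3: "(if h = 0 then 0 else nested_bound (Suc u) (h - 1)) = F * (h * (u + h + 2))"
  proof (cases h)
    case (Suc h')
    have f: "fact (u + h + 2) = (real u + h + 2) * fact (u + h + 1)" by (simp add: algebra_simps)
    have nz: "real u + h + 2 \<noteq> 0" by linarith
    have e: "2 * Suc u + h' = 2 * u + h + 1" "Suc u + h' + 1 = u + h + 1" "real h' + 1 = real h" using Suc by auto
    have "nested_bound (Suc u) h' = 2 ^ Suc u * real h * fact (2 * u + h + 1) / fact (u + h + 1)"
      unfolding nested_bound_def e by (rule refl)
    also have "\<dots> = (2 ^ Suc u * real h * fact (2 * u + h + 1) * (real u + h + 2)) / ((real u + h + 2) * fact (u + h + 1))"
      using nz by (simp del: fact_Suc power_Suc)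
    also have "\<dots> = F * (real h * (real u + h + 2))" unfolding F_def f by (simp del: fact_Suc power_Suc)
    also have "\<dots> = F * real (h * (u + h + 2))" by (simp add: algebra_simps)
    finally show ?thesis using Suc by simp
  qed simp
  have "real ((u + 1) * (h + 2)) + real (h * (u + h + 2)) = real ((h + 1) * (2 * u + h + 2))"
    by (simp add: algebra_simps)
  then show ?thesis unfolding 1 2 3 distrib_left[symmetric] by simp
qed

text \<open>Induction on the length that \<open>q\<close> must have: opening a letter and closing
  one both lower \<open>2 * card U + length st\<close> by one. The sets \<open>A\<close>,
  \<open>B\<close>, \<open>C\<close> hold the words that are empty, begin with an opening, or begin
  with a closing.\<close>

lemma nested_count:
  assumes "finite U"
  shows "finite {q. nested U st q} \<and> real (card {q. nested U st q}) \<le> nested_bound (card U) (length st)"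
  using assms
proof (induction "2 * card U + length st" arbitrary: U st rule: less_induct)
  case less
  define S where "S = (\<lambda>U st. {q. nested U st q})"
  define A :: "word set" where "A = (if U = {} \<and> st = [] then {[]} else {})"
  define B where "B = (\<Union>x\<in>U \<times> UNIV. Cons x ` S (U - {fst x}) (x # st))"
  define C where "C = (if st = [] then {} else Cons (fst (hd st), \<not> snd (hd st)) ` S U (tl st))"
  let ?bB = "nested_bound (card U - 1) (Suc (length st))" and ?bC = "nested_bound (card U) (length st - 1)"
  have eq: "S U st = A \<union> B \<union> C"
  proof (intro Set.set_eqI)
    fix q show "q \<in> S U st \<longleftrightarrow> q \<in> A \<union> B \<union> C"
    proof (cases q)
      case Nil
      then show ?thesis by (simp add: S_def A_def B_def C_def image_iff)
    next
      case (Cons x r)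
      then have "q \<in> B \<longleftrightarrow> fst x \<in> U \<and> nested (U - {fst x}) (x # st) r"
        by (cases x) (auto simp: B_def S_def)
      moreover have "q \<in> C \<longleftrightarrow> st \<noteq> [] \<and> x = (fst (hd st), \<not> snd (hd st)) \<and> nested U (tl st) r"
        using Cons by (auto simp: C_def S_def)
      ultimately show ?thesis using Cons by (simp add: S_def A_def)
    qed
  qed
  have B: "finite (S (U - {fst x}) (x # st)) \<and> real (card (S (U - {fst x}) (x # st))) \<le> ?bB"
    if "x \<in> U \<times> UNIV" for x
  proof -
    have x: "fst x \<in> U" using that by auto
    have c: "card (U - {fst x}) = card U - 1" using x by (rule card_Diff_singleton)
    have "card U > 0" using x less.prems by (auto simp: card_gt_0_iff)
    then have "2 * card (U - {fst x}) + length (x # st) < 2 * card U + length st" using c by simp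
    from less.hyps[OF this] show ?thesis using less.prems c by (simp add: S_def)
  qed
  have C: "finite (S U (tl st)) \<and> real (card (S U (tl st))) \<le> ?bC" if "st \<noteq> []"
  proof -
    have "2 * card U + length (tl st) < 2 * card U + length st" using that by simp
    from less.hyps[OF this less.prems] show ?thesis by (simp add: S_def)
  qed
  have fU: "finite (U \<times> (UNIV :: bool set))" using less.prems by simp
  have "finite B" unfolding B_def using B fU by (intro finite_UN_I finite_imageI) blast+
  moreover have "finite C" unfolding C_def using C by (cases "st = []") simp_all
  moreover have "finite A" by (simp add: A_def)
  ultimately have fin: "finite (S U st)" unfolding eq by simp
  have "card B \<le> (\<Sum>x\<in>U \<times> UNIV. card (Cons x ` S (U - {fst x}) (x # st)))"
    unfolding B_def by (intro card_UN_le fU)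
  also have "\<dots> \<le> (\<Sum>x\<in>U \<times> UNIV. card (S (U - {fst x}) (x # st)))"
    using B by (intro sum_mono card_image_le) blast
  finally have "real (card B) \<le> (\<Sum>x\<in>U \<times> (UNIV :: bool set). real (card (S (U - {fst x}) (x # st))))"
    unfolding of_nat_sum[symmetric] of_nat_le_iff .
  also have "\<dots> \<le> (\<Sum>x\<in>U \<times> (UNIV :: bool set). ?bB)"
    using B by (intro sum_mono) blast
  also have "\<dots> = 2 * real (card U) * ?bB" by (simp add: card_cartesian_product)
  finally have cB: "real (card B) \<le> 2 * real (card U) * ?bB" .
  have cC: "real (card C) \<le> (if st = [] then 0 else ?bC)"
  proof (cases "st = []")
    case False
    then have "card C \<le> card (S U (tl st))" unfolding C_def if_not_P[OF False] using C by (intro card_image_le) blast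
    then show ?thesis using C[OF False] False by simp
  qed (simp add: C_def)
  have cA: "real (card A) = of_bool (U = {} \<and> st = [])" by (simp add: A_def)
  have "card (S U st) \<le> card A + card B + card C"
    unfolding eq by (meson add_le_mono1 card_Un_le le_trans)
  then have le: "real (card (S U st)) \<le> of_bool (U = {} \<and> st = []) + 2 * real (card U) * ?bB + (if st = [] then 0 else ?bC)"
    using cA cB cC by linarith
  have "of_bool (U = {} \<and> st = []) + 2 * real (card U) * ?bB + (if st = [] then 0 else ?bC) \<le> nested_bound (card U) (length st)"
  proof (cases "card U")
    case 0
    then have "U = {}" using less.prems by simp
    then show ?thesis by (simp add: nested_bound_0)
  next
    case (Suc u)
    then have "U \<noteq> {}" by auto
    then show ?thesis using nested_bound_Suc[of u "length st"] Suc by (cases st) (simp_all add: algebra_simps)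
  qed
  then show ?case using le fin unfolding S_def by linarith
qed

lemma restr_simps [simp]: "restr I [] = []" "restr I (u @ v) = restr I u @ restr I v"
  "restr I (x # v) = (if fst x \<in> I then x # restr I v else restr I v)"
  by (simp_all add: restr_def)

lemma occ_distinct_rev:
  assumes "distinct (map fst st)" "y \<in> set st"
  shows "occ (rev st) (fst y) = [y]"
  using assms
proof (induction st)
  case (Cons a st)
  show ?case
  proof (cases "y = a")
    case True
    then have "occ (rev st) (fst y) = []" using Cons.prems by (simp add: occ_eq_Nil)
    then show ?thesis using True by simp
  next
    case False
    then have "fst a \<noteq> fst y" "y \<in> set st" using Cons.prems by force+
    then show ?thesis using Cons by simp
  qed
qed simp

lemma restr_pair:
  assumes "occ q s = []"
  shows "restr {s, t} q = occ q t"
  using assms by (induction q) (auto split: if_splits)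

lemma restr_skip:
  assumes "j \<notin> I"
  shows "restr I (filter (\<lambda>x. fst x \<noteq> j) w) = restr I w"
  using assms by (induction w) auto

text \<open>The word is read from the left, with \<open>rev st\<close> as the memory of the letters
  still open. Closed pairs are deleted from it, which affects neither the other letters nor their
  crossings.\<close>

lemma nested_if_noncrossing:
  assumes "\<And>j. j \<in> U \<union> fst ` set st \<Longrightarrow> opposite (occ (rev st @ q) j)"
    and "fst ` set q \<subseteq> U \<union> fst ` set st" and "distinct (map fst st)" and "U \<inter> fst ` set st = {}"
    and "\<And>s t. s \<in> U \<union> fst ` set st \<Longrightarrow> t \<in> U \<union> fst ` set st \<Longrightarrow> \<not> cross s t (rev st @ q)"
  shows "nested U st q"
  using assms
proof (induction q arbitrary: U st)
  case Nil
  have len: "length (occ (rev st) j) = 2" if "j \<in> U \<union> fst ` set st" for j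
    using Nil(1)[OF that] by (auto simp: opposite_def)
  have "st = []"
  proof (rule ccontr)
    assume "st \<noteq> []"
    then have "hd st \<in> set st" by simp
    then show False using len[of "fst (hd st)"] occ_distinct_rev[OF Nil(3), of "hd st"] by auto
  qed
  moreover from this have "U = {}" using len by auto
  ultimately show ?case by simp
next
  case (Cons x q)
  show ?case
  proof (cases "fst x \<in> U")
    case True
    have "U - {fst x} \<union> fst ` set (x # st) = U \<union> fst ` set st" using True by auto
    then have "nested (U - {fst x}) (x # st) q"
      using Cons.prems True by (intro Cons.IH) auto
    then show ?thesis using True by simp
  next
    case False
    then have xst: "fst x \<in> fst ` set st" using Cons.prems(2) by auto
    then obtain y st' where st: "st = y # st'" by (cases st) auto
    have occy: "occ (rev st) (fst y) = [y]" using occ_distinct_rev[OF Cons.prems(3), of y] st by simp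
    have y': "fst y \<notin> fst ` set st'" using Cons.prems(3) st by simp
    have opp: "\<exists>e. occ (rev st @ x # q) j = [(j, e), (j, \<not> e)]" if "j \<in> U \<union> fst ` set st" for j
      using Cons.prems(1)[OF that] unfolding occ_opposite .
    \<comment> \<open>If a letter \<open>s\<close> below the top \<open>t\<close> were closed now,
      the second \<open>t\<close> would still be to come, and \<open>s t s t\<close> would be a
      crossing.\<close>
    have "fst x = fst y"
    proof (rule ccontr)
      assume ne: "fst x \<noteq> fst y"
      let ?s = "fst x" and ?t = "fst y"
      from xst ne st obtain x' where x': "x' \<in> set st'" "fst x' = ?s" by auto
      have dst': "distinct (map fst st')" using Cons.prems(3) st by simp
      have ost': "occ (rev st') ?s = [x']" using occ_distinct_rev[OF dst' x'(1)] x'(2) by simp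
      obtain e where "occ (rev st @ x # q) ?s = [(?s, e), (?s, \<not> e)]" using opp[of ?s] xst by blast
      then have oqs: "occ q ?s = []" using ost' st ne by simp
      obtain f where "occ (rev st @ x # q) ?t = [(?t, f), (?t, \<not> f)]" using opp[of ?t] st by auto
      then obtain z where oqt: "occ q ?t = [z]" "fst z = ?t" using occy ne by auto
      have "occ (rev st') ?t = []" using y' by (simp add: occ_eq_Nil)
      then have "restr {?t, ?s} (rev st') = [x']" using restr_pair[of "rev st'" ?t ?s] ost' by simp
      moreover have "restr {?s, ?t} q = [z]" using restr_pair[OF oqs, of ?t] oqt by simp
      ultimately have "cross ?s ?t (rev st @ x # q)"
        using st ne x'(2) oqt(2) by (simp add: cross_def insert_commute)
      moreover have "?s \<in> U \<union> fst ` set st" "?t \<in> U \<union> fst ` set st" using xst st by auto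
      ultimately show False using Cons.prems(5) by blast
    qed
    obtain e where e: "occ (rev st @ x # q) (fst y) = [(fst y, e), (fst y, \<not> e)]" using opp[of "fst y"] st by auto
    then have xy: "y = (fst y, e)" "x = (fst y, \<not> e)" and oq: "occ q (fst y) = []" using occy \<open>fst x = fst y\<close> by auto
    \<comment> \<open>The top \<open>y\<close> and its partner \<open>x\<close> are adjacent in
      \<open>rev st @ x # q\<close>; without them it is the word of the induction
      hypothesis.\<close>
    have fy: "filter (\<lambda>z. fst z \<noteq> fst y) (rev st @ x # q) = rev st' @ q"
    proof -
      have "fst z \<noteq> fst y" if "z \<in> set (rev st')" for z
      proof
        assume "fst z = fst y"
        moreover have "fst z \<in> fst ` set st'" using that by simp
        ultimately show False using y' by simp
      qed
      then have 1: "filter (\<lambda>z. fst z \<noteq> fst y) (rev st') = rev st'" by (intro filter_True ballI)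
      have "fst z \<noteq> fst y" if "z \<in> set q" for z
      proof
        assume "fst z = fst y"
        moreover have "fst z \<in> fst ` set q" using that by simp
        ultimately show False using oq[unfolded occ_eq_Nil] by simp
      qed
      then have 2: "filter (\<lambda>z. fst z \<noteq> fst y) q = q" by (intro filter_True ballI)
      have "rev st @ x # q = rev st' @ y # x # q" using st by simp
      then show ?thesis using 1 2 \<open>fst x = fst y\<close> by simp
    qed
    have yU: "fst y \<notin> U" using Cons.prems(4) st by auto
    have ne: "j \<noteq> fst y" if "j \<in> U \<union> fst ` set st'" for j using that yU y' by auto
    have sub: "U \<union> fst ` set st' \<subseteq> U \<union> fst ` set st" using st by auto
    have "nested U st' q"
    proof (rule Cons.IH)
      fix j assume j: "j \<in> U \<union> fst ` set st'"
      have eqo: "occ (rev st' @ q) j = occ (rev st @ x # q) j"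
        using ne[OF j] st \<open>fst x = fst y\<close> by auto
      show "opposite (occ (rev st' @ q) j)" unfolding eqo by (rule Cons.prems(1)) (use j sub in blast)
    next
      show "fst ` set q \<subseteq> U \<union> fst ` set st'"
      proof
        fix j assume j: "j \<in> fst ` set q"
        moreover note oq[unfolded occ_eq_Nil]
        ultimately have "j \<noteq> fst y" by blast
        moreover have "j \<in> fst ` set (x # q)" using j by simp
        then have "j \<in> U \<union> fst ` set st" by (rule subsetD[OF Cons.prems(2)])
        ultimately show "j \<in> U \<union> fst ` set st'" using st by simp
      qed
    next
      show "distinct (map fst st')" "U \<inter> fst ` set st' = {}" using Cons.prems(3,4) st by auto
    next
      fix s t assume *: "s \<in> U \<union> fst ` set st'" "t \<in> U \<union> fst ` set st'"
      have eqr: "restr {s, t} (rev st' @ q) = restr {s, t} (rev st @ x # q)"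
        unfolding fy[symmetric] using ne[OF *(1)] ne[OF *(2)] by (intro restr_skip) auto
      have "cross s t (rev st' @ q) = cross s t (rev st @ x # q)" unfolding cross_def eqr by (rule refl)
      moreover have "\<not> cross s t (rev st @ x # q)" by (rule Cons.prems(5)) (use * sub in blast)+
      ultimately show "\<not> cross s t (rev st' @ q)" by blast
    qed
    then show ?thesis using st xy by (metis fst_conv list.discI list.sel(1,3) nested.simps(2) snd_conv)
  qed
qed

text \<open>With \<open>i = card I\<close> this is the Catalan number
  \<open>(2 i)! / (i! (i + 1)!)\<close> times \<open>i!\<close> labellings and \<open>2 ^ i\<close>
  choices of signs; it is the ballot number for an empty stack.\<close>

lemma card_noncrossing:
  assumes "finite I"
  shows "real (card {q \<in> exwords opposite 2 I. \<forall>s\<in>I. \<forall>t\<in>I. \<not> cross s t q})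
    \<le> 2 ^ card I * fact (2 * card I) / fact (card I + 1)"
proof -
  have "{q \<in> exwords opposite 2 I. \<forall>s\<in>I. \<forall>t\<in>I. \<not> cross s t q} \<subseteq> {q. nested I [] q}"
    by (auto simp: exwords_def words_def intro!: nested_if_noncrossing)
  then have "card {q \<in> exwords opposite 2 I. \<forall>s\<in>I. \<forall>t\<in>I. \<not> cross s t q} \<le> card {q. nested I [] q}"
    using nested_count[OF assms, of "[]"] by (intro card_mono) auto
  then show ?thesis using nested_count[OF assms, of "[]"] by (simp add: nested_bound_def)
qed

text \<open>An involution that keeps the letters and their places, hence all crossings. On a letter
  that occurs twice it turns opposite signs into equal ones and back.\<close>

fun flip_first :: "nat \<Rightarrow> word \<Rightarrow> word" where
  "flip_first j [] = []"
| "flip_first j (x # w) = (if fst x = j then (j, \<not> snd x) # w else x # flip_first j w)"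

lemma map_fst_flip [simp]: "map fst (flip_first j w) = map fst w"
  by (induction w) auto

lemma flip_flip [simp]: "flip_first j (flip_first j w) = w"
  by (induction w) auto

lemma occ_flip: "occ (flip_first j w) i = (if i = j then flip_first j (occ w i) else occ w i)"
  by (induction w) auto

lemma restr_flip: "j \<in> I \<Longrightarrow> restr I (flip_first j w) = flip_first j (restr I w)"
  by (induction w) (auto simp: restr_def)

lemma erase_flip: "j \<in> I \<Longrightarrow> erase I (flip_first j w) = erase I w"
  by (induction w) (auto simp: erase_def)

lemma length_flip [simp]: "length (flip_first j w) = length w"
  by (induction w) auto

lemma fst_set_flip: "fst ` set (flip_first j w) = fst ` set w"
  unfolding set_map[symmetric] by simp

lemma cross_cong: "map fst w = map fst w' \<Longrightarrow> cross s t w = cross s t w'"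
proof -
  have "map fst (restr I w) = filter (\<lambda>j. j \<in> I) (map fst w)" for I and w :: word
    by (simp add: restr_def filter_map comp_def)
  then show "map fst w = map fst w' \<Longrightarrow> cross s t w = cross s t w'" by (simp add: cross_def)
qed

lemma cross_restr: "s \<in> I \<Longrightarrow> t \<in> I \<Longrightarrow> cross s t (restr I w) = cross s t w"
proof -
  assume "s \<in> I" "t \<in> I"
  then have "restr {s, t} (restr I w) = restr {s, t} w"
    by (auto simp: restr_def intro!: filter_cong)
  then show ?thesis by (simp add: cross_def)
qed

lemma mixed_mono: "A \<subseteq> A' \<Longrightarrow> mixed I A B \<subseteq> mixed I A' B" by (auto simp: mixed_def)

lemma words_iff: "w \<in> words D l \<longleftrightarrow> fst ` set w \<subseteq> D \<and> length w = l"
  by (auto simp: words_def)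

lemma flip_mixed:
  assumes "w \<in> mixed I (exwords opposite 2 I) R" "j \<in> I"
  shows "flip_first j w \<in> mixed I (exwords (\<lambda>_. True) 2 I) R"
proof -
  have "restr I w \<in> exwords opposite 2 I" using assms by (simp add: mixed_def)
  then have "restr I (flip_first j w) \<in> exwords (\<lambda>_. True) 2 I"
    unfolding restr_flip[OF assms(2)] by (simp add: exwords_def words_iff fst_set_flip occ_flip)
  then show ?thesis using assms by (simp add: mixed_def erase_flip)
qed

lemma occ_mixed:
  assumes "w \<in> mixed I (exwords Q p I) R" "j \<in> I"
  shows "length (occ w j) = p" "Q (occ w j)"
proof -
  have "occ (restr I w) j = occ w j" using assms(2) by (simp add: occ_restr)
  moreover have "restr I w \<in> exwords Q p I" using assms(1) by (simp add: mixed_def)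
  then have "\<forall>j\<in>I. length (occ (restr I w) j) = p \<and> Q (occ (restr I w) j)" by (simp add: exwords_def)
  from bspec[OF this assms(2)] have "length (occ (restr I w) j) = p \<and> Q (occ (restr I w) j)" .
  ultimately show "length (occ w j) = p" "Q (occ w j)" by simp_all
qed

section \<open>The sum of the means over the words with given twice-occurring letters\<close>

context vec_action begin

text \<open>
  Each crossing all-opposite word \<open>w \<in> X\<close> is compensated by the two words \<open>f1 w\<close>, \<open>f2 w\<close> in which
  one of two crossing letters occurs twice with the same sign.
\<close>

lemma pair_sum:
  assumes I: "I \<subseteq> {..<d}" and R: "R \<subseteq> words ({..<d} - I) b" and c: "c \<ge> 2"
    and bnd: "\<And>w. w \<in> mixed I (exwords (\<lambda>_. True) 2 I) R \<Longrightarrow> total d w \<le> c * T d"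
  defines "i \<equiv> card I"
  shows "(\<Sum>w\<in>mixed I (exwords (\<lambda>_. True) 2 I) R. total d w)
    \<le> T d * (real ((2 * i + b) choose (2 * i)) * fact (2 * i) * card R
         * (2 * (2 ^ i - 1) + 1 + c * 2 ^ i / fact (i + 1)))"
proof -
  define Om where "Om = mixed I (exwords (\<lambda>_. True) 2 I) R"
  define Opp where "Opp = mixed I (exwords opposite 2 I) R"
  define X where "X = {w \<in> Opp. \<exists>s\<in>I. \<exists>t\<in>I. cross s t w}"
  define NX where "NX = mixed I {q \<in> exwords opposite 2 I. \<forall>s\<in>I. \<forall>t\<in>I. \<not> cross s t q} R"
  have fI: "finite I" using I finite_subset by blast
  have Oms: "Opp \<subseteq> Om" unfolding Opp_def Om_def by (rule mixed_mono) (auto simp: exwords_def)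
  have wOm: "w \<in> words {..<d} (2 * i + b)" if "w \<in> Om" for w
  proof (rule words_mixed[OF _ I])
    have "restr I w \<in> words I (2 * i)" "erase I w \<in> words ({..<d} - I) b"
      using that R exwords_subset[of "\<lambda>_. True" 2 I] unfolding Om_def mixed_def i_def by blast+
    then show "w \<in> mixed I (words I (2 * i)) (words ({..<d} - I) b)" by (simp add: mixed_def)
  qed
  then have finOm: "finite Om" using finite_subset[OF subsetI finite_words[of "{..<d}" "2 * i + b"]] by blast
  have "w \<in> NX \<longleftrightarrow> w \<in> Opp \<and> (\<forall>s\<in>I. \<forall>t\<in>I. \<not> cross s t w)" for w
    unfolding NX_def Opp_def mixed_def mem_Collect_eq using cross_restr[of _ I _ w] by blast
  then have OppX: "Opp = X \<union> NX" "X \<inter> NX = {}" unfolding X_def by blast+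
  have w': "fst ` set w \<subseteq> {..<d}" if "w \<in> Om" for w by (rule set_words[OF wOm[OF that]])

  \<comment> \<open>The pair is chosen from the letters alone, as \<open>pick_cong\<close> records.
    It can therefore be recovered after a sign change, which makes \<open>f1\<close> and
    \<open>f2\<close> injective.\<close>
  define pick where "pick = (\<lambda>w. SOME p. fst p \<in> I \<and> snd p \<in> I \<and> cross (fst p) (snd p) w)"
  have pick_cong: "pick w = pick v" if "map fst w = map fst v" for w v
    unfolding pick_def cross_cong[OF that] by (rule refl)
  have pick: "fst (pick w) \<in> I \<and> snd (pick w) \<in> I \<and> cross (fst (pick w)) (snd (pick w)) w" if "w \<in> X" for w
  proof -
    from that obtain s t where "s \<in> I" "t \<in> I" "cross s t w" unfolding X_def by blast
    then have "\<exists>p. fst p \<in> I \<and> snd p \<in> I \<and> cross (fst p) (snd p) w" by (intro exI[of _ "(s, t)"]) simp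
    from someI_ex[OF this] show ?thesis unfolding pick_def .
  qed
  define f1 where "f1 = (\<lambda>w. flip_first (fst (pick w)) w)"
  define f2 where "f2 = (\<lambda>w. flip_first (snd (pick w)) w)"
  let ?s = "\<lambda>w. fst (pick w)" and ?t = "\<lambda>w. snd (pick w)"
  have pf: "pick (f1 w) = pick w" "pick (f2 w) = pick w" for w
    by (rule pick_cong; simp add: f1_def f2_def)+
  have inj1: "inj_on f1 X"
  proof (rule inj_on_inverseI)
    fix w show "flip_first (fst (pick (f1 w))) (f1 w) = w" unfolding pf by (simp add: f1_def)
  qed
  have inj2: "inj_on f2 X"
  proof (rule inj_on_inverseI)
    fix w show "flip_first (snd (pick (f2 w))) (f2 w) = w" unfolding pf by (simp add: f2_def)
  qed
  have XOpp: "w \<in> Opp" if "w \<in> X" for w using that by (simp add: X_def)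
  have f1Om: "f1 w \<in> Om" and f2Om: "f2 w \<in> Om" if "w \<in> X" for w
    using flip_mixed[OF XOpp[OF that, unfolded Opp_def]] pick[OF that] by (simp_all add: f1_def f2_def Om_def)
  have opp: "\<exists>e. occ w j = [(j, e), (j, \<not> e)]" if "w \<in> Opp" "j \<in> I" for w j
    using occ_mixed(2)[of w I opposite 2 R j] that by (simp add: Opp_def occ_opposite)
  have occ1: "\<exists>e f. occ (f1 w) (?s w) = [(?s w, e), (?s w, e)] \<and> occ (f1 w) (?t w) = [(?t w, f), (?t w, \<not> f)]"
    and occ2: "\<exists>e f. occ (f2 w) (?s w) = [(?s w, f), (?s w, \<not> f)] \<and> occ (f2 w) (?t w) = [(?t w, e), (?t w, e)]"
    if w: "w \<in> X" for w
  proof -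
    obtain e where e: "occ w (?s w) = [(?s w, e), (?s w, \<not> e)]" using opp[OF XOpp[OF w]] pick[OF w] by blast
    obtain f where f: "occ w (?t w) = [(?t w, f), (?t w, \<not> f)]" using opp[OF XOpp[OF w]] pick[OF w] by blast
    have ne: "?s w \<noteq> ?t w" using pick[OF w] by (simp add: cross_def)
    show "\<exists>e f. occ (f1 w) (?s w) = [(?s w, e), (?s w, e)] \<and> occ (f1 w) (?t w) = [(?t w, f), (?t w, \<not> f)]"
      unfolding f1_def occ_flip using e f ne by simp
    show "\<exists>e f. occ (f2 w) (?s w) = [(?s w, f), (?s w, \<not> f)] \<and> occ (f2 w) (?t w) = [(?t w, e), (?t w, e)]"
      unfolding f2_def occ_flip using e f ne by simp
  qed
  have crossf: "cross (?s w) (?t w) (f1 w)" "cross (?s w) (?t w) (f2 w)" if w: "w \<in> X" for w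
    using pick[OF w] cross_cong[of "f1 w" w] cross_cong[of "f2 w" w] by (simp_all add: f1_def f2_def)
  have nOpp1: "f1 w \<notin> Opp" if w: "w \<in> X" for w
  proof
    assume "f1 w \<in> Opp"
    then obtain e where "occ (f1 w) (?s w) = [(?s w, e), (?s w, \<not> e)]" using opp pick[OF w] by blast
    moreover obtain e' where "occ (f1 w) (?s w) = [(?s w, e'), (?s w, e')]" using occ1[OF w] by blast
    ultimately show False by auto
  qed
  have nOpp2: "f2 w \<notin> Opp" if w: "w \<in> X" for w
  proof
    assume "f2 w \<in> Opp"
    then obtain e where "occ (f2 w) (?t w) = [(?t w, e), (?t w, \<not> e)]" using opp pick[OF w] by blast
    moreover obtain e' where "occ (f2 w) (?t w) = [(?t w, e'), (?t w, e')]" using occ2[OF w] by blast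
    ultimately show False by auto
  qed
  \<comment> \<open>A common value would come with the same pair, whose first letter has equal signs
    after \<open>f1\<close> and opposite signs after \<open>f2\<close>.\<close>
  have dis: "f1 ` X \<inter> f2 ` X = {}"
  proof (intro equals0I)
    fix z assume "z \<in> f1 ` X \<inter> f2 ` X"
    then obtain w v where wv: "w \<in> X" "v \<in> X" "z = f1 w" "z = f2 v" by auto
    then have p: "pick w = pick v" using pf by metis
    obtain e where "occ z (?s w) = [(?s w, e), (?s w, e)]" using occ1[OF wv(1)] wv(3) by blast
    moreover obtain f where "occ z (?s w) = [(?s w, f), (?s w, \<not> f)]"
      using occ2[OF wv(2)] wv(4) unfolding p by blast
    ultimately show False by auto
  qed
  let ?u = "(1 + 2 / n) * T d"
  have bX: "total d w \<le> ?u" if w: "w \<in> X" for w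
  proof -
    obtain e where e: "occ w (?s w) = [(?s w, e), (?s w, \<not> e)]" using opp[OF XOpp[OF w]] pick[OF w] by blast
    obtain f where f: "occ w (?t w) = [(?t w, f), (?t w, \<not> f)]" using opp[OF XOpp[OF w]] pick[OF w] by blast
    show ?thesis using w' Oms XOpp[OF w] pick[OF w] by (intro total_cross[OF _ _ e f]) auto
  qed
  have b1: "total d (f1 w) \<le> ?u" if w: "w \<in> X" for w
  proof -
    obtain e f where "occ (f1 w) (?s w) = [(?s w, e), (?s w, e)]"
      "occ (f1 w) (?t w) = [(?t w, f), (?t w, \<not> f)]" using occ1[OF w] by blast
    from total_cross[OF w'[OF f1Om[OF w]] crossf(1)[OF w] this] show ?thesis by simp
  qed
  have b2: "total d (f2 w) \<le> ?u" if w: "w \<in> X" for w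
  proof -
    obtain e f where "occ (f2 w) (?s w) = [(?s w, f), (?s w, \<not> f)]"
      "occ (f2 w) (?t w) = [(?t w, e), (?t w, e)]" using occ2[OF w] by blast
    from total_cross[OF w'[OF f2Om[OF w]] crossf(2)[OF w] this] show ?thesis by simp
  qed
  \<comment> \<open>Outside \<open>Opp\<close> some letter of \<open>I\<close> occurs twice with the
    same sign, so \<open>total_same\<close> applies.\<close>
  have brest: "total d w \<le> 2 * T d" if w: "w \<in> Om" "w \<notin> Opp" for w
  proof -
    obtain j where j: "j \<in> I" "\<not> opposite (occ w j)"
    proof -
      have "restr I w \<notin> exwords opposite 2 I" using w by (auto simp: Om_def Opp_def mixed_def)
      then have "\<exists>j\<in>I. \<not> opposite (occ w j)" using w(1) by (auto simp: Om_def mixed_def exwords_def occ_restr)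
      then show thesis using that by blast
    qed
    obtain e f where ef: "occ w j = [(j, e), (j, f)]"
      using occ_two occ_mixed(1)[of w I _ 2 R j] w(1) j(1) unfolding Om_def by blast
    then have "e = f" using j(2) by (auto simp: opposite_def)
    then show ?thesis using total_same[OF w'[OF w(1)], of j e] ef by simp
  qed
  define Y where "Y = X \<union> f1 ` X \<union> f2 ` X"
  have fin: "finite X" "finite NX" "finite Y"
    using finOm finite_subset[OF Oms finOm] OppX by (auto simp: Y_def)
  have sub: "Y \<subseteq> Om" "NX \<subseteq> Om" using f1Om f2Om Oms OppX XOpp by (auto simp: Y_def)
  have YNX: "NX \<inter> Y = {}" using OppX nOpp1 nOpp2 by (auto simp: Y_def)
  have "card (X \<union> f1 ` X) = card X + card (f1 ` X)"
    using fin nOpp1 XOpp by (intro card_Un_disjoint) auto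
  moreover have "card Y = card (X \<union> f1 ` X) + card (f2 ` X)"
    unfolding Y_def using fin nOpp2 XOpp dis by (intro card_Un_disjoint) auto
  ultimately have cY: "card Y = 3 * card X" using card_image[OF inj1] card_image[OF inj2] by simp
  have rest: "Om = (NX \<union> Y) \<union> (Om - (NX \<union> Y))" using sub by auto
  have cOm: "card Om = card NX + card Y + card (Om - (NX \<union> Y))"
    using rest fin finOm YNX by (metis Diff_disjoint card_Un_disjoint finite_Diff finite_UnI)
  have "(\<Sum>w\<in>Om. total d w) = (\<Sum>w\<in>NX \<union> Y. total d w) + (\<Sum>w\<in>Om - (NX \<union> Y). total d w)"
    using sum.subset_diff[of "NX \<union> Y" Om "total d"] sub finOm by (simp add: add.commute)
  also have "(\<Sum>w\<in>NX \<union> Y. total d w) = (\<Sum>w\<in>NX. total d w) + (\<Sum>w\<in>Y. total d w)"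
    using fin YNX by (intro sum.union_disjoint) auto
  also have "(\<Sum>w\<in>NX. total d w) \<le> real (card NX) * (c * T d)"
    using sub(2) bnd by (intro sum_bounded_above) (auto simp: Om_def)
  also have "(\<Sum>w\<in>Y. total d w) \<le> real (card Y) * ?u"
    using bX b1 b2 by (intro sum_bounded_above) (auto simp: Y_def)
  also have "(\<Sum>w\<in>Om - (NX \<union> Y). total d w) \<le> real (card (Om - (NX \<union> Y))) * (2 * T d)"
    using brest OppX(1) by (intro sum_bounded_above) (auto simp: Y_def)
  finally have s1: "(\<Sum>w\<in>Om. total d w) \<le> real (card NX) * (c * T d) + real (card Y) * ?u + real (card (Om - (NX \<union> Y))) * (2 * T d)"
    by linarith
  \<comment> \<open>This is where \<open>n \<ge> 3\<close> decides: a crossing word and its two sign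
    changes together need no more than their charges.\<close>
  have "3 * (1 + 2 / n) \<le> 5" using n_ge by (simp add: field_simps)
  then have "real (card X) * (3 * (1 + 2 / n)) \<le> real (card X) * 5" by (intro mult_left_mono) auto
  moreover have "real (card Y) * (1 + 2 / n) = real (card X) * (3 * (1 + 2 / n))" by (simp add: cY)
  ultimately have y: "real (card Y) * (1 + 2 / n) \<le> 5 * real (card X)" by linarith
  have cOpp: "card Opp = card X + card NX" unfolding OppX(1) using fin OppX(2) by (intro card_Un_disjoint) auto
  have "real (card NX) * c + real (card Y) * (1 + 2 / n) + real (card (Om - (NX \<union> Y))) * 2
     \<le> real (card NX) * c + 5 * real (card X) + (real (card Om) - real (card NX) - 3 * real (card X)) * 2"
    using y cOm cY by simp
  \<comment> \<open>Every word is charged 2, an opposite one 1 less, and a noncrossing one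
    additionally \<open>c\<close>. A noncrossing word thus carries \<open>1 + c\<close>, one more
    than its mean requires; this slack gives the bound its simple shape.\<close>
  also have "\<dots> \<le> 2 * real (card Om) - real (card Opp) + real (card NX) * c" using cOpp by simp
  finally have s2: "real (card NX) * c + real (card Y) * (1 + 2 / n) + real (card (Om - (NX \<union> Y))) * 2 \<le> 2 * real (card Om) - real (card Opp) + real (card NX) * c" .
  have "real (card NX) * (c * T d) + real (card Y) * ?u + real (card (Om - (NX \<union> Y))) * (2 * T d)
     = T d * (real (card NX) * c + real (card Y) * (1 + 2 / n) + real (card (Om - (NX \<union> Y))) * 2)"
    by (simp only: distrib_left mult_ac)
  also have "\<dots> \<le> T d * (2 * real (card Om) - real (card Opp) + real (card NX) * c)"
    by (rule mult_left_mono[OF s2]) simp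
  finally have s3: "(\<Sum>w\<in>Om. total d w) \<le> T d * (2 * real (card Om) - real (card Opp) + real (card NX) * c)" using s1 by linarith
  let ?C = "real ((2 * i + b) choose (2 * i))"
  have cm: "real (card (mixed I A R)) = ?C * card A * real (card R)" if "A \<subseteq> words I (2 * i)" for A
    using card_mixed[OF that R _ fI] by simp
  have 1: "real (card Om) = ?C * (fact (2 * i) * 2 ^ i) * real (card R)"
    unfolding Om_def using cm[of "exwords (\<lambda>_. True) 2 I"] card_exwords_2[OF fI] exwords_subset[of "\<lambda>_. True" 2 I] by (simp add: i_def)
  have 2: "real (card Opp) = ?C * fact (2 * i) * real (card R)"
    unfolding Opp_def using cm[of "exwords opposite 2 I"] card_exwords_opposite[OF fI] exwords_subset[of opposite 2 I] by (simp add: i_def)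
  have 3: "real (card NX) \<le> ?C * (2 ^ i * fact (2 * i) / fact (i + 1)) * real (card R)"
  proof -
    have "real (card NX) = ?C * card {q \<in> exwords opposite 2 I. \<forall>s\<in>I. \<forall>t\<in>I. \<not> cross s t q} * real (card R)"
      unfolding NX_def using exwords_subset[of opposite 2 I] by (intro cm) (auto simp: i_def)
    also have "\<dots> \<le> ?C * (2 ^ i * fact (2 * i) / fact (i + 1)) * real (card R)"
      unfolding i_def by (intro mult_right_mono mult_left_mono card_noncrossing fI) auto
    finally show ?thesis .
  qed
  have "real (card NX) * c \<le> ?C * (2 ^ i * fact (2 * i) / fact (i + 1)) * real (card R) * c"
    using 3 c by (intro mult_right_mono) auto
  then have "2 * real (card Om) - real (card Opp) + real (card NX) * c
    \<le> 2 * (?C * (fact (2 * i) * 2 ^ i) * real (card R)) - ?C * fact (2 * i) * real (card R) + ?C * (2 ^ i * fact (2 * i) / fact (i + 1)) * real (card R) * c"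
    unfolding 1 2 by linarith
  also have "\<dots> = ?C * fact (2 * i) * real (card R) * (2 * (2 ^ i - 1) + 1 + c * 2 ^ i / fact (i + 1))"
    by (simp del: fact_Suc add: algebra_simps)
  finally have "T d * (2 * real (card Om) - real (card Opp) + real (card NX) * c) \<le> T d * (?C * fact (2 * i) * real (card R) * (2 * (2 ^ i - 1) + 1 + c * 2 ^ i / fact (i + 1)))"
    by (rule mult_left_mono) simp
  then show ?thesis using s3 unfolding Om_def by linarith
qed

end

section \<open>The general linear group over the field of two elements\<close>

definition nzv :: "nat \<Rightarrow> bit vec set" where
  "nzv k = carrier_vec k - {0\<^sub>v k}"

definition subspace2 :: "nat \<Rightarrow> bit vec set \<Rightarrow> bool" where
  "subspace2 k H \<longleftrightarrow> H \<subseteq> carrier_vec k \<and> 0\<^sub>v k \<in> H \<and> (\<forall>u\<in>H. \<forall>v\<in>H. u + v \<in> H)"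

text \<open>Existence of a separating linear functional with coefficient vector \<open>c\<close>. It
  is obtained from the zero space by adjoining one vector at a time.\<close>

definition separated :: "nat \<Rightarrow> bit vec set \<Rightarrow> bool" where
  "separated k H \<longleftrightarrow> (\<forall>v\<in>carrier_vec k - H. \<exists>c\<in>carrier_vec k. (\<forall>h\<in>H. scalar_prod c h = 0) \<and> scalar_prod c v = 1)"

lemma bit_add_self [simp]: "(b::bit) + b = 0" by (cases b) auto

lemma bit_cases: "(b::bit) \<in> {0, 1}"
  using bit.exhaust by auto

lemma vec_add_self: "(v::bit vec) \<in> carrier_vec k \<Longrightarrow> v + v = 0\<^sub>v k"
  by (intro eq_vecI) auto

lemma vec_add_cancel:
  assumes "(u::bit vec) \<in> carrier_vec k" "v \<in> carrier_vec k"
  shows "u + (u + v) = v"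
proof -
  have "u + (u + v) = (u + u) + v" using assms by simp
  then show ?thesis using assms vec_add_self[of u k] by simp
qed

lemma subspace2_zero: "subspace2 k {0\<^sub>v k}"
  by (auto simp: subspace2_def)

text \<open>Over two elements, adjoining \<open>h\<close> adds just the coset \<open>h + H\<close>,
  so the spans of one and of two vectors are explicit finite sets.\<close>

lemma subspace2_extend:
  assumes H: "subspace2 k H" and h: "h \<in> carrier_vec k"
  shows "subspace2 k (H \<union> (+) h ` H)"
proof -
  have c: "u \<in> carrier_vec k" if "u \<in> H" for u using H that by (auto simp: subspace2_def)
  have a: "u + v \<in> H" if "u \<in> H" "v \<in> H" for u v using H that by (auto simp: subspace2_def)
  have 1: "u + (h + v) = h + (u + v)" "h + u + v = h + (u + v)" "(h + u) + (h + v) = u + v"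
    if "u \<in> H" "v \<in> H" for u v
  proof -
    note uv = c[OF that(1)] c[OF that(2)]
    show 2: "h + u + v = h + (u + v)" using assoc_add_vec[OF h uv] .
    have "u + (h + v) = (u + h) + v" using assoc_add_vec[OF uv(1) h uv(2)] by simp
    then show 3: "u + (h + v) = h + (u + v)" unfolding comm_add_vec[OF uv(1) h] 2 .
    have "(h + u) + (h + v) = h + (u + (h + v))" using assoc_add_vec[OF h uv(1)] h uv by simp
    then show "(h + u) + (h + v) = u + v" unfolding 3 using vec_add_cancel[OF h] uv by simp
  qed
  show ?thesis
    unfolding subspace2_def
  proof (intro conjI ballI)
    show "H \<union> (+) h ` H \<subseteq> carrier_vec k" using c h by auto
    show "0\<^sub>v k \<in> H \<union> (+) h ` H" using H by (auto simp: subspace2_def)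
    fix u v assume "u \<in> H \<union> (+) h ` H" "v \<in> H \<union> (+) h ` H"
    then show "u + v \<in> H \<union> (+) h ` H" by (auto simp: 1 a)
  qed
qed

lemma separated_zero: "separated k {0\<^sub>v k}"
  unfolding separated_def
proof
  fix v :: "bit vec" assume v: "v \<in> carrier_vec k - {0\<^sub>v k}"
  have "\<exists>i<k. v $ i \<noteq> 0"
  proof (rule ccontr)
    assume "\<not> (\<exists>i<k. v $ i \<noteq> 0)"
    then have "v = 0\<^sub>v k" using v by (intro eq_vecI) auto
    with v show False by simp
  qed
  then obtain i where i: "i < k" "v $ i \<noteq> 0" by blast
  then have "scalar_prod (unit_vec k i) v = 1"
    using v by (cases "v $ i") auto
  then show "\<exists>c\<in>carrier_vec k. (\<forall>h\<in>{0\<^sub>v k}. scalar_prod c h = 0) \<and> scalar_prod c v = 1"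
    by (intro bexI[of _ "unit_vec k i"]) auto
qed

text \<open>If \<open>c1\<close> vanishes on \<open>H\<close> and is 1 at \<open>h\<close>, then
  \<open>v' = v + (c1 v) h\<close> is the projection of \<open>v\<close> along \<open>h\<close>,
  still outside \<open>H\<close>. A functional \<open>c2\<close> that separates \<open>v'\<close>
  from \<open>H\<close>, composed with this projection, is \<open>c\<close>; it vanishes on
  \<open>H\<close> and at \<open>h\<close>.\<close>

lemma separated_extend:
  assumes H: "subspace2 k H" and sep: "separated k H" and h: "h \<in> carrier_vec k"
  shows "separated k (H \<union> (+) h ` H)"
proof (cases "h \<in> H")
  case True
  then have "H \<union> (+) h ` H = H" using H by (auto simp: subspace2_def)
  then show ?thesis using sep by simp
next
  case False
  have Hc: "u \<in> carrier_vec k" if "u \<in> H" for u using H that by (auto simp: subspace2_def)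
  obtain c1 where c1: "c1 \<in> carrier_vec k" "\<And>u. u \<in> H \<Longrightarrow> scalar_prod c1 u = 0" "scalar_prod c1 h = 1"
    using sep False h unfolding separated_def by blast
  show ?thesis
    unfolding separated_def
  proof
    fix v assume v: "v \<in> carrier_vec k - (H \<union> (+) h ` H)"
    define v' where "v' = v + scalar_prod c1 v \<cdot>\<^sub>v h"
    have "v' \<in> carrier_vec k - H"
    proof (cases "scalar_prod c1 v = 0")
      case True
      then have "v' = v" using v h by (auto simp: v'_def intro!: eq_vecI)
      then show ?thesis using v by simp
    next
      case F: False
      then have "scalar_prod c1 v = 1" by (cases "scalar_prod c1 v") auto
      then have v': "v' = h + v" using v h by (auto simp: v'_def intro!: eq_vecI)
      have "v = h + v'" unfolding v' using v h vec_add_cancel[of h k v] by simp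
      then show ?thesis using v v' h by auto
    qed
    then obtain c2 where c2: "c2 \<in> carrier_vec k" "\<And>u. u \<in> H \<Longrightarrow> scalar_prod c2 u = 0" "scalar_prod c2 v' = 1"
      using sep unfolding separated_def by blast
    define c where "c = c2 + scalar_prod c2 h \<cdot>\<^sub>v c1"
    have sc: "scalar_prod c u = scalar_prod c2 u + scalar_prod c2 h * scalar_prod c1 u" if "u \<in> carrier_vec k" for u
      unfolding c_def using c1(1) c2(1) that h by (simp add: add_scalar_prod_distrib[of _ k])
    have "scalar_prod c u = 0" if "u \<in> H" for u using sc[OF Hc[OF that]] c1(2) c2(2) that by simp
    moreover have "scalar_prod c h = 0" using sc[OF h] c1(3) by simp
    moreover have "scalar_prod c (h + u) = scalar_prod c h + scalar_prod c u" if "u \<in> H" for u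
      using Hc[OF that] h c1(1) c2(1) by (intro scalar_prod_add_distrib[of _ k]) (auto simp: c_def)
    moreover have "scalar_prod c v = 1"
    proof -
      have "scalar_prod c2 v' = scalar_prod c2 v + scalar_prod c1 v * scalar_prod c2 h"
        unfolding v'_def using c2(1) v h by (simp add: scalar_prod_add_distrib[of _ k])
      moreover have "scalar_prod c v = scalar_prod c2 v + scalar_prod c1 v * scalar_prod c2 h"
        using sc[of v] v by (simp only: mult.commute DiffD1)
      ultimately show ?thesis using c2(3) by simp
    qed
    ultimately show "\<exists>c\<in>carrier_vec k. (\<forall>u\<in>H \<union> (+) h ` H. scalar_prod c u = 0) \<and> scalar_prod c v = 1"
      using c1(1) c2(1) by (intro bexI[of _ c]) (auto simp: c_def)
  qed
qed

lemma finite_bit_vecs: "finite (carrier_vec k :: bit vec set)"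
  and card_bit_vecs: "card (carrier_vec k :: bit vec set) = 2 ^ k"
proof -
  have U: "(UNIV :: bit set) = {0, 1}" by (rule UNIV_eq_I) (rule bit_cases)
  let ?L = "{xs :: bit list. set xs \<subseteq> UNIV \<and> length xs = k}"
  have bij: "bij_betw vec_of_list ?L (carrier_vec k)"
  proof (rule bij_betw_byWitness[where f' = list_of_vec])
    show "vec_of_list ` ?L \<subseteq> carrier_vec k"
      by (intro image_subsetI carrier_vecI) simp
    show "list_of_vec ` carrier_vec k \<subseteq> ?L"
      by (intro image_subsetI) simp
  qed (simp_all add: vec_list list_vec)
  have fin: "finite ?L" by (rule finite_lists_length_eq) (unfold U, simp)
  have "card ?L = 2 ^ k" by (subst card_lists_length_eq) (unfold U, simp_all add: numeral_2_eq_2)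
  with bij_betw_same_card[OF bij] show "card (carrier_vec k :: bit vec set) = 2 ^ k" by simp
  show "finite (carrier_vec k :: bit vec set)" using bij_betw_finite[OF bij] fin by simp
qed

lemma nzv_finite: "finite (nzv k)"
  unfolding nzv_def using finite_bit_vecs by (rule finite_Diff)

lemma card_nzv: "card (nzv k) = 2 ^ k - 1"
  unfolding nzv_def by (subst card_Diff_subset) (simp_all add: card_bit_vecs)

text \<open>\<open>invertible_mat\<close> does not state the dimensions of the inverse; they are
  read off from the two products.\<close>

lemma GL2_iff: "A \<in> GL2 k \<longleftrightarrow> A \<in> carrier_mat k k \<and> (\<exists>B\<in>carrier_mat k k. A * B = 1\<^sub>m k \<and> B * A = 1\<^sub>m k)"
proof
  assume A: "A \<in> GL2 k"
  then have Ac: "A \<in> carrier_mat k k" and "invertible_mat A" by (auto simp: GL2_def)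
  then obtain B where B: "A * B = 1\<^sub>m (dim_row A)" "B * A = 1\<^sub>m (dim_row B)"
    by (auto simp: invertible_mat_def inverts_mat_def)
  have "dim_col B = k" using arg_cong[OF B(1), of dim_col] Ac by simp
  moreover have "dim_row B = k" using arg_cong[OF B(2), of dim_col] Ac by simp
  ultimately show "A \<in> carrier_mat k k \<and> (\<exists>B\<in>carrier_mat k k. A * B = 1\<^sub>m k \<and> B * A = 1\<^sub>m k)"
    using B Ac by (intro conjI bexI[of _ B]) auto
next
  assume "A \<in> carrier_mat k k \<and> (\<exists>B\<in>carrier_mat k k. A * B = 1\<^sub>m k \<and> B * A = 1\<^sub>m k)"
  then show "A \<in> GL2 k" by (auto simp: GL2_def invertible_mat_def inverts_mat_def)
qed

lemma GL2_mult: assumes "A \<in> GL2 k" "B \<in> GL2 k" shows "A * B \<in> GL2 k"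
proof -
  from assms obtain A' B' where A: "A \<in> carrier_mat k k" "A' \<in> carrier_mat k k" "A * A' = 1\<^sub>m k" "A' * A = 1\<^sub>m k"
    and B: "B \<in> carrier_mat k k" "B' \<in> carrier_mat k k" "B * B' = 1\<^sub>m k" "B' * B = 1\<^sub>m k"
    unfolding GL2_iff by blast
  have "A * B * (B' * A') = A * (B * B') * A'" "B' * A' * (A * B) = B' * (A' * A) * B"
    using A(1,2) B(1,2) by (simp_all add: assoc_mult_mat[of _ k k _ k _ k])
  then have "A * B * (B' * A') = 1\<^sub>m k" "B' * A' * (A * B) = 1\<^sub>m k"
    using A B by simp_all
  then show ?thesis unfolding GL2_iff using A B by (intro conjI bexI[of _ "B' * A'"]) auto
qed

lemma GL2_finite: "finite (GL2 k)"
proof -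
  have "carrier_mat k k \<subseteq> (\<lambda>f. mat k k (\<lambda>(i, j). f (i, j) :: bit)) ` ({..<k} \<times> {..<k} \<rightarrow>\<^sub>E {0, 1})"
  proof
    fix A :: "bit mat" assume A: "A \<in> carrier_mat k k"
    let ?f = "restrict (\<lambda>ij. A $$ ij) ({..<k} \<times> {..<k})"
    have "A = mat k k (\<lambda>(i, j). ?f (i, j))" using A by (intro eq_matI) auto
    moreover have "?f \<in> {..<k} \<times> {..<k} \<rightarrow>\<^sub>E {0, 1}" using bit_cases by (intro restrict_PiE_iff[THEN iffD2] ballI)
    ultimately show "A \<in> (\<lambda>f. mat k k (\<lambda>(i, j). f (i, j))) ` ({..<k} \<times> {..<k} \<rightarrow>\<^sub>E {0, 1})" by blast
  qed
  then have "finite (carrier_mat k k :: bit mat set)"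
    by (rule finite_subset) (intro finite_imageI finite_PiE; simp)
  then show ?thesis by (rule rev_finite_subset) (auto simp: GL2_def)
qed

lemma GL2_one: "1\<^sub>m k \<in> GL2 k"
  unfolding GL2_iff by (intro conjI bexI[of _ "1\<^sub>m k"]) auto

lemma GL2_cancel:
  assumes "A \<in> GL2 k" "u \<in> carrier_vec k" "v \<in> carrier_vec k" "A *\<^sub>v u = A *\<^sub>v v"
  shows "u = v"
proof -
  from assms(1) obtain B where B: "B \<in> carrier_mat k k" "B * A = 1\<^sub>m k" "A \<in> carrier_mat k k"
    unfolding GL2_iff by blast
  have "B *\<^sub>v (A *\<^sub>v w) = w" if "w \<in> carrier_vec k" for w
    using that B by (subst assoc_mult_mat_vec[symmetric, of _ k k _ k]) auto
  then show ?thesis using assms(2-4) by metis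
qed

lemma GL2_bij: assumes A: "A \<in> GL2 k" shows "bij_betw ((*\<^sub>v) A) (nzv k) (nzv k)"
proof -
  have c: "A \<in> carrier_mat k k" using A by (simp add: GL2_def)
  have "A *\<^sub>v v \<noteq> 0\<^sub>v k" if v: "v \<in> carrier_vec k" "v \<noteq> 0\<^sub>v k" for v
  proof
    assume "A *\<^sub>v v = 0\<^sub>v k"
    also have "0\<^sub>v k = A *\<^sub>v 0\<^sub>v k" using c by (intro eq_vecI) auto
    finally show False using GL2_cancel[OF A v(1) zero_carrier_vec] v(2) by blast
  qed
  then have "(*\<^sub>v) A ` nzv k \<subseteq> nzv k" using c by (auto simp: nzv_def)
  moreover have "inj_on ((*\<^sub>v) A) (nzv k)"
    using GL2_cancel[OF A] unfolding inj_on_def nzv_def by blast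
  ultimately show ?thesis using nzv_finite endo_inj_surj unfolding bij_betw_def by blast
qed

section \<open>Transvections and transitivity outside a subspace\<close>

definition transvection :: "nat \<Rightarrow> bit vec \<Rightarrow> bit vec \<Rightarrow> bit mat" where
  "transvection k a c = mat k k (\<lambda>(i, j). (if i = j then 1 else 0) + a $ i * c $ j)"

lemma transvection_mult:
  assumes "a \<in> carrier_vec k" "c \<in> carrier_vec k" "v \<in> carrier_vec k"
  shows "transvection k a c *\<^sub>v v = v + scalar_prod c v \<cdot>\<^sub>v a"
proof (rule eq_vecI)
  fix i assume "i < dim_vec (v + scalar_prod c v \<cdot>\<^sub>v a)"
  then have i: "i < k" using assms by simp
  have "(transvection k a c *\<^sub>v v) $ i = (\<Sum>j<k. ((if i = j then 1 else 0) + a $ i * c $ j) * v $ j)"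
    using i assms by (auto simp add: transvection_def scalar_prod_def lessThan_atLeast0 simp del: bit_eq_iff intro!: sum.cong)
  also have "\<dots> = (\<Sum>j<k. (if i = j then v $ j else 0) + a $ i * (c $ j * v $ j))"
    by (intro sum.cong refl) (simp only: distrib_right mult.assoc if_distrib[where f = "\<lambda>x. x * _"] mult_1_left mult_zero_left)
  also have "\<dots> = v $ i + a $ i * scalar_prod c v"
    using i assms unfolding sum.distrib scalar_prod_def sum_distrib_left[symmetric]
    by (simp only: carrier_vecD[OF assms(3)] lessThan_atLeast0 sum.delta finite_atLeastLessThan if_True atLeastLessThan_iff) simp
  finally show "(transvection k a c *\<^sub>v v) $ i = (v + scalar_prod c v \<cdot>\<^sub>v a) $ i"
    using i assms by (simp only: index_add_vec index_smult_vec carrier_vecD mult.commute)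
qed (use assms in \<open>simp add: transvection_def\<close>)

text \<open>As \<open>c\<close> vanishes at \<open>a\<close>, it takes the same value at
  \<open>v\<close> and at the image of \<open>v\<close>. Applying the map twice adds
  \<open>a\<close> twice or not at all, so in characteristic 2 it is an involution.\<close>

lemma transvection_GL2:
  assumes a: "a \<in> carrier_vec k" and c: "c \<in> carrier_vec k" and ca: "scalar_prod c a = 0"
  shows "transvection k a c \<in> GL2 k"
proof -
  let ?T = "transvection k a c"
  have T: "?T \<in> carrier_mat k k" by (simp add: transvection_def)
  have tt: "?T *\<^sub>v (?T *\<^sub>v v) = v" if v: "v \<in> carrier_vec k" for v
  proof -
    have "scalar_prod c (v + scalar_prod c v \<cdot>\<^sub>v a) = scalar_prod c v"
      using a c v ca by (simp add: scalar_prod_add_distrib[of _ k])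
    then have "?T *\<^sub>v (?T *\<^sub>v v) = (v + scalar_prod c v \<cdot>\<^sub>v a) + scalar_prod c v \<cdot>\<^sub>v a"
      using transvection_mult[OF a c] v a by simp
    also have "\<dots> = v" using v a by (intro eq_vecI) (auto simp: add.assoc)
    finally show ?thesis .
  qed
  have "?T * ?T = 1\<^sub>m k"
  proof (rule mat_col_eqI)
    fix j assume "j < dim_col (1\<^sub>m k :: bit mat)"
    then have j: "j < k" by simp
    have "col (?T * ?T) j = ?T *\<^sub>v (?T *\<^sub>v unit_vec k j)"
    proof -
      have "col ?T j = ?T *\<^sub>v unit_vec k j"
        using T j by (intro eq_vecI) (auto simp: scalar_prod_right_unit[of _ k])
      then show ?thesis unfolding col_mult2[OF T T j] by (rule arg_cong)
    qed
    then show "col (?T * ?T) j = col (1\<^sub>m k) j" using tt[of "unit_vec k j"] j by simp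
  qed (use T in auto)
  then show ?thesis unfolding GL2_iff using T by auto
qed

text \<open>The transvection along \<open>a = w + w'\<close> sends \<open>w\<close> to
  \<open>w'\<close> and fixes \<open>H\<close> if its functional vanishes on \<open>H\<close> and at
  \<open>a\<close> and is 1 at \<open>w\<close>. Such a functional exists, because \<open>w\<close>
  in the coset \<open>a + H\<close> would force \<open>w'\<close> into \<open>H\<close>.\<close>

lemma transitive_off_subspace:
  assumes H: "subspace2 k H" and sep: "\<And>h. h \<in> carrier_vec k \<Longrightarrow> separated k (H \<union> (+) h ` H)"
    and w: "w \<in> carrier_vec k - H" and w': "w' \<in> carrier_vec k - H"
  obtains B where "B \<in> GL2 k" "\<And>h. h \<in> H \<Longrightarrow> B *\<^sub>v h = h" "B *\<^sub>v w = w'"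
proof -
  define a where "a = w + w'"
  have a: "a \<in> carrier_vec k" using w w' by (auto simp: a_def)
  let ?H = "H \<union> (+) a ` H"
  have Hc: "u \<in> carrier_vec k" if "u \<in> H" for u using H that by (auto simp: subspace2_def)
  have "w \<notin> ?H"
  proof
    assume "w \<in> ?H"
    then obtain h where h: "h \<in> H" "w = a + h" using w by auto
    have "w' = w + a" using vec_add_cancel[of w k w'] w w' by (simp add: a_def)
    also have "\<dots> = a + (a + h)" using h(2) a Hc[OF h(1)] by (simp add: comm_add_vec[of _ k])
    also have "\<dots> = h" using vec_add_cancel a Hc[OF h(1)] by blast
    finally show False using h w' by simp
  qed
  then obtain c where c: "c \<in> carrier_vec k" "\<And>u. u \<in> ?H \<Longrightarrow> scalar_prod c u = 0" "scalar_prod c w = 1"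
    using sep[OF a] w unfolding separated_def by blast
  have "a + 0\<^sub>v k \<in> ?H" using H by (auto simp: subspace2_def)
  then have ca: "scalar_prod c a = 0" using c(2) a by simp
  let ?B = "transvection k a c"
  show thesis
  proof (rule that[of ?B])
    show "?B \<in> GL2 k" using transvection_GL2 a c(1) ca by blast
    show "?B *\<^sub>v h = h" if "h \<in> H" for h
      using transvection_mult[OF a c(1) Hc[OF that]] c(2)[of h] that a Hc[OF that]
      by (auto intro!: eq_vecI)
    have "?B *\<^sub>v w = w + a" using transvection_mult[OF a c(1), of w] c(3) w a by simp
    then show "?B *\<^sub>v w = w'" using vec_add_cancel[of w k w'] w w' by (simp add: a_def)
  qed
qed

text \<open>Left multiplication by matrices that fix \<open>H\<close> pointwise carries the fibres
  over points outside \<open>H\<close> into each other, so these fibres have equal size. They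
  exhaust \<open>K\<close> if \<open>u\<close> is never sent into \<open>H\<close>.\<close>

lemma card_fibre:
  assumes H: "subspace2 k H" and sep: "\<And>h. h \<in> carrier_vec k \<Longrightarrow> separated k (H \<union> (+) h ` H)"
    and K: "K \<subseteq> GL2 k" and KB: "\<And>A B. A \<in> K \<Longrightarrow> B \<in> GL2 k \<Longrightarrow> (\<And>h. h \<in> H \<Longrightarrow> B *\<^sub>v h = h) \<Longrightarrow> B * A \<in> K"
    and u: "u \<in> carrier_vec k" and w: "w \<in> carrier_vec k - H"
  shows "card {A \<in> K. A *\<^sub>v u = w} * card (carrier_vec k - H) \<le> card K"
    and "(\<And>A. A \<in> K \<Longrightarrow> A *\<^sub>v u \<notin> H) \<Longrightarrow> card {A \<in> K. A *\<^sub>v u = w} * card (carrier_vec k - H) = card K"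
proof -
  have finK: "finite K" using K GL2_finite finite_subset by blast
  have le: "card {A \<in> K. A *\<^sub>v u = w1} \<le> card {A \<in> K. A *\<^sub>v u = w2}"
    if w1: "w1 \<in> carrier_vec k - H" and w2: "w2 \<in> carrier_vec k - H" for w1 w2
  proof -
    obtain B where B: "B \<in> GL2 k" "\<And>h. h \<in> H \<Longrightarrow> B *\<^sub>v h = h" "B *\<^sub>v w1 = w2"
      using transitive_off_subspace[OF H sep w1 w2] by blast
    from B(1) obtain B' where B': "B \<in> carrier_mat k k" "B' \<in> carrier_mat k k" "B' * B = 1\<^sub>m k"
      unfolding GL2_iff by blast
    have Kc: "A \<in> carrier_mat k k" if "A \<in> K" for A using that K by (auto simp: GL2_def)
    have "B' * (B * A) = A" if "A \<in> K" for A
      using Kc[OF that] B' by (subst assoc_mult_mat[symmetric, of _ k k _ k _ k]) auto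
    then have "inj_on ((*) B) {A \<in> K. A *\<^sub>v u = w1}" by (intro inj_on_inverseI[where g = "(*) B'"]) auto
    moreover have "(*) B ` {A \<in> K. A *\<^sub>v u = w1} \<subseteq> {A \<in> K. A *\<^sub>v u = w2}"
    proof (intro image_subsetI)
      fix A assume A: "A \<in> {A \<in> K. A *\<^sub>v u = w1}"
      have "B * A *\<^sub>v u = B *\<^sub>v (A *\<^sub>v u)" using B'(1) Kc A u by (intro assoc_mult_mat_vec[of _ k k _ k]) auto
      then show "B * A \<in> {A \<in> K. A *\<^sub>v u = w2}" using KB[of A B] B A by simp
    qed
    ultimately show ?thesis using finK by (intro card_inj_on_le[of "(*) B"]) auto
  qed
  let ?U = "\<Union>w'\<in>carrier_vec k - H. {A \<in> K. A *\<^sub>v u = w'}"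
  have "card ?U = (\<Sum>w'\<in>carrier_vec k - H. card {A \<in> K. A *\<^sub>v u = w'})"
    using finK finite_bit_vecs by (intro card_UN_disjoint) auto
  also have "\<dots> = (\<Sum>w'\<in>carrier_vec k - H. card {A \<in> K. A *\<^sub>v u = w})"
    using le w by (intro sum.cong refl order_antisym) auto
  finally have eq: "card {A \<in> K. A *\<^sub>v u = w} * card (carrier_vec k - H) = card ?U" by simp
  show "card {A \<in> K. A *\<^sub>v u = w} * card (carrier_vec k - H) \<le> card K"
    unfolding eq by (intro card_mono finK) auto
  assume *: "\<And>A. A \<in> K \<Longrightarrow> A *\<^sub>v u \<notin> H"
  have "?U = K" using * K u by (auto simp: GL2_def)
  then show "card {A \<in> K. A *\<^sub>v u = w} * card (carrier_vec k - H) = card K" using eq by simp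
qed

lemma le_divide_mult: "c * b \<le> a / x \<Longrightarrow> 0 < b \<Longrightarrow> c \<le> a / (x * b)" for a b c x :: real
  by (simp only: divide_divide_eq_left[symmetric] pos_le_divide_eq)

text \<open>Images are prescribed one at a time: \<open>card_fibre\<close> is applied with
  \<open>H\<close> the span of the images prescribed so far, of 1, 2 and 4 elements. The complements
  have \<open>n\<close>, \<open>n - 1\<close> and \<open>n - 3\<close> elements, as the whole space
  has \<open>n + 1\<close>.\<close>

lemma GL2_action:
  assumes "k \<ge> 2"
  shows "vec_action (nzv k) (GL2 k) (*\<^sub>v) (+)"
proof -
  let ?n = "real (card (nzv k))" and ?N = "real (card (GL2 k))"
  have "(2::nat) ^ 2 \<le> 2 ^ k" using assms by (intro power_increasing) auto
  then have n3: "3 \<le> card (nzv k)" by (simp add: card_nzv)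
  have cn: "card (carrier_vec k :: bit vec set) = card (nzv k) + 1" by (simp add: card_nzv card_bit_vecs)
  note sub0 = subspace2_zero[of k] and sep0 = separated_zero[of k]
  have H1: "{0\<^sub>v k} \<union> (+) w ` {0\<^sub>v k} = {0\<^sub>v k, w}" if "w \<in> nzv k" for w
    using that by (auto simp: nzv_def)
  have sub1: "subspace2 k {0\<^sub>v k, w}" and sep1: "separated k {0\<^sub>v k, w}" if "w \<in> nzv k" for w
    using subspace2_extend[OF sub0, of w] separated_extend[OF sub0 sep0, of w] that
    unfolding H1[OF that] by (simp_all add: nzv_def)
  have H2: "{0\<^sub>v k, w} \<union> (+) w' ` {0\<^sub>v k, w} = {0\<^sub>v k, w, w', w + w'}" if "w \<in> nzv k" "w' \<in> nzv k" for w w'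
    using that comm_add_vec[of w k w'] by (auto simp: nzv_def)
  have sub2: "subspace2 k {0\<^sub>v k, w, w', w + w'}" and sep2: "separated k {0\<^sub>v k, w, w', w + w'}"
    if "w \<in> nzv k" "w' \<in> nzv k" for w w'
    using subspace2_extend[OF sub1[OF that(1)], of w'] separated_extend[OF sub1[OF that(1)] sep1[OF that(1)], of w'] that(2)
    unfolding H2[OF that] by (simp_all add: nzv_def)
  have mv: "(B * A) *\<^sub>v u = B *\<^sub>v (A *\<^sub>v u)" if "A \<in> GL2 k" "B \<in> GL2 k" "u \<in> nzv k" for A B u
    using that by (intro assoc_mult_mat_vec[of _ k k _ k]) (auto simp: GL2_def nzv_def)
  have n0: "A *\<^sub>v u \<notin> {0\<^sub>v k}" if "A \<in> GL2 k" "u \<in> nzv k" for A u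
    using GL2_bij[OF that(1)] that(2) by (auto simp: bij_betw_def nzv_def)
  have act1: "real (card {g \<in> GL2 k. g *\<^sub>v u = w}) = ?N / ?n" if "u \<in> nzv k" "w \<in> nzv k" for u w
  proof -
    have "card {g \<in> GL2 k. g *\<^sub>v u = w} * card (nzv k) = card (GL2 k)"
      using that GL2_mult n0 unfolding nzv_def
      by (intro card_fibre(2)[OF sub0 separated_extend[OF sub0 sep0]]) auto
    then have "real (card {g \<in> GL2 k. g *\<^sub>v u = w}) * ?n = ?N" by (simp only: of_nat_mult[symmetric])
    then show ?thesis using n3 by (simp add: field_simps)
  qed
  have act2: "real (card {g \<in> GL2 k. g *\<^sub>v u = w \<and> g *\<^sub>v u' = w'}) \<le> ?N / (?n * (?n - 1))"
    if "u \<in> nzv k" "u' \<in> nzv k - {u}" "w \<in> nzv k" "w' \<in> nzv k - {w}" for u u' w w'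
  proof -
    have "card (carrier_vec k - {0\<^sub>v k, w}) = card (nzv k) - 1"
      using that(3) cn by (subst card_Diff_subset) (auto simp: nzv_def)
    moreover have "card {g \<in> {g \<in> GL2 k. g *\<^sub>v u = w}. g *\<^sub>v u' = w'} * card (carrier_vec k - {0\<^sub>v k, w})
       \<le> card {g \<in> GL2 k. g *\<^sub>v u = w}"
    proof (rule card_fibre(1)[OF sub1[OF that(3)] separated_extend[OF sub1[OF that(3)] sep1[OF that(3)]]])
      fix A B assume "A \<in> {g \<in> GL2 k. g *\<^sub>v u = w}" "B \<in> GL2 k" "\<And>h. h \<in> {0\<^sub>v k, w} \<Longrightarrow> B *\<^sub>v h = h"
      then show "B * A \<in> {g \<in> GL2 k. g *\<^sub>v u = w}" using mv[of A B u] GL2_mult[of B k A] that(1) by simp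
    next
      show "u' \<in> carrier_vec k" "w' \<in> carrier_vec k - {0\<^sub>v k, w}" using that by (simp_all add: nzv_def)
    qed auto
    ultimately have "real (card {g \<in> {g \<in> GL2 k. g *\<^sub>v u = w}. g *\<^sub>v u' = w'}) * real (card (nzv k) - 1) \<le> ?N / ?n"
      unfolding act1[OF that(1,3), symmetric] of_nat_mult[symmetric] of_nat_le_iff by simp
    moreover have "real (card (nzv k) - 1) = ?n - 1" using n3 by (simp add: of_nat_diff)
    moreover have "{g \<in> {g \<in> GL2 k. g *\<^sub>v u = w}. g *\<^sub>v u' = w'} = {g \<in> GL2 k. g *\<^sub>v u = w \<and> g *\<^sub>v u' = w'}" by auto
    ultimately show ?thesis using n3 by (intro le_divide_mult) simp_all
  qed
  have act3: "real (card {g \<in> GL2 k. g *\<^sub>v u = w \<and> g *\<^sub>v u' = w' \<and> g *\<^sub>v u'' = w''}) \<le> ?N / (?n * (?n - 1) * (?n - 3))"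
    if "u \<in> nzv k" "u' \<in> nzv k - {u}" "u'' \<in> nzv k - {u, u', u + u'}"
       "w \<in> nzv k" "w' \<in> nzv k - {w}" "w'' \<in> nzv k - {w, w', w + w'}" for u u' u'' w w' w''
  proof -
    have sum3: "a + b \<noteq> 0\<^sub>v k \<and> a + b \<noteq> a \<and> a + b \<noteq> b \<and> a + b \<in> carrier_vec k"
      if "a \<in> nzv k" "b \<in> nzv k - {a}" for a b
    proof -
      have c: "a \<in> carrier_vec k" "b \<in> carrier_vec k" "a \<noteq> 0\<^sub>v k" "b \<noteq> 0\<^sub>v k" "b \<noteq> a"
        using that by (auto simp: nzv_def)
      show ?thesis
        using vec_add_cancel[OF c(1,2)] vec_add_cancel[OF c(2,1)] comm_add_vec[OF c(1,2)] c vec_add_self[OF c(1)] vec_add_self[OF c(2)]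
        by auto
    qed
    have wc: "w \<in> carrier_vec k" "w' \<in> carrier_vec k" "w \<noteq> 0\<^sub>v k" "w' \<noteq> 0\<^sub>v k" "w' \<noteq> w"
      using that by (auto simp: nzv_def)
    have s: "w + w' \<noteq> 0\<^sub>v k" "w + w' \<noteq> w" "w + w' \<noteq> w'" "w + w' \<in> carrier_vec k"
      using sum3[of w w'] that(4,5) by blast+
    have "card {0\<^sub>v k, w, w', w + w'} = 4" using wc(3-5) s(1-3) s(1-3)[symmetric] by simp
    moreover have "card (carrier_vec k - {0\<^sub>v k, w, w', w + w'}) = card (carrier_vec k :: bit vec set) - card {0\<^sub>v k, w, w', w + w'}"
      using wc s by (intro card_Diff_subset) auto
    ultimately have c: "card (carrier_vec k - {0\<^sub>v k, w, w', w + w'}) = card (nzv k) - 3"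
      unfolding cn by simp
    let ?K = "{g \<in> GL2 k. g *\<^sub>v u = w \<and> g *\<^sub>v u' = w'}"
    have W: "w \<in> nzv k" "w' \<in> nzv k" using that by auto
    have W'': "w'' \<in> carrier_vec k - {0\<^sub>v k, w, w', w + w'}" using that by (auto simp: nzv_def)
    have "card {g \<in> ?K. g *\<^sub>v u'' = w''} * card (carrier_vec k - {0\<^sub>v k, w, w', w + w'}) \<le> card ?K"
    proof (rule card_fibre(1)[OF sub2[OF W] separated_extend[OF sub2[OF W] sep2[OF W]]])
      fix A B assume "A \<in> ?K" "B \<in> GL2 k" "\<And>h. h \<in> {0\<^sub>v k, w, w', w + w'} \<Longrightarrow> B *\<^sub>v h = h"
      then show "B * A \<in> ?K" using mv[of A B u] mv[of A B u'] GL2_mult[of B k A] that(1,2) by simp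
    next
      show "u'' \<in> carrier_vec k" "w'' \<in> carrier_vec k - {0\<^sub>v k, w, w', w + w'}"
        using that(3) W'' by (simp_all add: nzv_def)
    qed auto
    then have "real (card {g \<in> ?K. g *\<^sub>v u'' = w''}) * real (card (nzv k) - 3) \<le> real (card ?K)"
      unfolding c of_nat_mult[symmetric] of_nat_le_iff .
    also have "\<dots> \<le> ?N / (?n * (?n - 1))" by (rule act2) (use that in auto)
    finally have le: "real (card {g \<in> ?K. g *\<^sub>v u'' = w''}) * (?n - 3) \<le> ?N / (?n * (?n - 1))"
      using n3 by (simp add: of_nat_diff)
    \<comment> \<open>The vector \<open>u''\<close> lies outside the plane of \<open>u\<close> and
      \<open>u'\<close>, hence \<open>n > 3\<close> and the division is legitimate.\<close>
    have "card {u, u', u + u'} < card (nzv k)"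
    proof (rule psubset_card_mono[OF nzv_finite])
      have "u + u' \<in> nzv k" using sum3[of u u'] that by (simp add: nzv_def)
      then show "{u, u', u + u'} \<subset> nzv k" using that by auto
    qed
    moreover have "card {u, u', u + u'} = 3"
      using that sum3[of u u'] by (auto simp: card_insert_if)
    ultimately have "?n - 3 > 0" by simp
    moreover have "{g \<in> ?K. g *\<^sub>v u'' = w''} = {g \<in> GL2 k. g *\<^sub>v u = w \<and> g *\<^sub>v u' = w' \<and> g *\<^sub>v u'' = w''}" by auto
    ultimately show ?thesis using le_divide_mult[OF le] by simp
  qed
  show ?thesis
  proof
    show "u + v \<in> nzv k" if uv: "u \<in> nzv k" "v \<in> nzv k" "u \<noteq> v" for u v
    proof -
      have c: "u \<in> carrier_vec k" "v \<in> carrier_vec k" using uv by (auto simp: nzv_def)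
      have "u + v \<noteq> 0\<^sub>v k" using vec_add_cancel[OF c] c uv(3) by auto
      then show ?thesis using c by (simp add: nzv_def)
    qed
    show "u + u \<notin> nzv k" if "u \<in> nzv k" for u
      using that vec_add_self[of u k] by (simp add: nzv_def)
    show "u + (u + v) = v" if "u \<in> nzv k" "v \<in> nzv k" for u v
      using vec_add_cancel[of u k v] that by (simp add: nzv_def)
    show "u + v = v + u" if "u \<in> nzv k" "v \<in> nzv k" for u v
      using comm_add_vec[of u k v] that by (simp add: nzv_def)
    show "g *\<^sub>v (u + v) = g *\<^sub>v u + g *\<^sub>v v" if "g \<in> GL2 k" "u \<in> nzv k" "v \<in> nzv k" for g u v
      using that by (intro mult_add_distrib_mat_vec[of _ k k]) (auto simp: GL2_def nzv_def)
    show "GL2 k \<noteq> {}" using GL2_one by blast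
  qed (use n3 nzv_finite GL2_finite GL2_bij act1 act2 act3 in \<open>assumption | simp\<close>)+
qed

section \<open>Traces and eigenvalues\<close>

definition mtrace :: "'a :: comm_monoid_add mat \<Rightarrow> 'a" where
  "mtrace A = (\<Sum>i<dim_row A. A $$ (i, i))"

lemma mtrace_comm:
  fixes A B :: "'a :: comm_semiring_0 mat"
  assumes "A \<in> carrier_mat n n" "B \<in> carrier_mat n n"
  shows "mtrace (A * B) = mtrace (B * A)"
proof -
  have "mtrace (A * B) = (\<Sum>i<n. \<Sum>j<n. A $$ (i, j) * B $$ (j, i))"
    using assms by (auto simp: mtrace_def scalar_prod_def lessThan_atLeast0 intro!: sum.cong)
  also have "\<dots> = (\<Sum>j<n. \<Sum>i<n. B $$ (j, i) * A $$ (i, j))"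
    by (subst sum.swap) (simp only: mult.commute)
  also have "\<dots> = mtrace (B * A)"
    using assms by (auto simp: mtrace_def scalar_prod_def lessThan_atLeast0 intro!: sum.cong)
  finally show ?thesis .
qed

lemma upper_triangular_pow:
  fixes B :: "'a :: comm_semiring_1 mat"
  assumes B: "B \<in> carrier_mat n n" "upper_triangular B"
  shows "upper_triangular (B ^\<^sub>m k) \<and> (\<forall>i<n. (B ^\<^sub>m k) $$ (i, i) = (B $$ (i, i)) ^ k)"
proof (induction k)
  case 0
  then show ?case using B(1) by auto
next
  case (Suc k)
  have Bk: "B ^\<^sub>m k \<in> carrier_mat n n" using B(1) by simp
  have entry: "(B ^\<^sub>m Suc k) $$ (i, j) = (\<Sum>l<n. (B ^\<^sub>m k) $$ (i, l) * B $$ (l, j))" if "i < n" "j < n" for i j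
    using that B(1) Bk by (simp add: scalar_prod_def lessThan_atLeast0)
  have z: "(B ^\<^sub>m k) $$ (i, l) = 0" if "l < i" "i < n" for i l
    using Suc Bk that by auto
  have zB: "B $$ (i, l) = 0" if "l < i" "i < n" for i l
    using B that by auto
  have "(B ^\<^sub>m Suc k) $$ (i, j) = 0" if "j < i" "i < n" for i j
    using that z zB unfolding entry[OF that(2) less_trans[OF that]]
    by (intro sum.neutral ballI) (metis lessThan_iff less_le_trans mult_zero_left mult_zero_right not_le)
  moreover have "(B ^\<^sub>m Suc k) $$ (i, i) = (B $$ (i, i)) ^ Suc k" if "i < n" for i
  proof -
    have "(B ^\<^sub>m Suc k) $$ (i, i) = (\<Sum>l\<in>{i}. (B ^\<^sub>m k) $$ (i, l) * B $$ (l, i))"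
      unfolding entry[OF that that]
    proof (rule sum.mono_neutral_right)
      show "\<forall>l\<in>{..<n} - {i}. (B ^\<^sub>m k) $$ (i, l) * B $$ (l, i) = 0"
        using z[of _ i] zB[of i] that by (metis DiffE insertCI lessThan_iff linorder_neqE_nat mult_zero_left mult_zero_right)
    qed (use that in auto)
    then show ?thesis using Suc that by (simp add: mult.commute)
  qed
  ultimately show ?case using B(1) by auto
qed

text \<open>Schur triangularization: cyclicity of the trace removes the similarity, and the diagonal
  of a power of a triangular matrix consists of the powers of its diagonal.\<close>

lemma mtrace_pow_eigenvalues:
  fixes A :: "complex mat"
  assumes A: "A \<in> carrier_mat n n" and c: "char_poly A = (\<Prod>e\<leftarrow>es. [:- e, 1:])"
  shows "mtrace (A ^\<^sub>m k) = (\<Sum>e\<leftarrow>es. e ^ k)"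
proof -
  obtain B P Q where "schur_decomposition A es = (B, P, Q)" by (metis prod_cases3)
  from schur_decomposition[OF A c this] have wit: "similar_mat_wit A B P Q" and ut: "upper_triangular B"
    and diag: "diag_mat B = es" by auto
  note c = similar_mat_witD2[OF A wit]
  have Bk: "B ^\<^sub>m k \<in> carrier_mat n n" using c by simp
  have "mtrace (A ^\<^sub>m k) = mtrace (P * (B ^\<^sub>m k * Q))"
    unfolding similar_mat_wit_pow_id[OF wit] using c Bk by (simp only: assoc_mult_mat[OF c(6) Bk c(7)])
  also have "\<dots> = mtrace ((B ^\<^sub>m k * Q) * P)" using c Bk by (intro mtrace_comm) auto
  also have "(B ^\<^sub>m k * Q) * P = B ^\<^sub>m k" using c Bk by (simp add: assoc_mult_mat[of _ n n _ n _ n])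
  also have "mtrace (B ^\<^sub>m k) = (\<Sum>i<n. (B $$ (i, i)) ^ k)"
    using upper_triangular_pow[OF c(5) ut, of k] carrier_matD(1)[OF Bk] unfolding mtrace_def by simp
  also have "\<dots> = (\<Sum>e\<leftarrow>es. e ^ k)"
    unfolding diag[symmetric] diag_mat_def using c(5)
    by (simp add: comp_def lessThan_atLeast0 sum_list_sum_nth) 
  finally show ?thesis .
qed

text \<open>The Hermitian form \<open>S\<close> at an eigenvector is \<open>e\<close> times its
  squared norm \<open>R\<close> and, by symmetry, its own conjugate. Reality links
  \<open>abs_mu2\<close>, which sorts moduli, to the trace, which sums powers of
  eigenvalues.\<close>

lemma symmetric_eigenvalue_real:
  fixes M :: "real mat"
  assumes M: "M \<in> carrier_mat n n" and sym: "\<And>i j. i < n \<Longrightarrow> j < n \<Longrightarrow> M $$ (i, j) = M $$ (j, i)"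
    and ev: "eigenvalue (map_mat complex_of_real M) e"
  shows "e \<in> \<real>"
proof -
  let ?A = "map_mat complex_of_real M"
  obtain v where v: "v \<in> carrier_vec n" "v \<noteq> 0\<^sub>v n" "?A *\<^sub>v v = e \<cdot>\<^sub>v v"
    using ev M by (auto simp: eigenvalue_def eigenvector_def)
  define S where "S = (\<Sum>i<n. \<Sum>j<n. cnj (v $ i) * of_real (M $$ (i, j)) * v $ j)"
  define R where "R = (\<Sum>i<n. (cmod (v $ i))\<^sup>2)"
  have Av: "(\<Sum>j<n. of_real (M $$ (i, j)) * v $ j) = e * v $ i" if "i < n" for i
  proof -
    have "(?A *\<^sub>v v) $ i = e * v $ i" using v that by simp
    then show ?thesis using that M v(1) by (simp add: scalar_prod_def lessThan_atLeast0)
  qed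
  have "S = (\<Sum>i<n. cnj (v $ i) * (\<Sum>j<n. of_real (M $$ (i, j)) * v $ j))"
    by (simp add: S_def sum_distrib_left mult.assoc)
  also have "\<dots> = (\<Sum>i<n. e * of_real ((cmod (v $ i))\<^sup>2))"
    using Av by (intro sum.cong refl) (simp add: complex_norm_square mult_ac del: of_real_power)
  also have "\<dots> = e * of_real R" by (simp add: R_def sum_distrib_left)
  finally have SR: "S = e * of_real R" .
  have "cnj S = (\<Sum>i<n. \<Sum>j<n. v $ i * of_real (M $$ (i, j)) * cnj (v $ j))" by (simp add: S_def)
  also have "\<dots> = (\<Sum>j<n. \<Sum>i<n. v $ i * of_real (M $$ (i, j)) * cnj (v $ j))" by (rule sum.swap)
  also have "\<dots> = S" unfolding S_def using sym by (intro sum.cong refl) (simp add: mult_ac)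
  finally have "S \<in> \<real>" by (simp add: Reals_cnj_iff)
  moreover have "R > 0"
  proof -
    have "\<exists>i<n. v $ i \<noteq> 0"
    proof (rule ccontr)
      assume "\<not> (\<exists>i<n. v $ i \<noteq> 0)"
      then have "v = 0\<^sub>v n" using v(1) by (intro eq_vecI) auto
      with v(2) show False by simp
    qed
    then obtain i where "i < n" "v $ i \<noteq> 0" by blast
    then show ?thesis unfolding R_def by (intro sum_pos2[of _ i]) auto
  qed
  moreover have "S / of_real R = e" using SR \<open>R > 0\<close> by simp
  moreover have "S / of_real R \<in> \<real>" using \<open>S \<in> \<real>\<close> by (rule Reals_divide) simp
  ultimately show ?thesis by simp
qed

text \<open>The entries other than \<open>L ! 1\<close> contribute at least 1: either the entry 1 is
  in the tail, or the first entry is at least 1.\<close>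

lemma second_largest_power:
  fixes L :: "real list"
  assumes sorted: "sorted (rev L)" and one: "1 \<in> set L" and len: "length L \<ge> 2" and nn: "\<And>x. x \<in> set L \<Longrightarrow> x \<ge> 0"
  shows "(L ! 1) ^ k \<le> (\<Sum>x\<leftarrow>L. x ^ k) - 1"
proof -
  obtain a b L' where L: "L = a # b # L'"
    using len by (metis One_nat_def Suc_1 Suc_le_length_iff)
  have ba: "b \<le> a" using sorted by (simp add: L sorted_append)
  have nn': "0 \<le> x ^ k" if "x \<in> set L" for x using nn[OF that] by simp
  have "1 \<le> a ^ k + (\<Sum>x\<leftarrow>L'. x ^ k)"
  proof (cases "1 \<in> set L'")
    case True
    have "1 ^ k \<le> (\<Sum>x\<leftarrow>L'. x ^ k)"
      by (rule member_le_sum_list) (use True nn' L in \<open>auto intro!: image_eqI[of _ _ 1]\<close>)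
    then show ?thesis using nn'[of a] L by simp
  next
    case False
    then have "1 \<le> a" using one ba by (auto simp: L)
    then have "1 \<le> a ^ k" by simp
    moreover have "0 \<le> (\<Sum>x\<leftarrow>L'. x ^ k)" using nn' L by (intro sum_list_nonneg) auto
    ultimately show ?thesis by simp
  qed
  then show ?thesis by (simp add: L)
qed

text \<open>An even power of the modulus of a real eigenvalue is the power itself, so the trace is
  the power sum of the moduli. The constant vector belongs to the eigenvalue 1, which accounts for
  the subtracted 1.\<close>

lemma abs_mu2_power:
  assumes M: "M \<in> carrier_mat n n" and sym: "\<And>i j. i < n \<Longrightarrow> j < n \<Longrightarrow> M $$ (i, j) = M $$ (j, i)"
    and row: "\<And>i. i < n \<Longrightarrow> (\<Sum>j<n. M $$ (i, j)) = 1" and n: "n \<ge> 2"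
  shows "abs_mu2 M ^ (2 * m) \<le> mtrace (M ^\<^sub>m (2 * m)) - 1" and "abs_mu2 M \<ge> 0"
proof -
  let ?A = "map_mat complex_of_real M"
  have A: "?A \<in> carrier_mat n n" using M by simp
  from char_poly_factorized[OF A] obtain es where cp: "char_poly ?A = (\<Prod>e\<leftarrow>es. [:- e, 1:])" and len: "length es = n"
    by auto
  have "proots (\<Prod>e\<leftarrow>es. [:- e, 1:]) = mset es"
    proof (induction es)
    case (Cons a es)
    have "(\<Prod>e\<leftarrow>es. [:- e, 1:]) \<noteq> (0 :: complex poly)" by (simp add: prod_list_zero_iff image_iff)
    then have "proots ([:- a, 1:] * (\<Prod>e\<leftarrow>es. [:- e, 1:])) = proots [:- a, 1:] + proots (\<Prod>e\<leftarrow>es. [:- e, 1:])"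
      by (intro proots_mult) auto
    then show ?case using Cons by (simp del: mult_pCons_left)
  qed simp
  then have ms: "eigenvalues_mset M = mset es" unfolding eigenvalues_mset_def cp by simp
  have ev: "e \<in> set es \<longleftrightarrow> eigenvalue ?A e" for e
    unfolding eigenvalue_root_char_poly[OF A] cp by (induction es) auto
  have real: "e \<in> \<real>" if "e \<in> set es" for e
    using symmetric_eigenvalue_real[OF M sym] that ev by blast
  have "eigenvalue ?A 1"
    unfolding eigenvalue_def
  proof (rule exI[of _ "vec n (\<lambda>_. 1)"])
    have "?A *\<^sub>v vec n (\<lambda>_. 1) = 1 \<cdot>\<^sub>v vec n (\<lambda>_. 1)"
    proof (rule eq_vecI)
      fix i assume "i < dim_vec (1 \<cdot>\<^sub>v vec n (\<lambda>_. 1 :: complex))"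
      then have i: "i < n" by simp
      have "(?A *\<^sub>v vec n (\<lambda>_. 1)) $ i = (\<Sum>j<n. complex_of_real (M $$ (i, j)))"
        using i M by (simp add: scalar_prod_def lessThan_atLeast0)
      also have "\<dots> = 1" using row[OF i] by (simp only: of_real_sum[symmetric] of_real_1)
      finally show "(?A *\<^sub>v vec n (\<lambda>_. 1)) $ i = (1 \<cdot>\<^sub>v vec n (\<lambda>_. 1)) $ i" using i by simp
    qed (use M in simp)
    moreover have "vec n (\<lambda>_. 1 :: complex) \<noteq> 0\<^sub>v n"
      using n by (auto simp: vec_eq_iff intro!: exI[of _ 0])
    ultimately show "eigenvector ?A (vec n (\<lambda>_. 1)) 1" using M by (auto simp: eigenvector_def)
  qed
  then have one: "1 \<in> set es" by (simp add: ev)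
  define L where "L = rev (sorted_list_of_multiset (image_mset cmod (mset es)))"
  have mL: "mset L = image_mset cmod (mset es)" by (simp add: L_def)
  have sL: "set L = cmod ` set es" using arg_cong[OF mL, of set_mset] by simp
  have lL: "length L = n" using arg_cong[OF mL, of size] len by simp
  have mu: "abs_mu2 M = L ! 1" by (simp add: abs_mu2_def ms L_def)
  have "complex_of_real (\<Sum>x\<leftarrow>L. x ^ (2 * m)) = (\<Sum>e\<leftarrow>es. complex_of_real (cmod e ^ (2 * m)))"
  proof -
    have "(\<Sum>x\<leftarrow>L. x ^ (2 * m)) = (\<Sum>e\<leftarrow>es. cmod e ^ (2 * m))"
      using arg_cong[OF mL, of "\<lambda>X. sum_mset (image_mset (\<lambda>x. x ^ (2 * m)) X)"]
      by (simp add: sum_mset_sum_list[symmetric] image_mset.compositionality comp_def)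
    moreover have "complex_of_real (\<Sum>e\<leftarrow>es. cmod e ^ (2 * m)) = (\<Sum>e\<leftarrow>es. complex_of_real (cmod e ^ (2 * m)))" for es
      by (induction es) (simp_all only: list.map sum_list.Nil sum_list.Cons of_real_0 of_real_add)
    ultimately show ?thesis by simp
  qed
  also have "\<dots> = (\<Sum>e\<leftarrow>es. e ^ (2 * m))"
  proof (rule arg_cong[where f = sum_list], rule map_cong[OF refl])
    fix e assume "e \<in> set es"
    then obtain r where "e = of_real r" using real by (auto elim: Reals_cases)
    then show "complex_of_real (cmod e ^ (2 * m)) = e ^ (2 * m)" by (simp add: power_mult)
  qed
  also have "\<dots> = mtrace (?A ^\<^sub>m (2 * m))" by (rule mtrace_pow_eigenvalues[OF A cp, symmetric])
  also have "?A ^\<^sub>m (2 * m) = map_mat complex_of_real (M ^\<^sub>m (2 * m))"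
    by (rule of_real_hom.mat_hom_pow[OF M, symmetric])
  also have "mtrace \<dots> = complex_of_real (mtrace (M ^\<^sub>m (2 * m)))"
    using M by (simp add: mtrace_def)
  finally have tr: "(\<Sum>x\<leftarrow>L. x ^ (2 * m)) = mtrace (M ^\<^sub>m (2 * m))" by (simp only: of_real_eq_iff)
  have nn: "x \<ge> 0" if "x \<in> set L" for x using that sL by auto
  have "1 \<in> set L" using one by (auto simp: sL intro!: image_eqI[of _ _ 1])
  then show "abs_mu2 M ^ (2 * m) \<le> mtrace (M ^\<^sub>m (2 * m)) - 1"
    unfolding mu tr[symmetric] using nn n lL by (intro second_largest_power) (auto simp: L_def)
  show "abs_mu2 M \<ge> 0" unfolding mu using n lL by (intro nn nth_mem) simp
qed

section \<open>Trace method for the Schreier graph\<close>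

lemma vtx_bij: "bij_betw (vtx k) {..<2 ^ k - 1} (nzv k)"
proof -
  have bits: "bit (Suc a) j \<longleftrightarrow> j < k \<and> vtx k a $ j = 1" if "a < 2 ^ k - 1" for a j
  proof -
    \<comment> \<open>\<open>Suc a < 2 ^ k\<close>, so the binary digits from place \<open>k\<close>
      on vanish and the vector determines \<open>Suc a\<close>.\<close>
    have "take_bit k (Suc a) = Suc a" using that by (simp add: take_bit_nat_eq_self)
    then have "bit (Suc a) j \<longleftrightarrow> j < k \<and> bit (Suc a) j" by (metis bit_take_bit_iff)
    then show ?thesis by (auto simp: vtx_def)
  qed
  have inj: "inj_on (vtx k) {..<2 ^ k - 1}"
  proof (rule inj_onI)
    fix a b assume ab: "a \<in> {..<2 ^ k - 1}" "b \<in> {..<2 ^ k - 1}" "vtx k a = vtx k b"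
    have "Suc a = Suc b"
      by (rule bit_eqI) (use bits[of a] bits[of b] ab in simp)
    then show "a = b" by simp
  qed
  have sub: "vtx k ` {..<2 ^ k - 1} \<subseteq> nzv k"
  proof (intro image_subsetI)
    fix a assume a: "a \<in> {..<2 ^ k - 1 :: nat}"
    have "vtx k a \<noteq> 0\<^sub>v k"
    proof
      assume z: "vtx k a = 0\<^sub>v k"
      have "Suc a = 0" by (rule bit_eqI) (use bits[of a] a z in auto)
      then show False by simp
    qed
    then show "vtx k a \<in> nzv k" by (simp add: nzv_def vtx_def)
  qed
  have "card (vtx k ` {..<2 ^ k - 1}) = card (nzv k)"
    using card_image[OF inj] by (simp add: card_nzv)
  then have "vtx k ` {..<2 ^ k - 1} = nzv k" using sub nzv_finite by (intro card_subset_eq) auto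
  then show ?thesis using inj by (simp add: bij_betw_def)
qed

lemma power_powr_inverse:
  fixes x :: real
  assumes "x \<ge> 0" "m > 0"
  shows "(x ^ (2 * m)) powr (1 / (2 * real m)) = x"
proof (cases "x = 0")
  case True
  then show ?thesis using assms by simp
next
  case False
  then have "x ^ (2 * m) = x powr (2 * real m)" using assms by (simp add: powr_realpow[symmetric])
  then show ?thesis using assms False by (simp add: powr_powr)
qed

lemma words_Suc: "words D (Suc l) = (\<lambda>(x, w). x # w) ` ((D \<times> UNIV) \<times> words D l)"
  by (auto simp: words_def image_iff length_Suc_conv)

lemma sum_words_Suc:
  assumes "finite D"
  shows "(\<Sum>w\<in>words D (Suc l). f w) = (\<Sum>w\<in>words D l. \<Sum>x\<in>D \<times> UNIV. f (x # w))"
proof -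
  have "(\<Sum>w\<in>words D (Suc l). f w) = (\<Sum>(x, w)\<in>(D \<times> UNIV) \<times> words D l. f (x # w))"
    unfolding words_Suc by (subst sum.reindex) (auto simp: inj_on_def case_prod_beta' intro!: sum.cong)
  also have "\<dots> = (\<Sum>x\<in>D \<times> UNIV. \<Sum>w\<in>words D l. f (x # w))"
    by (rule sum.cartesian_product[symmetric])
  finally show ?thesis by (subst sum.swap) simp
qed

locale schreier_graph =
  fixes k d :: nat
  assumes k2: "k \<ge> 2" and d1: "d \<ge> 1"

sublocale schreier_graph \<subseteq> vec_action "nzv k" "GL2 k" "(*\<^sub>v)" "(+)"
  by (rule GL2_action) (rule k2)

context schreier_graph begin

text \<open>The backward traversal of an edge, the second summand in the adjacency matrix, is the
  letter with negative sign; a loop is counted by both signs.\<close>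

lemma schreier_norm_entry:
  assumes ss: "ss \<in> tuples d" and a: "a < 2 ^ k - 1" and b: "b < 2 ^ k - 1"
  shows "schreier_norm k ss $$ (a, b)
    = 1 / (2 * real d) * (\<Sum>x\<in>{..<d} \<times> UNIV. of_bool (sact (ss ! fst x) (snd x) (vtx k a) = vtx k b))"
proof -
  have v: "vtx k a \<in> nzv k" "vtx k b \<in> nzv k" using bij_betwE[OF vtx_bij] a b by auto
  have "(\<Sum>x\<in>{..<d} \<times> UNIV. of_bool (sact (ss ! fst x) (snd x) (vtx k a) = vtx k b))
    = (\<Sum>j<d. \<Sum>e\<in>UNIV. of_bool (sact (ss ! j) e (vtx k a) = vtx k b) :: real)"
    by (simp only: sum.cartesian_product case_prod_beta')
  also have "\<dots> = (\<Sum>j<d. of_bool (ss ! j *\<^sub>v vtx k a = vtx k b) + of_bool (ss ! j *\<^sub>v vtx k b = vtx k a))"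
  proof (rule sum.cong[OF refl])
    fix j assume "j \<in> {..<d}"
    then have g: "ss ! j \<in> GL2 k" using tuples_nth[OF ss] by simp
    show "(\<Sum>e\<in>UNIV. of_bool (sact (ss ! j) e (vtx k a) = vtx k b) :: real)
       = of_bool (ss ! j *\<^sub>v vtx k a = vtx k b) + of_bool (ss ! j *\<^sub>v vtx k b = vtx k a)"
      by (simp add: UNIV_bool sact_def inv_act[OF g v])
  qed
  finally show ?thesis
    using a b tuples_length[OF ss] by (simp add: schreier_norm_def schreier_adj_def)
qed

lemma schreier_norm_carrier: "schreier_norm k ss \<in> carrier_mat (2 ^ k - 1) (2 ^ k - 1)"
  by (simp add: schreier_norm_def schreier_adj_def)

lemma schreier_norm_sym:
  "i < 2 ^ k - 1 \<Longrightarrow> j < 2 ^ k - 1 \<Longrightarrow> schreier_norm k ss $$ (i, j) = schreier_norm k ss $$ (j, i)"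
  by (simp add: schreier_norm_def schreier_adj_def add.commute)

lemma sum_vtx:
  assumes "v \<in> nzv k"
  shows "(\<Sum>c<2 ^ k - 1. of_bool (v = vtx k c) * f (vtx k c)) = (f v :: real)"
proof -
  have "(\<Sum>c<2 ^ k - 1. of_bool (v = vtx k c) * f (vtx k c)) = (\<Sum>x\<in>nzv k. of_bool (v = x) * f x)"
    by (rule sum.reindex_bij_betw[OF vtx_bij])
  also have "\<dots> = f v" using assms nzv_finite by (simp add: of_bool_def if_distrib[where f = "\<lambda>x. x * _"] cong: if_cong)
  finally show ?thesis .
qed

lemma schreier_norm_row:
  assumes ss: "ss \<in> tuples d" and i: "i < 2 ^ k - 1"
  shows "(\<Sum>j<2 ^ k - 1. schreier_norm k ss $$ (i, j)) = 1"
proof -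
  have v: "vtx k i \<in> nzv k" using bij_betwE[OF vtx_bij] i by auto
  have "(\<Sum>j<2 ^ k - 1. schreier_norm k ss $$ (i, j))
     = 1 / (2 * real d) * (\<Sum>j<2 ^ k - 1. \<Sum>x\<in>{..<d} \<times> UNIV. of_bool (sact (ss ! fst x) (snd x) (vtx k i) = vtx k j))"
    unfolding sum_distrib_left[of "1 / (2 * real d)" _ "{..<2 ^ k - 1}"]
    by (intro sum.cong refl schreier_norm_entry[OF ss i]) simp
  also have "(\<Sum>j<2 ^ k - 1. \<Sum>x\<in>{..<d} \<times> UNIV. of_bool (sact (ss ! fst x) (snd x) (vtx k i) = vtx k j))
     = (\<Sum>x\<in>{..<d} \<times> (UNIV :: bool set). 1 :: real)"
    unfolding sum.swap[of _ "{..<d} \<times> UNIV"]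
  proof (rule sum.cong[OF refl])
    fix x :: "nat \<times> bool" assume x: "x \<in> {..<d} \<times> UNIV"
    have "sact (ss ! fst x) (snd x) (vtx k i) \<in> nzv k" using x v by (intro sact_in tuples_nth[OF ss]) auto
    from sum_vtx[OF this, of "\<lambda>_. 1"]
    show "(\<Sum>j<2 ^ k - 1. of_bool (sact (ss ! fst x) (snd x) (vtx k i) = vtx k j)) = (1 :: real)" by simp
  qed
  also have "\<dots> = 2 * real d" by simp
  finally show ?thesis using d1 by simp
qed

text \<open>A walk is prolonged at its end \<open>b\<close>, which is the head of the word because
  the first letter acts last. The sum over the intermediate vertex selects the one that the shorter
  word reaches.\<close>

lemma schreier_norm_pow_entry:
  assumes ss: "ss \<in> tuples d" and a: "a < 2 ^ k - 1" and b: "b < 2 ^ k - 1"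
  shows "(schreier_norm k ss ^\<^sub>m l) $$ (a, b)
    = (1 / (2 * real d)) ^ l * (\<Sum>w\<in>words {..<d} l. of_bool (ev ss w (vtx k a) = vtx k b))"
  using b
proof (induction l arbitrary: b)
  case 0
  have "words {..<d} 0 = {[]}" by (auto simp: words_def)
  moreover have "vtx k a = vtx k b \<longleftrightarrow> a = b"
    using vtx_bij[of k] a 0 by (auto simp: bij_betw_def inj_on_def)
  ultimately show ?case using a 0 schreier_norm_carrier[of ss] by simp
next
  case (Suc l)
  let ?c = "1 / (2 * real d)" and ?n = "2 ^ k - 1 :: nat"
  have va: "vtx k a \<in> nzv k" using bij_betwE[OF vtx_bij] a by auto
  have "(schreier_norm k ss ^\<^sub>m Suc l) $$ (a, b) = (\<Sum>c<?n. (schreier_norm k ss ^\<^sub>m l) $$ (a, c) * schreier_norm k ss $$ (c, b))"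
    using a Suc.prems schreier_norm_carrier[of ss] by (simp add: scalar_prod_def lessThan_atLeast0)
  also have "\<dots> = (\<Sum>c<?n. ?c ^ l * (\<Sum>w\<in>words {..<d} l. of_bool (ev ss w (vtx k a) = vtx k c)) *
        (?c * (\<Sum>x\<in>{..<d} \<times> UNIV. of_bool (sact (ss ! fst x) (snd x) (vtx k c) = vtx k b))))"
    using Suc.IH schreier_norm_entry[OF ss _ Suc.prems] by (intro sum.cong refl) simp
  also have "\<dots> = ?c ^ Suc l * (\<Sum>c<?n. (\<Sum>w\<in>words {..<d} l. \<Sum>x\<in>{..<d} \<times> UNIV. of_bool (ev ss w (vtx k a) = vtx k c) *
         of_bool (sact (ss ! fst x) (snd x) (vtx k c) = vtx k b)))"
    unfolding sum_distrib_left[of "?c ^ Suc l"] sum_product[symmetric]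
    by (intro sum.cong refl) (simp only: power_Suc mult_ac)
  also have "(\<Sum>c<?n. (\<Sum>w\<in>words {..<d} l. \<Sum>x\<in>{..<d} \<times> UNIV. of_bool (ev ss w (vtx k a) = vtx k c) *
         of_bool (sact (ss ! fst x) (snd x) (vtx k c) = vtx k b)))
     = (\<Sum>w\<in>words {..<d} l. \<Sum>x\<in>{..<d} \<times> UNIV. \<Sum>c<?n. of_bool (ev ss w (vtx k a) = vtx k c) *
         (of_bool (sact (ss ! fst x) (snd x) (vtx k c) = vtx k b) :: real))"
    by (subst sum.swap, rule sum.cong[OF refl], rule sum.swap)
  also have "\<dots> = (\<Sum>w\<in>words {..<d} l. \<Sum>x\<in>{..<d} \<times> UNIV. of_bool (ev ss (x # w) (vtx k a) = vtx k b))"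
  proof (intro sum.cong refl)
    fix w and x :: "nat \<times> bool" assume "w \<in> words {..<d} l"
    then have "bij_betw (ev ss w) (nzv k) (nzv k)" by (intro ev_bij[OF ss] set_words)
    then have "ev ss w (vtx k a) \<in> nzv k" using va by (rule bij_in)
    from sum_vtx[OF this, of "\<lambda>v. of_bool (sact (ss ! fst x) (snd x) v = vtx k b)"]
    show "(\<Sum>c<?n. of_bool (ev ss w (vtx k a) = vtx k c) *
         (of_bool (sact (ss ! fst x) (snd x) (vtx k c) = vtx k b) :: real)) = of_bool (ev ss (x # w) (vtx k a) = vtx k b)"
      by simp
  qed
  also have "\<dots> = (\<Sum>w\<in>words {..<d} (Suc l). of_bool (ev ss w (vtx k a) = vtx k b))"
    by (rule sum_words_Suc[symmetric]) simp
  finally show ?case .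
qed

lemma mtrace_schreier_pow:
  assumes ss: "ss \<in> tuples d"
  shows "mtrace (schreier_norm k ss ^\<^sub>m l) = (1 / (2 * real d)) ^ l * (\<Sum>w\<in>words {..<d} l. real (fixn (ev ss w)))"
proof -
  have "mtrace (schreier_norm k ss ^\<^sub>m l)
     = (\<Sum>a<2 ^ k - 1. (1 / (2 * real d)) ^ l * (\<Sum>w\<in>words {..<d} l. of_bool (ev ss w (vtx k a) = vtx k a)))"
    unfolding mtrace_def using schreier_norm_carrier[of ss] schreier_norm_pow_entry[OF ss] by simp
  also have "\<dots> = (1 / (2 * real d)) ^ l * (\<Sum>w\<in>words {..<d} l. \<Sum>a<2 ^ k - 1. of_bool (ev ss w (vtx k a) = vtx k a))"
    unfolding sum_distrib_left[symmetric] by (subst sum.swap) (rule refl)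
  also have "(\<Sum>w\<in>words {..<d} l. \<Sum>a<2 ^ k - 1. of_bool (ev ss w (vtx k a) = vtx k a)) = (\<Sum>w\<in>words {..<d} l. real (fixn (ev ss w)))"
  proof (rule sum.cong[OF refl])
    fix w
    have "(\<Sum>a<2 ^ k - 1. of_bool (ev ss w (vtx k a) = vtx k a)) = (\<Sum>v\<in>nzv k. of_bool (ev ss w v = v) :: real)"
      by (rule sum.reindex_bij_betw[OF vtx_bij])
    also have "\<dots> = real (fixn (ev ss w))" using nzv_finite by (simp add: fixn_def Int_def)
    finally show "(\<Sum>a<2 ^ k - 1. of_bool (ev ss w (vtx k a) = vtx k a)) = real (fixn (ev ss w))" .
  qed
  finally show ?thesis .
qed

lemma n_eq: "n = real (2 ^ k - 1)" by (simp add: card_nzv)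

text \<open>Jensen's inequality for the convex power \<open>2 m\<close> compares the power of the
  mean with the mean of the power, which \<open>abs_mu2_power\<close> bounds by the mean of the
  trace minus 1. Nonnegativity is recorded separately for a further use of the monotonicity of
  \<open>powr\<close>.\<close>

lemma expectation_mu2:
  assumes m: "m > 0"
  shows mean_trace_ge_1: "(1 / (2 * real d)) ^ (2 * m) * ((\<Sum>w\<in>words {..<d} (2 * m). total d w) / T d) - 1 \<ge> 0"
    and "measure_pmf.expectation (pmf_of_set (tuples d)) (\<lambda>ss. abs_mu2 (schreier_norm k ss)) \<le>
    ((1 / (2 * real d)) ^ (2 * m) * ((\<Sum>w\<in>words {..<d} (2 * m). total d w) / T d) - 1) powr (1 / (2 * real m))"
proof -
  let ?mu = "\<lambda>ss. abs_mu2 (schreier_norm k ss)"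
  let ?E = "(\<Sum>ss\<in>tuples d. ?mu ss) / T d"
  have ne: "tuples d \<noteq> {}" using T_pos[of d] by auto
  have "(2::nat) \<le> 2 ^ k - 1" using cardV by (simp add: card_nzv)
  note mu = abs_mu2_power[OF schreier_norm_carrier schreier_norm_sym schreier_norm_row this]
  have E0: "?E \<ge> 0" using T_pos[of d] mu(2) by (intro divide_nonneg_pos sum_nonneg) auto
  have "?E ^ (2 * m) = (\<Sum>ss\<in>tuples d. (1 / T d) *\<^sub>R ?mu ss) ^ (2 * m)"
    by (simp add: sum_divide_distrib)
  also have "\<dots> \<le> (\<Sum>ss\<in>tuples d. (1 / T d) * ?mu ss ^ (2 * m))"
    using T_pos[of d] by (intro convex_on_sum[OF finite_tuples ne convex_power_even[of "2 * m"]]) auto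
  also have "\<dots> \<le> (\<Sum>ss\<in>tuples d. (1 / T d) * (mtrace (schreier_norm k ss ^\<^sub>m (2 * m)) - 1))"
    using T_pos[of d] mu(1) by (intro sum_mono mult_left_mono) auto
  also have "\<dots> = (\<Sum>ss\<in>tuples d. (1 / T d) * ((1 / (2 * real d)) ^ (2 * m) * (\<Sum>w\<in>words {..<d} (2 * m). real (fixn (ev ss w))) - 1))"
    by (intro sum.cong refl) (simp only: mtrace_schreier_pow)
  also have "\<dots> = 1 / T d * ((1 / (2 * real d)) ^ (2 * m) * (\<Sum>ss\<in>tuples d. \<Sum>w\<in>words {..<d} (2 * m). real (fixn (ev ss w))) - T d)"
    by (simp only: sum_distrib_left[symmetric] sum_subtractf sum_constant mult_1_right)
  also have "(\<Sum>ss\<in>tuples d. \<Sum>w\<in>words {..<d} (2 * m). real (fixn (ev ss w))) = (\<Sum>w\<in>words {..<d} (2 * m). total d w)"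
    unfolding total_def by (rule sum.swap)
  also have "1 / T d * ((1 / (2 * real d)) ^ (2 * m) * (\<Sum>w\<in>words {..<d} (2 * m). total d w) - T d)
     = (1 / (2 * real d)) ^ (2 * m) * ((\<Sum>w\<in>words {..<d} (2 * m). total d w) / T d) - 1"
    using T_pos[of d] by (simp add: right_diff_distrib)
  finally have le: "?E ^ (2 * m) \<le> (1 / (2 * real d)) ^ (2 * m) * ((\<Sum>w\<in>words {..<d} (2 * m). total d w) / T d) - 1" .
  then show "(1 / (2 * real d)) ^ (2 * m) * ((\<Sum>w\<in>words {..<d} (2 * m). total d w) / T d) - 1 \<ge> 0"
    using zero_le_power[OF E0, of "2 * m"] by linarith
  have "measure_pmf.expectation (pmf_of_set (tuples d)) ?mu = ?E"
    by (rule integral_pmf_of_set[OF ne finite_tuples])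
  also have "?E = (?E ^ (2 * m)) powr (1 / (2 * real m))"
    by (rule power_powr_inverse[OF E0 m, symmetric])
  also have "\<dots> \<le> ((1 / (2 * real d)) ^ (2 * m) * ((\<Sum>w\<in>words {..<d} (2 * m). total d w) / T d) - 1) powr (1 / (2 * real m))"
    using le E0 by (intro powr_mono2) auto
  finally show "measure_pmf.expectation (pmf_of_set (tuples d)) (\<lambda>ss. abs_mu2 (schreier_norm k ss)) \<le>
    ((1 / (2 * real d)) ^ (2 * m) * ((\<Sum>w\<in>words {..<d} (2 * m). total d w) / T d) - 1) powr (1 / (2 * real m))" .
qed

end

section \<open>The bound\<close>

lemma sum_subsets_card:
  fixes g :: "nat \<Rightarrow> real"
  assumes "finite D"
  shows "(\<Sum>I\<in>Pow D. if card I \<le> m then g (card I) else 0) = (\<Sum>i=0..m. real (card D choose i) * g i)"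
proof -
  have fin: "finite {I \<in> Pow D. card I = i}" for i using assms by simp
  have "(\<Sum>I\<in>Pow D. if card I \<le> m then g (card I) else 0) = (\<Sum>I\<in>{I \<in> Pow D. card I \<in> {0..m}}. g (card I))"
    using assms by (intro sum.mono_neutral_cong_right) auto
  also have "{I \<in> Pow D. card I \<in> {0..m}} = (\<Union>i\<in>{0..m}. {I \<in> Pow D. card I = i})" by auto
  also have "(\<Sum>I\<in>\<dots>. g (card I)) = (\<Sum>i=0..m. \<Sum>I\<in>{I \<in> Pow D. card I = i}. g (card I))"
    using fin by (intro sum.UNION_disjoint) auto
  also have "\<dots> = (\<Sum>i=0..m. real (card D choose i) * g i)"
  proof (rule sum.cong[OF refl])
    fix i
    have "(\<Sum>I\<in>{I \<in> Pow D. card I = i}. g (card I)) = (\<Sum>I\<in>{I. I \<subseteq> D \<and> card I = i}. g i)"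
      by (rule sum.cong) auto
    then show "(\<Sum>I\<in>{I \<in> Pow D. card I = i}. g (card I)) = real (card D choose i) * g i"
      using n_subsets[OF assms, of i] by simp
  qed
  finally show ?thesis .
qed

text \<open>This is the case \<open>I = {}\<close> of \<open>wmin_exact\<close>, where no letter is
  deleted. The variable \<open>q\<close> in place of \<open>Suc p\<close> lets numerals be
  matched.\<close>

lemma wmin_split:
  assumes "finite D" "p \<ge> 1" "q = Suc p"
  shows "wmin p D l = {w \<in> wmin p D l. card (exact p w) \<ge> 1} \<union> wmin q D l"
    and "{w \<in> wmin p D l. card (exact p w) \<ge> 1} \<inter> wmin q D l = {}"
    and "wmin q D l = {w \<in> wmin p D l. exact p w = {}}"
proof -
  have fin: "finite (exact p w)" if "w \<in> wmin p D l" for w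
    using exact_subset[OF assms(2), of w D l] that assms(1) finite_subset by (auto simp: wmin_def)
  have *: "erase {} w = w" "restr {} w = []" for w by (simp_all add: erase_def restr_def)
  have "{w \<in> wmin p D l. exact p w = {}} = wexact p D l {}"
    using wmin_exact[OF assms(1,2), of "{}" l] by simp
  also have "\<dots> = wmin q D l"
    by (auto simp: wexact_def mixed_def exwords_def words_def * assms(3))
  finally show eq: "wmin q D l = {w \<in> wmin p D l. exact p w = {}}" by simp
  have "card (exact p w) \<ge> 1 \<longleftrightarrow> exact p w \<noteq> {}" if "w \<in> wmin p D l" for w
    using fin[OF that] by (simp add: Suc_le_eq card_gt_0_iff)
  then show "wmin p D l = {w \<in> wmin p D l. card (exact p w) \<ge> 1} \<union> wmin q D l"
    "{w \<in> wmin p D l. card (exact p w) \<ge> 1} \<inter> wmin q D l = {}"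
    unfolding eq by blast+
qed

lemma wmin_1: "wmin 1 D l = words D l"
proof -
  have "v = [] \<or> 1 \<le> length v" for v :: word by (cases v) auto
  then show ?thesis unfolding wmin_def by blast
qed

lemma mixed_Un: "mixed I A (B \<union> B') = mixed I A B \<union> mixed I A B'"
  by (auto simp: mixed_def)

lemma erase_occ_three:
  assumes "w \<in> mixed I A {r \<in> wmin 3 D l. card (exact 3 r) \<ge> 1}"
  shows "\<exists>j. length (occ w j) = 3"
proof -
  have "exact 3 (erase I w) \<noteq> {}" using assms unfolding mixed_def by force
  then obtain j where "length (occ (erase I w) j) = 3" unfolding exact_def by blast
  then have "length (occ w j) = 3" by (simp add: occ_erase split: if_splits)
  then show ?thesis by blast
qed

context vec_action begin

text \<open>\<open>pair_sum\<close> is applied twice, according to the letters outside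
  \<open>I\<close>: if one of them occurs exactly three times, then with \<open>c = 5\<close> from
  \<open>total_thrice\<close>; if each is absent or occurs at least four times, then with
  \<open>c = n\<close>, the trivial bound.\<close>

lemma sum_total_wexact:
  assumes I: "I \<subseteq> {..<d}" and le: "2 * card I \<le> l" and ne: "I \<noteq> {}"
  defines "i \<equiv> card I"
  defines "x3 \<equiv> Xp 3 1 (l - 2 * i) (d - i)" and "x4 \<equiv> Xp 4 0 (l - 2 * i) (d - i)"
  shows "(\<Sum>w\<in>wexact 2 {..<d} l I. total d w)
    \<le> T d * ((fact l / fact (l - 2 * i)) * ((2 * (2 ^ i - 1) + 1) * (x3 + x4) + 2 ^ i / fact (i + 1) * (5 * x3 + n * x4)))"
proof -
  let ?b = "l - 2 * i" and ?D = "{..<d} - I"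
  define R3 where "R3 = {r \<in> wmin 3 ?D ?b. card (exact 3 r) \<ge> 1}"
  define R4 where "R4 = wmin 4 ?D ?b"
  have cD: "card ?D = d - i" using I by (simp add: i_def card_Diff_subset finite_subset)
  have fD: "finite ?D" by simp
  have R: "wmin 3 ?D ?b = R3 \<union> R4" "R3 \<inter> R4 = {}"
    unfolding R3_def R4_def by (rule wmin_split[OF fD]; simp)+
  have c3: "real (card R3) = x3" using card_wmin[OF fD, of 3 ?b 1] by (simp add: R3_def x3_def cD)
  have c4: "real (card R4) = x4" using card_wmin[OF fD, of 4 ?b 0] by (simp add: R4_def x4_def cD)
  have s3: "R3 \<subseteq> words ?D ?b" and s4: "R4 \<subseteq> words ?D ?b" by (auto simp: R3_def R4_def wmin_def)
  let ?M = "mixed I (exwords (\<lambda>_. True) 2 I)"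
  have sub: "fst ` set w \<subseteq> {..<d}" if "w \<in> ?M R3" for w
  proof -
    have "w \<in> mixed I (words I (2 * i)) (words ?D ?b)"
      using that s3 exwords_subset[of "\<lambda>_. True" 2 I] unfolding mixed_def i_def by blast
    from set_words[OF words_mixed[OF this I]] show ?thesis .
  qed
  have le': "2 * i + ?b = l" using le by (simp add: i_def)
  have C: "real (l choose (2 * i)) * fact (2 * i) = fact l / fact ?b"
    using binomial_fact[of "2 * i" l, where 'a = real] le by (simp add: i_def)
  have 3: "(\<Sum>w\<in>?M R3. total d w) \<le> T d * ((fact l / fact ?b) * x3 * (2 * (2 ^ i - 1) + 1 + 5 * 2 ^ i / fact (i + 1)))"
  proof -
    have "total d w \<le> 5 * T d" if "w \<in> ?M R3" for w
      using total_thrice[OF sub[OF that]] erase_occ_three[of w I _ ?D ?b] that unfolding R3_def by blast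
    from pair_sum[OF I s3 _ this] show ?thesis unfolding i_def[symmetric] le' C c3 by simp
  qed
  have 4: "(\<Sum>w\<in>?M R4. total d w) \<le> T d * ((fact l / fact ?b) * x4 * (2 * (2 ^ i - 1) + 1 + n * 2 ^ i / fact (i + 1)))"
    using pair_sum[OF I s4 _ total_trivial] n_ge unfolding i_def[symmetric] le' C c4 by simp
  have s23: "Suc 2 = (3 :: nat)" by simp
  have "wexact 2 {..<d} l I = ?M R3 \<union> ?M R4"
    unfolding wexact_def s23 mixed_Un[symmetric] R(1)[symmetric] i_def ..
  moreover have "?M R3 \<inter> ?M R4 = {}" using R(2) by (auto simp: mixed_def)
  moreover have "wexact 2 {..<d} l I = {w \<in> wmin 2 {..<d} l. exact 2 w = I}"
    using wmin_exact[of "{..<d}" 2 I l] I le by simp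
  then have "finite (wexact 2 {..<d} l I)" using finite_wmin[of "{..<d}" 2 l] by simp
  ultimately have "(\<Sum>w\<in>wexact 2 {..<d} l I. total d w) = (\<Sum>w\<in>?M R3. total d w) + (\<Sum>w\<in>?M R4. total d w)"
    by (metis finite_Un sum.union_disjoint)
  also note add_mono[OF 3 4]
  also have "T d * ((fact l / fact ?b) * x3 * (2 * (2 ^ i - 1) + 1 + 5 * 2 ^ i / fact (i + 1)))
      + T d * ((fact l / fact ?b) * x4 * (2 * (2 ^ i - 1) + 1 + n * 2 ^ i / fact (i + 1)))
    = T d * ((fact l / fact ?b) * ((2 * (2 ^ i - 1) + 1) * (x3 + x4) + 2 ^ i / fact (i + 1) * (5 * x3 + n * x4)))"
    by (simp del: fact_Suc add: algebra_simps add_divide_distrib)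
  finally show ?thesis .
qed

text \<open>The words with a letter that occurs once form one class; the others are sorted by the
  set \<open>I\<close> of letters that occur twice. For \<open>I = {}\<close> there are no pairs,
  and the class is estimated directly; it yields the two terms with \<open>Xp 3\<close> and
  \<open>Xp 4\<close> outside the sum over \<open>i\<close>.\<close>

lemma sum_total:
  fixes d m :: nat
  defines "D \<equiv> {..<d}"
  shows "(\<Sum>w\<in>words D (2 * m). total d w) \<le> T d * (Xp 1 1 (2 * m) d + (5 * Xp 3 1 (2 * m) d + n * Xp 4 0 (2 * m) d)
    + (\<Sum>i=1..m. real (d choose i) * ((fact (2 * m) / fact (2 * m - 2 * i)) *
        ((2 * (2 ^ i - 1) + 1) * (Xp 3 1 (2 * m - 2 * i) (d - i) + Xp 4 0 (2 * m - 2 * i) (d - i))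
         + 2 ^ i / fact (i + 1) * (5 * Xp 3 1 (2 * m - 2 * i) (d - i) + n * Xp 4 0 (2 * m - 2 * i) (d - i))))))"
    (is "_ \<le> T d * (_ + _ + (\<Sum>i=1..m. real (d choose i) * ?h i))")
proof -
  let ?l = "2 * m"
  define g where "g = (\<lambda>i. if i = 0 then 5 * Xp 3 1 ?l d + n * Xp 4 0 ?l d else ?h i)"
  have fD: "finite D" and cD: "card D = d" by (simp_all add: D_def)
  have wD: "fst ` set w \<subseteq> {..<d}" if "w \<in> wmin p D ?l" for w p
    using that set_words[of w D ?l] unfolding wmin_def D_def by blast
  define W1 where "W1 = {w \<in> wmin 1 D ?l. card (exact 1 w) \<ge> 1}"
  have sp: "words D ?l = W1 \<union> wmin 2 D ?l" "W1 \<inter> wmin 2 D ?l = {}"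
    unfolding W1_def wmin_1[symmetric] by (rule wmin_split[OF fD]; simp)+
  have fin: "finite W1" "finite (wmin 2 D ?l)" using finite_wmin[OF fD] by (simp_all add: W1_def)
  have once: "(\<Sum>w\<in>W1. total d w) \<le> T d * Xp 1 1 ?l d"
  proof -
    have "total d w \<le> T d" if w: "w \<in> W1" for w
    proof -
      have "card (exact 1 w) \<ge> 1" using w unfolding W1_def by blast
      then have "card (exact 1 w) \<noteq> 0" by linarith
      then have "exact 1 w \<noteq> {}" by (metis card.empty)
      then obtain j where j: "length (occ w j) = 1" unfolding exact_def by blast
      have "w \<in> wmin 1 D ?l" using w unfolding W1_def by blast
      then show ?thesis by (rule total_once[OF wD j])
    qed
    then have "(\<Sum>w\<in>W1. total d w) \<le> real (card W1) * T d" by (rule sum_bounded_above)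
    moreover have "real (card W1) = Xp 1 1 ?l d" unfolding W1_def using card_wmin[OF fD order_refl, of ?l 1] unfolding cD .
    ultimately show ?thesis by (simp only: mult.commute)
  qed
  have empty: "(\<Sum>w\<in>wmin 3 D ?l. total d w) \<le> T d * g 0"
  proof -
    define R3 where "R3 = {w \<in> wmin 3 D ?l. card (exact 3 w) \<ge> 1}"
    have sp3: "wmin 3 D ?l = R3 \<union> wmin 4 D ?l" "R3 \<inter> wmin 4 D ?l = {}"
      unfolding R3_def by (rule wmin_split[OF fD]; simp)+
    have fin3: "finite R3" "finite (wmin 4 D ?l)" using finite_wmin[OF fD] by (simp_all add: R3_def)
    have "total d w \<le> 5 * T d" if w: "w \<in> R3" for w
    proof -
      have "card (exact 3 w) \<ge> 1" using w unfolding R3_def by blast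
      then have "card (exact 3 w) \<noteq> 0" by linarith
      then have "exact 3 w \<noteq> {}" by (metis card.empty)
      then obtain j where j: "length (occ w j) = 3" unfolding exact_def by blast
      have "w \<in> wmin 3 D ?l" using w unfolding R3_def by blast
      then show ?thesis by (rule total_thrice[OF wD j])
    qed
    then have "(\<Sum>w\<in>R3. total d w) \<le> real (card R3) * (5 * T d)" by (rule sum_bounded_above)
    moreover have "(\<Sum>w\<in>wmin 4 D ?l. total d w) \<le> real (card (wmin 4 D ?l)) * (n * T d)"
      by (rule sum_bounded_above) (rule total_trivial)
    moreover have "real (card R3) = Xp 3 1 ?l d" using card_wmin[OF fD, of 3 ?l 1] by (simp add: R3_def cD)
    moreover have "real (card (wmin 4 D ?l)) = Xp 4 0 ?l d" using card_wmin[OF fD, of 4 ?l 0] by (simp add: cD)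
    ultimately show ?thesis unfolding sp3(1) using sum.union_disjoint[OF fin3 sp3(2), of "total d"]
      by (simp add: g_def algebra_simps)
  qed
  have step: "(\<Sum>w\<in>{w \<in> wmin 2 D ?l. exact 2 w = I}. total d w) \<le> T d * (if card I \<le> m then g (card I) else 0)"
    if I: "I \<in> Pow D" for I
  proof (cases "card I \<le> m")
    case False
    \<comment> \<open>More than \<open>m\<close> letters that occur twice do not fit into length
      \<open>2 m\<close>, so the sum ends at \<open>i = m\<close>.\<close>
    then have "\<not> 2 * card I \<le> ?l" by simp
    then have "{w \<in> wmin 2 D ?l. exact 2 w = I} = {}" using wmin_exact[OF fD, of 2 I ?l] I by simp
    then show ?thesis using False by (simp del: Collect_empty_eq)
  next
    case True
    then have le: "2 * card I \<le> ?l" by simp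
    have eq: "{w \<in> wmin 2 D ?l. exact 2 w = I} = wexact 2 D ?l I" using wmin_exact[OF fD, of 2 I ?l] I le by simp
    show ?thesis
    proof (cases "I = {}")
      case I0: True
      have "{w \<in> wmin 2 D ?l. exact 2 w = I} = wmin 3 D ?l" unfolding I0 by (rule wmin_split(3)[OF fD, symmetric]) simp_all
      then show ?thesis using empty I0 by simp
    next
      case I1: False
      have "finite I" using I fD finite_subset by blast
      then have "card I \<noteq> 0" using I1 by simp
      then show ?thesis unfolding eq using sum_total_wexact[of I d ?l] I le I1 True by (simp add: g_def D_def)
    qed
  qed
  have "(\<Sum>w\<in>wmin 2 D ?l. total d w) = (\<Sum>I\<in>Pow D. \<Sum>w\<in>{w \<in> wmin 2 D ?l. exact 2 w = I}. total d w)"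
  proof (rule sum.group[symmetric, OF fin(2)])
    show "exact 2 ` wmin 2 D ?l \<subseteq> Pow D"
      using exact_subset[of 2 _ D ?l] by (auto simp: wmin_def)
  qed (use fD in simp)
  also have "\<dots> \<le> (\<Sum>I\<in>Pow D. T d * (if card I \<le> m then g (card I) else 0))"
    by (rule sum_mono) (rule step)
  also have "\<dots> = T d * (\<Sum>i=0..m. real (d choose i) * g i)"
    unfolding sum_distrib_left[symmetric] sum_subsets_card[OF fD] cD ..
  also have "(\<Sum>i=0..m. real (d choose i) * g i) = g 0 + (\<Sum>i=1..m. real (d choose i) * g i)"
    by (simp add: sum.atLeast_Suc_atMost)
  finally have two: "(\<Sum>w\<in>wmin 2 D ?l. total d w) \<le> T d * (g 0 + (\<Sum>i=1..m. real (d choose i) * g i))" .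
  have "(\<Sum>w\<in>words D ?l. total d w) = (\<Sum>w\<in>W1. total d w) + (\<Sum>w\<in>wmin 2 D ?l. total d w)"
    unfolding sp(1) by (rule sum.union_disjoint[OF fin sp(2)])
  also have "\<dots> \<le> T d * (Xp 1 1 ?l d + g 0 + (\<Sum>i=1..m. real (d choose i) * g i))"
    using once two by (simp only: distrib_left)
  also have "g 0 = 5 * Xp 3 1 ?l d + n * Xp 4 0 ?l d" by (simp add: g_def)
  also have "(\<Sum>i=1..m. real (d choose i) * g i) = (\<Sum>i=1..m. real (d choose i) * ?h i)"
  proof (rule sum.cong[OF refl])
    fix i assume "i \<in> {1..m}"
    then have "i \<noteq> 0" by simp
    then show "real (d choose i) * g i = real (d choose i) * ?h i"
      by (simp only: g_def if_False)
  qed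
  finally show ?thesis .
qed

end

text \<open>Multiplied by the factor \<open>n\<close> in front of the bracket, the weights
  \<open>2 / n\<close>, \<open>1 / n\<close>, \<open>5 / n\<close> and 1 become the bounds 2, 1, 5
  and \<open>n\<close> on the mean number of fixed points; \<open>p\<close> stands for
  \<open>2 ^ i - 1\<close>.\<close>

lemma bracket_summand_scale:
  fixes n :: real
  assumes "n > 0"
  shows "n * (p * x * (2 / n) + (x * (1 / n) + q * (a * (5 / n) + b))) = (2 * p + 1) * x + q * (5 * a + n * b)"
  using assms by (simp add: field_simps)

lemma bracket_scale:
  fixes n :: real
  assumes "n > 0"
  shows "n * (s + x * (1 / n) + a * (5 / n) + b) = x + (5 * a + n * b) + n * s"
  using assms by (simp add: field_simps)

theorem theorem1:
  fixes k d m :: nat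
  assumes "k \<ge> 2" and "d \<ge> 1" and "m > 0"
  defines "n \<equiv> real (2 ^ k - 1)"
      and "x3 \<equiv> (\<lambda>i. Xp 3 1 (2 * m - 2 * i) (d - i))"
      and "x4 \<equiv> (\<lambda>i. Xp 4 0 (2 * m - 2 * i) (d - i))"
  shows "measure_pmf.expectation (pmf_of_set {ss. length ss = d \<and> set ss \<subseteq> GL2 k})
           (\<lambda>ss. abs_mu2 (schreier_norm k ss))
         \<le> ((1 / (2 * real d)) ^ (2 * m) * n *
              ((\<Sum>i = 1..m. real (d choose i) * (fact (2 * m) / fact (2 * m - 2 * i)) *
                  ((2 ^ i - 1) * (x3 i + x4 i) * (2 / n)
                   + ((x3 i + x4 i) * (1 / n)
                      + 2 ^ i / fact (i + 1) * (x3 i * (5 / n) + x4 i))))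
               + Xp 1 1 (2 * m) d * (1 / n) + x3 0 * (5 / n) + x4 0)
            - 1) powr (1 / (2 * real m))"
    (is "_ \<le> (?c * n * ?B - 1) powr _")
proof -
  interpret G: schreier_graph k d using assms by unfold_locales
  let ?S = "\<Sum>w\<in>words {..<d} (2 * m). G.total d w"
  have nG: "real (card (nzv k)) = n" using G.n_eq by (simp add: n_def)
  have n3: "n > 0" using G.n_ge nG by linarith
  let ?e = "\<lambda>i. (2 ^ i - 1) * (x3 i + x4 i) * (2 / n)
      + ((x3 i + x4 i) * (1 / n) + 2 ^ i / fact (i + 1) * (x3 i * (5 / n) + x4 i))"
  let ?f = "\<lambda>i. (2 * (2 ^ i - 1) + 1) * (x3 i + x4 i) + 2 ^ i / fact (i + 1) * (5 * x3 i + n * x4 i)"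
  have "n * (real (d choose i) * (fact (2 * m) / fact (2 * m - 2 * i)) * ?e i)
      = real (d choose i) * ((fact (2 * m) / fact (2 * m - 2 * i)) * ?f i)" for i
    unfolding bracket_summand_scale[OF n3, symmetric] by (simp only: mult.assoc mult.left_commute[of n])
  then have "n * (\<Sum>i = 1..m. real (d choose i) * (fact (2 * m) / fact (2 * m - 2 * i)) * ?e i)
      = (\<Sum>i = 1..m. real (d choose i) * ((fact (2 * m) / fact (2 * m - 2 * i)) * ?f i))"
    unfolding sum_distrib_left by (intro sum.cong refl)
  then have B: "n * ?B = Xp 1 1 (2 * m) d + (5 * x3 0 + n * x4 0)
      + (\<Sum>i = 1..m. real (d choose i) * ((fact (2 * m) / fact (2 * m - 2 * i)) * ?f i))"
    unfolding bracket_scale[OF n3] by (simp only:)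
  have "?S \<le> G.T d * (Xp 1 1 (2 * m) d + (5 * x3 0 + n * x4 0)
      + (\<Sum>i = 1..m. real (d choose i) * ((fact (2 * m) / fact (2 * m - 2 * i)) * ?f i)))"
    using G.sum_total[where d = d and m = m, unfolded nG] by (simp only: x3_def x4_def mult_0_right diff_zero)
  then have "?S \<le> G.T d * (n * ?B)" by (simp only: B)
  then have "?S / G.T d \<le> n * ?B"
    unfolding pos_divide_le_eq[OF G.T_pos] by (simp only: mult.commute[of _ "G.T d"])
  then have "?c * (?S / G.T d) \<le> ?c * (n * ?B)" by (rule mult_left_mono) simp
  then have le: "?c * (?S / G.T d) - 1 \<le> ?c * n * ?B - 1" unfolding mult.assoc[of ?c n ?B] by (rule diff_right_mono)
  have "measure_pmf.expectation (pmf_of_set {ss. length ss = d \<and> set ss \<subseteq> GL2 k}) (\<lambda>ss. abs_mu2 (schreier_norm k ss))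
      \<le> (?c * (?S / G.T d) - 1) powr (1 / (2 * real m))"
    using G.expectation_mu2(2)[OF assms(3)] unfolding G.tuples_def .
  \<comment> \<open>The smaller base is nonnegative because it bounds an even power of the mean from
    above.\<close>
  also have "\<dots> \<le> (?c * n * ?B - 1) powr (1 / (2 * real m))"
    by (rule powr_mono2[OF _ G.mean_trace_ge_1[OF assms(3)] le]) simp
  finally show ?thesis .
qed

end
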